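(* Let $B=B_1\oplus\cdots\oplus B_m$ be as in the context, $0\le k\le \dim B$, $(\underline{k},\underline{r})\in\Omega_k$, and let $\mu:X(\underline{k},\underline{r})\to \mathrm{Gr}_k(B)$ be as in the context. Let $M\in \mathrm{Gr}_k(B)$. The variety $\mu^{-1}(M)$ admits an affine paving $\mu^{-1}(M)=\bigsqcup_{\alpha\in I}S_\alpha$ such that for each $i$ with $1\le i\le m$ the following functions are constant on each piece $S_\alpha$: $$\dim (P_i\cap B_{<i}),\qquad \dim (H_i\cap B_{<i}),\qquad \dim\bigl(P_i\cap(\mathrm{rad}\,\mathrm{pr}_iM+B_{<i})\bigr).$$
   Context: An affine paving of a variety $X$ is a decomposition $X=\bigsqcup_{\alpha\in I}S_\alpha$ into finitely many locally closed subvarieties, each isomorphic to an affine space $\mathbb{A}^{k_\alpha}$, such that $I$ can be totally ordered $\alpha_1<\cdots<\alpha_N$ with $S_{\alpha_1}\cup\cdots\cup S_{\alpha_i}$ closed for every $i$. Setting. $B_1,\dots,B_m$ are nonzero finite-dimensional complex vector spaces, each with a nondegenerate bilinear form $\langle-,-\rangle_{B_i}$ that is symmetric or skew-symmetric; $n_i=\dim B_i$. $B=B_1\oplus\cdots\oplus B_m$, $B_{\le i}=B_1\oplus\cdots\oplus B_i$, $B_{<i}=B_{\le i-1}$. For a subspace $H\subset B$, $\mathrm{pr}_iH=(H\cap B_{\le i})/(H\cap B_{<i})$, regarded as a subspace of $B_i\cong B_{\le i}/B_{<i}$. Orthogonal complements of subspaces of $B_i$ are with respect to $\langle-,-\rangle_{B_i}$,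 and $\mathrm{rad}\,\mathrm{pr}_iM=\mathrm{pr}_iM\cap(\mathrm{pr}_iM)^\perp\subset B_i$. For a space $V$ with nondegenerate form, $\mathcal{C}_{k,r}(V)=\{H\in \mathrm{Gr}_k(V)\mid \dim H-\dim (H\cap H^\perp)=r\}$. If the form is symmetric and $\dim V=2k>0$, $\mathcal{C}_{k,0}(V)$ is a union of two $\mathrm{SO}(V)$-orbits, arbitrarily labelled $\mathcal{C}_{k,0'}(V)$ and $\mathcal{C}_{k,0''}(V)$. $\Omega_k$ is the set of pairs $(\underline{k},\underline{r})$ of $m$-tuples, where $\underline{k}=(k_1,\dots,k_m)$ are nonnegative integers with sum $k$, and $\underline{r}=(r_1,\dots,r_m)$ satisfies for each $i$: $r_i$ is an integer with $\max\{0,2k_i-n_i\}\le r_i\le k_i$, even if the form on $B_i$ is skew-symmetric; except that if the form on $B_i$ is symmetric and $n_i=2k_i$, the value $r_i=0$ is replaced by the two symbols $0'$, $0''$ (read as $0$ in arithmetic expressions). Definition of $X(\underline{k},\underline{r})$. A point is a list of subspaces $P_i,H_i\subset B_{\le i}$ and $\tilde P_i\subset B_i$ for $1\le i\le m$ such that for each $i$ (with $H_0=0$): $\dim\tilde P_i=k_i-r_i$, $\dim P_i=k_1+\cdots+k_{i-1}+k_i-r_i$, $\dim H_i=k_1+\cdots+k_i$, $\tilde P_i\subset\tilde P_i^\perp$, $\mathrm{pr}_iP_i\subset\tilde P_i$, $\mathrm{pr}_iH_i\subset\tilde P_i^\perp$, $H_{i-1}\subset P_i\subset H_i$; and if $r_i\in\{0',0''\}$,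 then $\tilde P_i\in\mathcal{C}_{k_i,r_i}(B_i)$. It is a closed subvariety of a product of Grassmannians. The map $\mu$ sends a point to $H_m\in \mathrm{Gr}_k(B)$. *)

theory Defs
  imports "HOL-Analysis.Analysis"
begin

section \<open>Varieties given by affine charts\<close>

inductive_set polynomial_functions :: "(('v \<Rightarrow> complex) \<Rightarrow> complex) set" where
  const: "(\<lambda>_. c) \<in> polynomial_functions"
| var: "(\<lambda>x. x v) \<in> polynomial_functions"
| add: "\<lbrakk>F \<in> polynomial_functions; G \<in> polynomial_functions\<rbrakk>
    \<Longrightarrow> (\<lambda>x. F x + G x) \<in> polynomial_functions"
| mult: "\<lbrakk>F \<in> polynomial_functions; G \<in> polynomial_functions\<rbrakk>
    \<Longrightarrow> (\<lambda>x. F x * G x) \<in> polynomial_functions"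

text \<open>
  An ambient variety is given by an atlas, a set of pairs \<open>(D, c)\<close>: a Zariski open affine \<open>D\<close>
  together with coordinates \<open>c\<close> that identify \<open>D\<close> with a closed subvariety of an affine space.
  The principal open subsets of the charts form a basis of the Zariski topology.
\<close>

type_synonym ('p, 'v) atlas = "('p set \<times> ('p \<Rightarrow> 'v \<Rightarrow> complex)) set"

definition zariski :: "('p, 'v) atlas \<Rightarrow> 'p topology" where
  "zariski \<A> = topology_generated_by
     {{p \<in> D. F (c p) \<noteq> 0} | D c F. (D, c) \<in> \<A> \<and> F \<in> polynomial_functions}"

text \<open>
  Regular functions on a locally closed subset \<open>S\<close> with its reduced structure: locally a quotient
  of polynomials in the coordinates of a chart.
\<close>

definition regular_on :: "('p, 'v) atlas \<Rightarrow> 'p set \<Rightarrow> ('p \<Rightarrow> complex) \<Rightarrow> bool" where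
  "regular_on \<A> S f \<longleftrightarrow>
     (\<forall>p\<in>S. \<exists>(D, c)\<in>\<A>. \<exists>F\<in>polynomial_functions. \<exists>G\<in>polynomial_functions.
        p \<in> D \<and> G (c p) \<noteq> 0 \<and>
        (\<forall>q\<in>S \<inter> D. G (c q) \<noteq> 0 \<longrightarrow> f q = F (c q) / G (c q)))"

definition morphism ::
  "('p, 'v) atlas \<Rightarrow> 'p set \<Rightarrow> ('q, 'w) atlas \<Rightarrow> 'q set \<Rightarrow> ('p \<Rightarrow> 'q) \<Rightarrow> bool" where
  "morphism \<A> S \<B> T \<phi> \<longleftrightarrow>
     continuous_map (subtopology (zariski \<A>) S) (subtopology (zariski \<B>) T) \<phi> \<and>
     (\<forall>U f. openin (subtopology (zariski \<B>) T) U \<and> regular_on \<B> U f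
        \<longrightarrow> regular_on \<A> {p \<in> S. \<phi> p \<in> U} (f \<circ> \<phi>))"

definition isomorphic_varieties ::
  "('p, 'v) atlas \<Rightarrow> 'p set \<Rightarrow> ('q, 'w) atlas \<Rightarrow> 'q set \<Rightarrow> bool" where
  "isomorphic_varieties \<A> S \<B> T \<longleftrightarrow>
     (\<exists>\<phi> \<psi>. morphism \<A> S \<B> T \<phi> \<and> morphism \<B> T \<A> S \<psi> \<and>
        (\<forall>p\<in>S. \<psi> (\<phi> p) = p) \<and> (\<forall>q\<in>T. \<phi> (\<psi> q) = q))"

definition affine_space :: "nat \<Rightarrow> (nat \<Rightarrow> complex) set" where
  "affine_space d = {x. \<forall>i\<ge>d. x i = 0}"

definition affine_atlas :: "nat \<Rightarrow> (nat \<Rightarrow> complex, nat) atlas" where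
  "affine_atlas d = {(affine_space d, \<lambda>x. x)}"

definition locally_closed_in :: "'p topology \<Rightarrow> 'p set \<Rightarrow> bool" where
  "locally_closed_in T S \<longleftrightarrow> (\<exists>U C. openin T U \<and> closedin T C \<and> S = U \<inter> C)"

text \<open>The list enumerates the pieces in the total order witnessing the paving.\<close>

definition affine_paving :: "('p, 'v) atlas \<Rightarrow> 'p set \<Rightarrow> 'p set list \<Rightarrow> bool" where
  "affine_paving \<A> X Ss \<longleftrightarrow>
     X = \<Union>(set Ss) \<and>
     (\<forall>\<alpha><length Ss. \<forall>\<beta><length Ss. \<alpha> \<noteq> \<beta> \<longrightarrow> Ss ! \<alpha> \<inter> Ss ! \<beta> = {}) \<and>
     (\<forall>S\<in>set Ss. locally_closed_in (subtopology (zariski \<A>) X) S \<and>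
        (\<exists>d. isomorphic_varieties \<A> S (affine_atlas d) (affine_space d))) \<and>
     (\<forall>i\<le>length Ss. closedin (subtopology (zariski \<A>) X) (\<Union>(set (take i Ss))))"


section \<open>Products of Grassmannians\<close>

text \<open>
  Linear algebra over the complex numbers: \<open>vec.subspace\<close>, \<open>vec.span\<close>, \<open>vec.dim\<close> refer to complex
  scalars, whereas the unqualified \<open>subspace\<close>, \<open>span\<close>, \<open>dim\<close> would refer to real ones.
\<close>

definition complementary :: "(complex ^ 'n) set \<Rightarrow> (complex ^ 'n) set \<Rightarrow> bool" where
  "complementary L W \<longleftrightarrow>
     vec.subspace L \<and> vec.subspace W \<and> L \<inter> W = {0} \<and> L + W = UNIV"

text \<open>The matrix of the projection onto \<open>L\<close> along \<open>W\<close>, for complementary \<open>L\<close> and \<open>W\<close>.\<close>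

definition proj_along :: "(complex ^ 'n) set \<Rightarrow> (complex ^ 'n) set \<Rightarrow> complex ^ 'n ^ 'n" where
  "proj_along W L = (THE A. (\<forall>x\<in>L. A *v x = x) \<and> (\<forall>w\<in>W. A *v w = 0))"

text \<open>
  Points are families \<open>L\<close> of subspaces indexed by a finite set \<open>J\<close>; all dimensions are admitted, so
  this is the disjoint union of the products of the Grassmannians of the various dimensions.
  For each family \<open>W\<close> of subspaces there is the standard affine chart of those \<open>L\<close> with
  \<open>L j\<close> complementary to \<open>W j\<close>. For a fixed complement \<open>L0\<close> of \<open>W\<close>, the complements of \<open>W\<close> are the
  graphs of the linear maps \<open>f\<close> from \<open>L0\<close> to \<open>W\<close>, and \<open>proj_along W L = proj_along W L0 + f \<circ> proj_along W L0\<close>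
  for \<open>L\<close> the graph of \<open>f\<close>. So the entries of the projections identify the chart with an affine
  subspace of a product of matrix spaces, compatibly with the usual coordinates \<open>f\<close>.
\<close>

definition grassmann_chart ::
  "'j set \<Rightarrow> ('j \<Rightarrow> (complex ^ 'n) set) \<Rightarrow> ('j \<Rightarrow> (complex ^ 'n) set) set" where
  "grassmann_chart J W = {L \<in> extensional J. \<forall>j\<in>J. complementary (L j) (W j)}"

definition grassmann_coords ::
  "'j set \<Rightarrow> ('j \<Rightarrow> (complex ^ 'n) set) \<Rightarrow> ('j \<Rightarrow> (complex ^ 'n) set) \<Rightarrow> 'j \<times> 'n \<times> 'n \<Rightarrow> complex" where
  "grassmann_coords J W L = (\<lambda>(j, a, b). if j \<in> J then proj_along (W j) (L j) $ a $ b else 0)"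

definition grassmann_atlas ::
  "'j set \<Rightarrow> ('j \<Rightarrow> (complex ^ 'n) set, 'j \<times> 'n \<times> 'n) atlas" where
  "grassmann_atlas J = {(grassmann_chart J W, grassmann_coords J W) | W. True}"


section \<open>Bilinear forms on subspaces\<close>

definition bilinear_form_on ::
  "(complex ^ 'n) set \<Rightarrow> (complex ^ 'n \<Rightarrow> complex ^ 'n \<Rightarrow> complex) \<Rightarrow> bool" where
  "bilinear_form_on V b \<longleftrightarrow>
     (\<forall>x\<in>V. \<forall>y\<in>V. \<forall>z\<in>V. b (x + y) z = b x z + b y z \<and> b z (x + y) = b z x + b z y) \<and>
     (\<forall>c. \<forall>x\<in>V. \<forall>y\<in>V. b (c *s x) y = c * b x y \<and> b x (c *s y) = c * b x y)"

definition symmetric_on :: "'a set \<Rightarrow> ('a \<Rightarrow> 'a \<Rightarrow> complex) \<Rightarrow> bool" where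
  "symmetric_on V b \<longleftrightarrow> (\<forall>x\<in>V. \<forall>y\<in>V. b x y = b y x)"

definition skew_symmetric_on :: "'a set \<Rightarrow> ('a \<Rightarrow> 'a \<Rightarrow> complex) \<Rightarrow> bool" where
  "skew_symmetric_on V b \<longleftrightarrow> (\<forall>x\<in>V. \<forall>y\<in>V. b x y = - b y x)"

text \<open>For symmetric and skew-symmetric forms the left and right conditions agree.\<close>

definition nondegenerate_on ::
  "(complex ^ 'n) set \<Rightarrow> (complex ^ 'n \<Rightarrow> complex ^ 'n \<Rightarrow> complex) \<Rightarrow> bool" where
  "nondegenerate_on V b \<longleftrightarrow> (\<forall>x\<in>V. (\<forall>y\<in>V. b x y = 0) \<longrightarrow> x = 0)"

definition perp ::
  "(complex ^ 'n) set \<Rightarrow> (complex ^ 'n \<Rightarrow> complex ^ 'n \<Rightarrow> complex) \<Rightarrow> (complex ^ 'n) set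
    \<Rightarrow> (complex ^ 'n) set" where
  "perp V b H = {x \<in> V. \<forall>y\<in>H. b x y = 0}"

definition rad ::
  "(complex ^ 'n) set \<Rightarrow> (complex ^ 'n \<Rightarrow> complex ^ 'n \<Rightarrow> complex) \<Rightarrow> (complex ^ 'n) set
    \<Rightarrow> (complex ^ 'n) set" where
  "rad V b H = H \<inter> perp V b H"

definition Gr :: "nat \<Rightarrow> (complex ^ 'n) set \<Rightarrow> (complex ^ 'n) set set" where
  "Gr k V = {H. vec.subspace H \<and> H \<subseteq> V \<and> vec.dim H = k}"

definition rank_locus ::
  "(complex ^ 'n) set \<Rightarrow> (complex ^ 'n \<Rightarrow> complex ^ 'n \<Rightarrow> complex) \<Rightarrow> nat \<Rightarrow> nat
    \<Rightarrow> (complex ^ 'n) set set" where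
  "rank_locus V b k r = {H \<in> Gr k V. vec.dim H - vec.dim (H \<inter> perp V b H) = r}"

text \<open>
  Elements of \<open>SO(V)\<close> are represented by matrices of the ambient space that extend them by the identity
  on some complement of \<open>V\<close>; the determinant of such a matrix is that of its restriction to \<open>V\<close>.
\<close>

definition SO ::
  "(complex ^ 'n) set \<Rightarrow> (complex ^ 'n \<Rightarrow> complex ^ 'n \<Rightarrow> complex) \<Rightarrow> (complex ^ 'n ^ 'n) set" where
  "SO V b = {A. (\<exists>W. complementary V W \<and> (\<forall>w\<in>W. A *v w = w)) \<and>
     (\<forall>x\<in>V. A *v x \<in> V) \<and> (\<forall>x\<in>V. \<forall>y\<in>V. b (A *v x) (A *v y) = b x y) \<and> det A = 1}"

definition SO_orbit ::
  "(complex ^ 'n) set \<Rightarrow> (complex ^ 'n \<Rightarrow> complex ^ 'n \<Rightarrow> complex) \<Rightarrow> (complex ^ 'n) set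
    \<Rightarrow> (complex ^ 'n) set set" where
  "SO_orbit V b H = {(\<lambda>x. A *v x) ` H | A. A \<in> SO V b}"

text \<open>
  \<open>(C1, C2)\<close> is a labelling of the two \<open>SO(V)\<close>-orbits of Lagrangian subspaces, where \<open>dim V\<close> is even.
\<close>

definition lagrangian_labelling ::
  "(complex ^ 'n) set \<Rightarrow> (complex ^ 'n \<Rightarrow> complex ^ 'n \<Rightarrow> complex)
    \<Rightarrow> (complex ^ 'n) set set \<Rightarrow> (complex ^ 'n) set set \<Rightarrow> bool" where
  "lagrangian_labelling V b C1 C2 \<longleftrightarrow>
     (let \<L> = rank_locus V b (vec.dim V div 2) 0 in
        C1 \<in> SO_orbit V b ` \<L> \<and> C2 \<in> SO_orbit V b ` \<L> \<and> C1 \<noteq> C2 \<and> C1 \<union> C2 = \<L>)"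


section \<open>The graded space and the varieties over it\<close>

definition internal_direct_sum :: "nat \<Rightarrow> (nat \<Rightarrow> (complex ^ 'n) set) \<Rightarrow> bool" where
  "internal_direct_sum m V \<longleftrightarrow>
     (\<forall>i\<in>{1..m}. vec.subspace (V i)) \<and>
     (\<forall>x. \<exists>!u. u \<in> (\<Pi>\<^sub>E i\<in>{1..m}. V i) \<and> x = (\<Sum>i\<in>{1..m}. u i))"

definition B_le :: "(nat \<Rightarrow> (complex ^ 'n) set) \<Rightarrow> nat \<Rightarrow> (complex ^ 'n) set" where
  "B_le V i = vec.span (\<Union>j\<in>{1..i}. V j)"

definition B_lt :: "(nat \<Rightarrow> (complex ^ 'n) set) \<Rightarrow> nat \<Rightarrow> (complex ^ 'n) set" where
  "B_lt V i = vec.span (\<Union>j\<in>{1..<i}. V j)"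

text \<open>The image of \<open>H \<inter> B_le V i\<close> in \<open>B_le V i / B_lt V i\<close>, identified with \<open>V i\<close>.\<close>

definition pr :: "(nat \<Rightarrow> (complex ^ 'n) set) \<Rightarrow> nat \<Rightarrow> (complex ^ 'n) set \<Rightarrow> (complex ^ 'n) set" where
  "pr V i H = {v \<in> V i. \<exists>h \<in> H \<inter> B_le V i. h - v \<in> B_lt V i}"

text \<open>\<open>Zero1\<close> and \<open>Zero2\<close> are the symbols \<open>0'\<close> and \<open>0''\<close>.\<close>

datatype rank_symbol = Rank nat | Zero1 | Zero2

fun rank_val :: "rank_symbol \<Rightarrow> nat" where
  "rank_val (Rank r) = r"
| "rank_val Zero1 = 0"
| "rank_val Zero2 = 0"

definition allowed_ranks ::
  "(complex ^ 'n) set \<Rightarrow> (complex ^ 'n \<Rightarrow> complex ^ 'n \<Rightarrow> complex) \<Rightarrow> nat \<Rightarrow> rank_symbol set" where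
  "allowed_ranks V b k =
     (let R = {r. max 0 (2 * int k - int (vec.dim V)) \<le> int r \<and> r \<le> k} in
        if symmetric_on V b \<and> vec.dim V = 2 * k then Rank ` (R - {0}) \<union> {Zero1, Zero2}
        else Rank ` R)"

text \<open>Only the values at \<open>{1..m}\<close> of the functions representing \<open>m\<close>-tuples are relevant.\<close>

definition Omega ::
  "nat \<Rightarrow> (nat \<Rightarrow> (complex ^ 'n) set) \<Rightarrow> (nat \<Rightarrow> complex ^ 'n \<Rightarrow> complex ^ 'n \<Rightarrow> complex)
    \<Rightarrow> nat \<Rightarrow> ((nat \<Rightarrow> nat) \<times> (nat \<Rightarrow> rank_symbol)) set" where
  "Omega m V b k = {(ks, rs). (\<Sum>i\<in>{1..m}. ks i) = k \<and>
     (\<forall>i\<in>{1..m}. rs i \<in> allowed_ranks (V i) (b i) (ks i))}"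

text \<open>A point lists the subspaces \<open>P_i\<close>, \<open>H_i\<close> and \<open>P~_i\<close>, in this order of constructors.\<close>

datatype component = Psub nat | Hsub nat | Ptil nat

definition components :: "nat \<Rightarrow> component set" where
  "components m = Psub ` {1..m} \<union> Hsub ` {1..m} \<union> Ptil ` {1..m}"

type_synonym 'n point = "component \<Rightarrow> (complex ^ 'n) set"

definition H_at :: "'n point \<Rightarrow> nat \<Rightarrow> (complex ^ 'n) set" where
  "H_at x i = (if i = 0 then {0} else x (Hsub i))"

text \<open>
  The arguments \<open>C1\<close>, \<open>C2\<close> give the labelled orbits of Lagrangian subspaces of the \<open>V i\<close>. The Grassmannians
  of \<open>V i\<close> and of \<open>B_le V i\<close> are regarded as closed subvarieties of those of the whole space.
\<close>

definition X_var ::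
  "nat \<Rightarrow> (nat \<Rightarrow> (complex ^ 'n) set) \<Rightarrow> (nat \<Rightarrow> complex ^ 'n \<Rightarrow> complex ^ 'n \<Rightarrow> complex)
    \<Rightarrow> (nat \<Rightarrow> (complex ^ 'n) set set) \<Rightarrow> (nat \<Rightarrow> (complex ^ 'n) set set)
    \<Rightarrow> (nat \<Rightarrow> nat) \<Rightarrow> (nat \<Rightarrow> rank_symbol) \<Rightarrow> 'n point set" where
  "X_var m V b C1 C2 ks rs = {x \<in> extensional (components m). \<forall>i\<in>{1..m}.
     x (Ptil i) \<in> Gr (ks i - rank_val (rs i)) (V i) \<and>
     x (Psub i) \<in> Gr ((\<Sum>j\<in>{1..<i}. ks j) + (ks i - rank_val (rs i))) (B_le V i) \<and>
     x (Hsub i) \<in> Gr (\<Sum>j\<in>{1..i}. ks j) (B_le V i) \<and>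
     x (Ptil i) \<subseteq> perp (V i) (b i) (x (Ptil i)) \<and>
     pr V i (x (Psub i)) \<subseteq> x (Ptil i) \<and>
     pr V i (x (Hsub i)) \<subseteq> perp (V i) (b i) (x (Ptil i)) \<and>
     H_at x (i - 1) \<subseteq> x (Psub i) \<and> x (Psub i) \<subseteq> x (Hsub i) \<and>
     (rs i = Zero1 \<longrightarrow> x (Ptil i) \<in> C1 i) \<and>
     (rs i = Zero2 \<longrightarrow> x (Ptil i) \<in> C2 i)}"

definition mu :: "nat \<Rightarrow> 'n point \<Rightarrow> (complex ^ 'n) set" where
  "mu m x = x (Hsub m)"

end

theory Submission
  imports Defs
begin

text \<open>
  Choose a Witt basis of each \<open>B_i\<close> adapted to \<open>pr_i M\<close>: its vectors \<open>e_1, \<dots>, e_n\<close> satisfy \<open>b e_j e_l \<noteq> 0\<close>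
  exactly for \<open>j + l = n + 1\<close>, the first of them span \<open>rad (pr_i M)\<close>, and \<open>pr_i M\<close> is spanned by basis
  vectors, up to one exceptional vector \<open>e_j - e_(j - 1)\<close> in the middle. These bases form an ordered basis
  \<open>E\<close> of the whole space. The jumps of a subspace \<open>L\<close> are the positions of the leading coordinates of its
  vectors, and they are determined by the dimensions of the intersections of \<open>L\<close> with the flag of \<open>E\<close>.

  The pieces of the paving are the sets of points with prescribed jumps of all \<open>P_i\<close>, \<open>H_i\<close>, \<open>P~_i\<close>. All
  spaces they are intersected with belong to the flag, so the stated functions are constant on the pieces; and since
  the dimensions of intersections are upper semicontinuous, the pieces can be ordered as required.

  It remains to see that a piece is an affine space. It lies in a single chart, where echelon forms give
  coordinates. The conditions that remain are equations \<open>b u v = 0\<close> for \<open>u\<close> in a basis of \<open>pr_i H_i\<close> or \<open>P~_i\<close>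
  and \<open>v\<close> in a basis of \<open>P~_i\<close>. For \<open>u\<close> and \<open>v\<close> with leading positions \<open>j\<close> and \<open>k\<close>, the equation is void unless
  \<open>j\<close> exceeds the position dual to \<open>k\<close>, and then a single coordinate of \<open>u\<close> or \<open>v\<close> of highest degree can be
  eliminated from it. So the system is triangular and its solutions are a graph over the free coordinates.
  The choice of the orbit of a Lagrangian \<open>P~_i\<close> imposes no condition on a piece, because Lagrangian
  subspaces with the same jumps are conjugate under a unipotent isometry.
\<close>

section \<open>Morphisms in compatible charts\<close>

text \<open>The crux is the choice of the coordinate that an equation
  \<open>form (w j) (z k) = 0\<close> is solved for. The vector \<open>w j\<close> lies in
  \<open>M\<close>, so it can be adjusted at \<open>star k\<close> only if \<open>star k\<close> is
  a jump of \<open>M\<close>. The indices in \<open>reg\<close> ensure this: there a basis vector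
  itself lies in \<open>pr_i M\<close>, and its dual index is a jump too or, for a radical vector,
  exceeds all jumps of the block, so that the equation is void. For \<open>k\<close> outside
  \<open>reg\<close> the coordinate of \<open>z k\<close> at \<open>star j\<close> is used instead;
  it is available because \<open>P~_i\<close> need not lie in \<open>pr_i M\<close>. The two choices
  would collide at an index outside \<open>reg\<close> that is a jump of both \<open>H_i\<close> and
  \<open>P~_i\<close>. Only the exceptional vector could cause this, and the isotropy of
  \<open>P~_i\<close> excludes it. Different equations may still share coordinates of the same
  degree; tie-breakers in \<open>rank\<close> settle these cases.\<close>

lemma polynomial_sum:
  "(\<And>i. i \<in> I \<Longrightarrow> F i \<in> polynomial_functions) \<Longrightarrow> (\<lambda>x. \<Sum>i\<in>I. F i x) \<in> polynomial_functions"
  by (induction I rule: infinite_finite_induct) (auto intro: polynomial_functions.intros)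

lemma polynomial_prod:
  "(\<And>i. i \<in> I \<Longrightarrow> F i \<in> polynomial_functions) \<Longrightarrow> (\<lambda>x. \<Prod>i\<in>I. F i x) \<in> polynomial_functions"
  by (induction I rule: infinite_finite_induct) (auto intro: polynomial_functions.intros)

lemma polynomial_uminus: "F \<in> polynomial_functions \<Longrightarrow> (\<lambda>x. - F x) \<in> polynomial_functions"
  using polynomial_functions.mult[OF polynomial_functions.const[of "-1"]] by fastforce

lemma polynomial_diff:
  "F \<in> polynomial_functions \<Longrightarrow> G \<in> polynomial_functions \<Longrightarrow> (\<lambda>x. F x - G x) \<in> polynomial_functions"
  using polynomial_functions.add[OF _ polynomial_uminus, of F G] by simp

lemma polynomial_power: "F \<in> polynomial_functions \<Longrightarrow> (\<lambda>x. F x ^ k) \<in> polynomial_functions"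
  by (induction k) (auto intro: polynomial_functions.intros)

lemma polynomial_subst:
  assumes "F \<in> polynomial_functions" "\<And>v. (\<lambda>x. g x v) \<in> polynomial_functions"
  shows "(\<lambda>x. F (g x)) \<in> polynomial_functions"
  using assms(1) by induction (auto intro: polynomial_functions.intros assms(2))

lemmas polynomial_intros = polynomial_functions.intros polynomial_sum polynomial_prod
  polynomial_uminus polynomial_diff polynomial_power

text \<open>Openness and regularity quantify over the whole atlas. If all overlaps with
  \<open>D\<close> are principal in \<open>D\<close> and all transition functions have the matching
  denominator, both can be tested in the single chart \<open>D\<close>, and each piece of the paving
  lies in a single chart.\<close>

definition compatible_chart :: "('p, 'v) atlas \<Rightarrow> 'p set \<Rightarrow> ('p \<Rightarrow> 'v \<Rightarrow> complex) \<Rightarrow> bool" where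
  "compatible_chart \<A> D c \<longleftrightarrow> (D, c) \<in> \<A> \<and> (\<forall>(D', c')\<in>\<A>. \<exists>\<Delta>\<in>polynomial_functions.
     (\<forall>p\<in>D. p \<in> D' \<longleftrightarrow> \<Delta> (c p) \<noteq> 0) \<and>
     (\<forall>v. \<exists>F\<in>polynomial_functions. \<forall>p\<in>D \<inter> D'. c' p v = F (c p) / \<Delta> (c p)))"

text \<open>Fractions with powers of \<open>\<Delta>\<close> as denominators are closed under sums
  and products. The exponent grows with the degree of \<open>F\<close>, hence the existential
  \<open>k\<close>.\<close>

lemma transition_polynomial:
  assumes F: "F \<in> polynomial_functions" and \<Delta>: "\<Delta> \<in> polynomial_functions"
    and ne: "\<And>p. p \<in> E \<Longrightarrow> \<Delta> (c p) \<noteq> 0"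
    and c': "\<And>v. \<exists>F\<in>polynomial_functions. \<forall>p\<in>E. c' p v = F (c p) / \<Delta> (c p)"
  shows "\<exists>G\<in>polynomial_functions. \<exists>k. \<forall>p\<in>E. F (c' p) = G (c p) / \<Delta> (c p) ^ k"
  using F
proof induction
  case (const a)
  then show ?case
    by (intro bexI[of _ "\<lambda>_. a"] exI[of _ 0]) (auto intro: polynomial_functions.const)
next
  case (var v)
  obtain F where "F \<in> polynomial_functions" "\<forall>p\<in>E. c' p v = F (c p) / \<Delta> (c p)"
    using c' by blast
  then show ?case
    by (intro bexI[of _ F] exI[of _ 1]) auto
next
  case (add F1 F2)
  then obtain G1 G2 k1 k2 where *: "G1 \<in> polynomial_functions" "G2 \<in> polynomial_functions"
    "\<forall>p\<in>E. F1 (c' p) = G1 (c p) / \<Delta> (c p) ^ k1" "\<forall>p\<in>E. F2 (c' p) = G2 (c p) / \<Delta> (c p) ^ k2"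
    by blast
  have "(\<lambda>x. G1 x * \<Delta> x ^ k2 + G2 x * \<Delta> x ^ k1) \<in> polynomial_functions"
    by (intro polynomial_intros * \<Delta>)
  then show ?case
    by (rule bexI[rotated], intro exI[of _ "k1 + k2"]) (auto simp: * ne power_add field_simps)
next
  case (mult F1 F2)
  then obtain G1 G2 k1 k2 where *: "G1 \<in> polynomial_functions" "G2 \<in> polynomial_functions"
    "\<forall>p\<in>E. F1 (c' p) = G1 (c p) / \<Delta> (c p) ^ k1" "\<forall>p\<in>E. F2 (c' p) = G2 (c p) / \<Delta> (c p) ^ k2"
    by blast
  have "(\<lambda>x. G1 x * G2 x) \<in> polynomial_functions"
    by (intro polynomial_intros *)
  then show ?case
    by (rule bexI[rotated], intro exI[of _ "k1 + k2"]) (auto simp: * power_add)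
qed

lemma compatible_chartE:
  assumes "compatible_chart \<A> D c" "(D', c') \<in> \<A>"
  obtains \<Delta> where "\<Delta> \<in> polynomial_functions" "\<And>p. p \<in> D \<Longrightarrow> p \<in> D' \<longleftrightarrow> \<Delta> (c p) \<noteq> 0"
    "\<And>F. F \<in> polynomial_functions \<Longrightarrow>
       \<exists>G\<in>polynomial_functions. \<exists>k. \<forall>p\<in>D \<inter> D'. F (c' p) = G (c p) / \<Delta> (c p) ^ k"
proof -
  have "\<exists>\<Delta>\<in>polynomial_functions. (\<forall>p\<in>D. p \<in> D' \<longleftrightarrow> \<Delta> (c p) \<noteq> 0) \<and>
     (\<forall>v. \<exists>F\<in>polynomial_functions. \<forall>p\<in>D \<inter> D'. c' p v = F (c p) / \<Delta> (c p))"
    using assms unfolding compatible_chart_def by fastforce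
  then obtain \<Delta> where \<Delta>: "\<Delta> \<in> polynomial_functions" "\<forall>p\<in>D. p \<in> D' \<longleftrightarrow> \<Delta> (c p) \<noteq> 0"
     "\<forall>v. \<exists>F\<in>polynomial_functions. \<forall>p\<in>D \<inter> D'. c' p v = F (c p) / \<Delta> (c p)"
    by blast
  show thesis
  proof (rule that[OF \<Delta>(1)])
    show "\<exists>G\<in>polynomial_functions. \<exists>k. \<forall>p\<in>D \<inter> D'. F (c' p) = G (c p) / \<Delta> (c p) ^ k"
      if "F \<in> polynomial_functions" for F
      by (rule transition_polynomial[OF that \<Delta>(1)]) (use \<Delta> in auto)
  qed (use \<Delta> in auto)
qed

lemma openin_zariski_principal:
  "(D, c) \<in> \<A> \<Longrightarrow> F \<in> polynomial_functions \<Longrightarrow> openin (zariski \<A>) {p \<in> D. F (c p) \<noteq> 0}"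
  unfolding zariski_def by (rule topology_generated_by_Basis) blast

lemma openin_zariski_chart: "(D, c) \<in> \<A> \<Longrightarrow> openin (zariski \<A>) D"
  using openin_zariski_principal[of D c \<A> "\<lambda>_. 1"] by (simp add: polynomial_functions.const)

text \<open>The atlas provides only a subbasis, with members from all charts. Induction over the
  generated topology shows that the principal open sets of one compatible chart already form a
  neighbourhood base at its points.\<close>

lemma openin_zariski_in_chart:
  assumes cc: "compatible_chart \<A> D c" and U: "openin (zariski \<A>) U" and p: "p \<in> U" "p \<in> D"
  shows "\<exists>F\<in>polynomial_functions. F (c p) \<noteq> 0 \<and> (\<forall>q\<in>D. F (c q) \<noteq> 0 \<longrightarrow> q \<in> U)"
proof -
  let ?B = "{{p \<in> D. F (c p) \<noteq> 0} | D c F. (D, c) \<in> \<A> \<and> F \<in> polynomial_functions}"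
  have "generate_topology_on ?B U"
    using U unfolding zariski_def openin_topology_generated_by_iff .
  then show ?thesis
    using p
  proof (induction arbitrary: p)
    case (Int U1 U2)
    obtain F1 where F1: "F1 \<in> polynomial_functions" "F1 (c p) \<noteq> 0" "\<forall>q\<in>D. F1 (c q) \<noteq> 0 \<longrightarrow> q \<in> U1"
      using Int.IH(1)[of p] Int.prems by blast
    obtain F2 where F2: "F2 \<in> polynomial_functions" "F2 (c p) \<noteq> 0" "\<forall>q\<in>D. F2 (c q) \<noteq> 0 \<longrightarrow> q \<in> U2"
      using Int.IH(2)[of p] Int.prems by blast
    have "(\<lambda>x. F1 x * F2 x) \<in> polynomial_functions"
      by (intro polynomial_intros F1 F2)
    then show ?case
      by (rule bexI[rotated]) (use F1 F2 in auto)
  next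
    case (UN K)
    then obtain U where U: "U \<in> K" "p \<in> U" by blast
    show ?case using UN.IH[OF U(1) U(2) UN.prems(2)] U(1) by blast
  next
    case (Basis U)
    then obtain D' c' F where *: "U = {p \<in> D'. F (c' p) \<noteq> 0}" "(D', c') \<in> \<A>" "F \<in> polynomial_functions"
      by blast
    obtain \<Delta> where \<Delta>: "\<Delta> \<in> polynomial_functions" "\<And>p. p \<in> D \<Longrightarrow> p \<in> D' \<longleftrightarrow> \<Delta> (c p) \<noteq> 0"
      and ex: "\<And>F. F \<in> polynomial_functions \<Longrightarrow>
         \<exists>G\<in>polynomial_functions. \<exists>k. \<forall>p\<in>D \<inter> D'. F (c' p) = G (c p) / \<Delta> (c p) ^ k"
      by (rule compatible_chartE[OF cc *(2)]) (rule that)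
    obtain G k where G: "G \<in> polynomial_functions" "\<forall>p\<in>D \<inter> D'. F (c' p) = G (c p) / \<Delta> (c p) ^ k"
      using ex[OF *(3)] by blast
    \<comment> \<open>The factor \<open>\<Delta>\<close> confines the nonvanishing locus to
      \<open>D'\<close>, outside of which \<open>G\<close> says nothing about
      \<open>U\<close>.\<close>
    have "(\<lambda>x. G x * \<Delta> x) \<in> polynomial_functions"
      by (intro polynomial_intros G \<Delta>)
    then show ?case
      by (rule bexI[rotated]) (use Basis.prems G \<Delta> * in auto)
  qed auto
qed

lemma regular_on_in_chart:
  assumes cc: "compatible_chart \<A> D c" and f: "regular_on \<A> S f" and S: "S \<subseteq> D" and p: "p \<in> S"
  shows "\<exists>F\<in>polynomial_functions. \<exists>G\<in>polynomial_functions.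
    G (c p) \<noteq> 0 \<and> (\<forall>q\<in>S. G (c q) \<noteq> 0 \<longrightarrow> f q = F (c q) / G (c q))"
proof -
  obtain D' c' F G where *: "(D', c') \<in> \<A>" "F \<in> polynomial_functions" "G \<in> polynomial_functions"
    "p \<in> D'" "G (c' p) \<noteq> 0" "\<forall>q\<in>S \<inter> D'. G (c' q) \<noteq> 0 \<longrightarrow> f q = F (c' q) / G (c' q)"
    using f p unfolding regular_on_def by blast
  obtain \<Delta> where \<Delta>: "\<Delta> \<in> polynomial_functions" "\<And>p. p \<in> D \<Longrightarrow> p \<in> D' \<longleftrightarrow> \<Delta> (c p) \<noteq> 0"
      and ex: "\<And>F. F \<in> polynomial_functions \<Longrightarrow>
         \<exists>G\<in>polynomial_functions. \<exists>k. \<forall>p\<in>D \<inter> D'. F (c' p) = G (c p) / \<Delta> (c p) ^ k"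
    by (rule compatible_chartE[OF cc *(1)]) (rule that)
  obtain F1 k where F1: "F1 \<in> polynomial_functions" "\<forall>p\<in>D \<inter> D'. F (c' p) = F1 (c p) / \<Delta> (c p) ^ k"
    using ex[OF *(2)] by blast
  obtain G1 l where G1: "G1 \<in> polynomial_functions" "\<forall>p\<in>D \<inter> D'. G (c' p) = G1 (c p) / \<Delta> (c p) ^ l"
    using ex[OF *(3)] by blast
  have pD: "p \<in> D" using S p by auto
  \<comment> \<open>Clearing denominators gives \<open>F1 * \<Delta> ^ l\<close> over
    \<open>G1 * \<Delta> ^ k\<close>; one more factor \<open>\<Delta>\<close> in both restricts the
    identity to points of \<open>D'\<close>, even if \<open>k = 0\<close>.\<close>
  have 1: "G1 (c p) * \<Delta> (c p) ^ k * \<Delta> (c p) \<noteq> 0"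
    using * G1(2) pD \<Delta>(2) by auto
  have 2: "f q = (F1 (c q) * \<Delta> (c q) ^ l * \<Delta> (c q)) / (G1 (c q) * \<Delta> (c q) ^ k * \<Delta> (c q))"
    if "q \<in> S" "G1 (c q) * \<Delta> (c q) ^ k * \<Delta> (c q) \<noteq> 0" for q
  proof -
    have q: "q \<in> D" "q \<in> D'" using that S \<Delta>(2) by auto
    then have "f q = F (c' q) / G (c' q)" using * that G1 by auto
    then show ?thesis using F1(2) G1(2) q that by (simp add: field_simps)
  qed
  have F': "(\<lambda>x. F1 x * \<Delta> x ^ l * \<Delta> x) \<in> polynomial_functions"
    by (intro polynomial_intros F1 \<Delta>)
  have G': "(\<lambda>x. G1 x * \<Delta> x ^ k * \<Delta> x) \<in> polynomial_functions"
    by (intro polynomial_intros G1 \<Delta>)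
  show ?thesis
  proof (rule bexI[OF _ F'], rule bexI[OF _ G'], intro conjI ballI impI)
    show "G1 (c p) * \<Delta> (c p) ^ k * \<Delta> (c p) \<noteq> 0"
      by (rule 1)
    show "f q = (F1 (c q) * \<Delta> (c q) ^ l * \<Delta> (c q)) / (G1 (c q) * \<Delta> (c q) ^ k * \<Delta> (c q))"
      if "q \<in> S" "G1 (c q) * \<Delta> (c q) ^ k * \<Delta> (c q) \<noteq> 0" for q
      by (rule 2[OF that])
  qed
qed

text \<open>Pulling back along \<open>\<phi>\<close> is substitution of polynomials, which turns
  principal open sets into principal open sets and quotients into quotients. Only the two chosen
  charts are needed, since both are compatible.\<close>

lemma morphism_if_polynomial:
  assumes A: "compatible_chart \<A> D c" and B: "compatible_chart \<B> D' c'"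
    and S: "S \<subseteq> D" and T: "T \<subseteq> D'" and maps: "\<And>p. p \<in> S \<Longrightarrow> \<phi> p \<in> T"
    and poly: "\<And>v. \<exists>\<Phi>\<in>polynomial_functions. \<forall>p\<in>S. c' (\<phi> p) v = \<Phi> (c p)"
  shows "morphism \<A> S \<B> T \<phi>"
proof -
  obtain \<Phi> where \<Phi>: "\<And>v. \<Phi> v \<in> polynomial_functions" "\<And>v p. p \<in> S \<Longrightarrow> c' (\<phi> p) v = \<Phi> v (c p)"
    using poly by metis
  have pull: "(\<lambda>x. F (\<lambda>v. \<Phi> v x)) \<in> polynomial_functions" if "F \<in> polynomial_functions" for F
    by (rule polynomial_subst[OF that]) (simp add: \<Phi>)
  have pull_eq: "c' (\<phi> p) = (\<lambda>v. \<Phi> v (c p))" if "p \<in> S" for p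
    by (rule ext) (simp add: \<Phi> that)
  have Dc: "(D, c) \<in> \<A>" "(D', c') \<in> \<B>" using A B by (auto simp: compatible_chart_def)
  have topS: "topspace (subtopology (zariski \<A>) S) = S"
    using openin_subset[OF openin_zariski_chart[OF Dc(1)]] S by auto
  have topT: "topspace (subtopology (zariski \<B>) T) = T"
    using openin_subset[OF openin_zariski_chart[OF Dc(2)]] T by auto
  have op: "openin (subtopology (zariski \<A>) S) {p \<in> S. \<phi> p \<in> U}"
    if U: "openin (subtopology (zariski \<B>) T) U" for U
  proof (rule openin_subopen[THEN iffD2], rule ballI)
    fix p assume "p \<in> {p \<in> S. \<phi> p \<in> U}"
    then have p: "p \<in> S" "\<phi> p \<in> U" by auto
    obtain U' where U': "openin (zariski \<B>) U'" "U = U' \<inter> T"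
      using U unfolding openin_subtopology by blast
    obtain F where F: "F \<in> polynomial_functions" "F (c' (\<phi> p)) \<noteq> 0" "\<forall>q\<in>D'. F (c' q) \<noteq> 0 \<longrightarrow> q \<in> U'"
      using openin_zariski_in_chart[OF B U'(1)] p U' maps T by blast
    let ?O = "{p \<in> D. F (\<lambda>v. \<Phi> v (c p)) \<noteq> 0} \<inter> S"
    have "openin (subtopology (zariski \<A>) S) ?O"
      using openin_zariski_principal[OF Dc(1) pull[OF F(1)]] by (auto simp: openin_subtopology)
    moreover have "p \<in> ?O" using p F S pull_eq by auto
    moreover have "\<phi> q \<in> U" if "q \<in> ?O" for q
    proof -
      have "F (c' (\<phi> q)) \<noteq> 0" using that pull_eq by simp
      then show ?thesis using F(3) U' maps T that by blast
    qed
    ultimately show "\<exists>T. openin (subtopology (zariski \<A>) S) T \<and> p \<in> T \<and> T \<subseteq> {p \<in> S. \<phi> p \<in> U}"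
      by blast
  qed
  show ?thesis
    unfolding morphism_def
  proof (intro conjI allI impI)
    show "continuous_map (subtopology (zariski \<A>) S) (subtopology (zariski \<B>) T) \<phi>"
      unfolding continuous_map_def topS topT using maps op by auto
  next
    fix U f assume Uf: "openin (subtopology (zariski \<B>) T) U \<and> regular_on \<B> U f"
    then have UT: "U \<subseteq> T" using openin_subset topT by metis
    show "regular_on \<A> {p \<in> S. \<phi> p \<in> U} (f \<circ> \<phi>)"
      unfolding regular_on_def
    proof safe
      fix p assume p: "p \<in> S" "\<phi> p \<in> U"
      obtain F G where FG: "F \<in> polynomial_functions" "G \<in> polynomial_functions" "G (c' (\<phi> p)) \<noteq> 0"
        "\<forall>q\<in>U. G (c' q) \<noteq> 0 \<longrightarrow> f q = F (c' q) / G (c' q)"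
        using regular_on_in_chart[OF B, of U f "\<phi> p"] Uf p UT T by blast
      show "\<exists>(D, c)\<in>\<A>. \<exists>F\<in>polynomial_functions. \<exists>G\<in>polynomial_functions. p \<in> D \<and> G (c p) \<noteq> 0 \<and>
         (\<forall>q\<in>{p \<in> S. \<phi> p \<in> U} \<inter> D. G (c q) \<noteq> 0 \<longrightarrow> (f \<circ> \<phi>) q = F (c q) / G (c q))"
      proof (rule bexI[OF _ Dc(1)], simp only: prod.case,
            rule bexI[OF _ pull[OF FG(1)]], rule bexI[OF _ pull[OF FG(2)]], intro conjI ballI impI)
        show "p \<in> D" using p S by blast
        show "G (\<lambda>v. \<Phi> v (c p)) \<noteq> 0"
          using FG(3) p pull_eq by simp
        show "(f \<circ> \<phi>) q = F (\<lambda>v. \<Phi> v (c q)) / G (\<lambda>v. \<Phi> v (c q))"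
          if q: "q \<in> {p \<in> S. \<phi> p \<in> U} \<inter> D" "G (\<lambda>v. \<Phi> v (c q)) \<noteq> 0" for q
        proof -
          have "c' (\<phi> q) = (\<lambda>v. \<Phi> v (c q))" using pull_eq q(1) by blast
          then show ?thesis using FG(4)[rule_format, of "\<phi> q"] q by simp
        qed
      qed
    qed
  qed
qed

lemma compatible_chart_affine: "compatible_chart (affine_atlas d) (affine_space d) (\<lambda>x. x)"
  unfolding compatible_chart_def affine_atlas_def
proof (simp only: ball_simps prod.case singleton_iff simp_thms)
  show "\<exists>\<Delta>\<in>polynomial_functions. (\<forall>p\<in>affine_space d. (p \<in> affine_space d) = (\<Delta> p \<noteq> 0)) \<and>
    (\<forall>v. \<exists>F\<in>polynomial_functions. \<forall>p\<in>affine_space d \<inter> affine_space d. p v = F p / \<Delta> p)"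
  proof (rule bexI[OF _ polynomial_functions.const[of 1]], intro conjI allI)
    fix v show "\<exists>F\<in>polynomial_functions. \<forall>p\<in>affine_space d \<inter> affine_space d. p v = F p / 1"
      by (rule bexI[OF _ polynomial_functions.var[of v]]) simp
  qed simp
qed

lemma isomorphic_affine_if_polynomial:
  assumes cc: "compatible_chart \<A> D c" and S: "S \<subseteq> D"
    and \<phi>: "\<And>p. p \<in> S \<Longrightarrow> \<phi> p \<in> affine_space d" and \<psi>: "\<And>t. t \<in> affine_space d \<Longrightarrow> \<psi> t \<in> S"
    and inv: "\<And>p. p \<in> S \<Longrightarrow> \<psi> (\<phi> p) = p" "\<And>t. t \<in> affine_space d \<Longrightarrow> \<phi> (\<psi> t) = t"
    and p1: "\<And>v. \<exists>\<Phi>\<in>polynomial_functions. \<forall>p\<in>S. \<phi> p v = \<Phi> (c p)"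
    and p2: "\<And>v. \<exists>\<Psi>\<in>polynomial_functions. \<forall>t\<in>affine_space d. c (\<psi> t) v = \<Psi> t"
  shows "isomorphic_varieties \<A> S (affine_atlas d) (affine_space d)"
  unfolding isomorphic_varieties_def
proof (intro exI[of _ \<phi>] exI[of _ \<psi>] conjI ballI)
  show "morphism \<A> S (affine_atlas d) (affine_space d) \<phi>"
    by (rule morphism_if_polynomial[OF cc compatible_chart_affine S subset_refl]) (fact \<phi> p1)+
  show "morphism (affine_atlas d) (affine_space d) \<A> S \<psi>"
    by (rule morphism_if_polynomial[OF compatible_chart_affine cc subset_refl S]) (fact \<psi> p2)+
qed (fact inv)+

section \<open>Pavings by fibres of semicontinuous functions\<close>

text \<open>Near \<open>x\<close> all values are at most those at \<open>x\<close>; a nearby point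
  with at least the same total therefore has the same values. This one remark yields both the local
  closedness of the fibres and, with fibres of larger total coming first, the closedness of the
  initial unions.\<close>

lemma affine_paving_by_fibres:
  fixes d :: "'k \<Rightarrow> 'p \<Rightarrow> nat"
  assumes X: "X \<subseteq> topspace (zariski \<A>)" and K: "finite K"
    and bound: "\<And>k x. k \<in> K \<Longrightarrow> x \<in> X \<Longrightarrow> d k x \<le> N"
    and semicont: "\<And>k x. k \<in> K \<Longrightarrow> x \<in> X \<Longrightarrow>
      \<exists>U. openin (zariski \<A>) U \<and> x \<in> U \<and> (\<forall>y\<in>U \<inter> X. d k y \<le> d k x)"
    and cell: "\<And>x0. x0 \<in> X \<Longrightarrow>
      \<exists>e. isomorphic_varieties \<A> {x \<in> X. \<forall>k\<in>K. d k x = d k x0} (affine_atlas e) (affine_space e)"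
  shows "\<exists>Ss. affine_paving \<A> X Ss \<and> (\<forall>S\<in>set Ss. \<forall>k\<in>K. d k constant_on S)"
proof -
  define fib where "fib x0 = {x \<in> X. \<forall>k\<in>K. d k x = d k x0}" for x0
  define tot where "tot S = (\<Sum>k\<in>K. d k (SOME x. x \<in> S))" for S
  let ?F = "fib ` X"
  have "finite ?F"
  proof (rule finite_surj)
    show "finite (K \<rightarrow>\<^sub>E {..N})" by (intro finite_PiE K) auto
    show "?F \<subseteq> (\<lambda>\<delta>. {x \<in> X. \<forall>k\<in>K. d k x = \<delta> k}) ` (K \<rightarrow>\<^sub>E {..N})"
    proof (rule image_subsetI, rule image_eqI)
      fix x assume "x \<in> X"
      then show "restrict (\<lambda>k. d k x) K \<in> K \<rightarrow>\<^sub>E {..N}" using bound by auto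
    qed (auto simp: fib_def)
  qed
  then obtain xs where xs: "set xs = ?F" "distinct xs"
    using finite_distinct_list by blast
  \<comment> \<open>Negated totals, because \<open>sort_key\<close> sorts increasingly and the
    fibres with the largest total have to come first.\<close>
  define Ss where "Ss = sort_key (\<lambda>S. - int (tot S)) xs"
  have Ss: "set Ss = ?F" "distinct Ss" "sorted (map (\<lambda>S. - int (tot S)) Ss)"
    using xs by (auto simp: Ss_def)
  have fib_eq: "fib x = fib y" if "x \<in> fib y" for x y
    using that by (auto simp: fib_def)
  have self: "x \<in> fib x" if "x \<in> X" for x using that by (auto simp: fib_def)
  have tot: "tot (fib x) = (\<Sum>k\<in>K. d k x)" if "x \<in> X" for x
  proof -
    have "(SOME y. y \<in> fib x) \<in> fib x" by (rule someI[of _ x], rule self[OF that])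
    then show ?thesis by (auto simp: tot_def fib_def)
  qed
  have mem: "x \<in> X" "S = fib x" if S: "S \<in> set Ss" and x: "x \<in> S" for x S
  proof -
    obtain z where "S = fib z" using S Ss(1) by blast
    then show "x \<in> X" "S = fib x" using x fib_eq[of x z] by (auto simp: fib_def)
  qed
  have nbhd: "\<exists>U. openin (zariski \<A>) U \<and> x \<in> U \<and> (\<forall>y\<in>U \<inter> X. \<forall>k\<in>K. d k y \<le> d k x)"
    if x: "x \<in> X" for x
  proof -
    obtain U where U: "\<And>k. k \<in> K \<Longrightarrow> openin (zariski \<A>) (U k)" "\<And>k. k \<in> K \<Longrightarrow> x \<in> U k"
      "\<And>k y. k \<in> K \<Longrightarrow> y \<in> U k \<inter> X \<Longrightarrow> d k y \<le> d k x"
      using semicont[OF _ x] by metis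
    show ?thesis
    proof (cases "K = {}")
      case True
      then show ?thesis using X x by blast
    next
      case False
      have "openin (zariski \<A>) (\<Inter>k\<in>K. U k)"
        by (rule openin_INT2) (use K U False in auto)
      then show ?thesis
        using U by (intro exI[of _ "\<Inter>k\<in>K. U k"]) blast
    qed
  qed
  have top: "topspace (subtopology (zariski \<A>) X) = X" using X by auto
  \<comment> \<open>With \<open>nbhd\<close>, closedness becomes a purely order-theoretic condition
    on the values: the complement has to be stable under lowering them.\<close>
  have cl: "closedin (subtopology (zariski \<A>) X) C"
    if C: "C \<subseteq> X" and up: "\<And>x y. x \<in> X - C \<Longrightarrow> y \<in> X \<Longrightarrow> \<forall>k\<in>K. d k y \<le> d k x \<Longrightarrow> y \<notin> C" for C
    unfolding closedin_def top
  proof (intro conjI C openin_subopen[THEN iffD2] ballI)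
    fix x assume x: "x \<in> X - C"
    then obtain U where U: "openin (zariski \<A>) U" "x \<in> U" "\<forall>y\<in>U \<inter> X. \<forall>k\<in>K. d k y \<le> d k x"
      using nbhd by blast
    then have "openin (subtopology (zariski \<A>) X) (U \<inter> X)" "x \<in> U \<inter> X" "U \<inter> X \<subseteq> X - C"
      using x up by (auto simp: openin_subtopology)
    then show "\<exists>T. openin (subtopology (zariski \<A>) X) T \<and> x \<in> T \<and> T \<subseteq> X - C" by blast
  qed
  have "affine_paving \<A> X Ss"
    unfolding affine_paving_def
  proof (intro conjI allI impI ballI)
    show "X = \<Union> (set Ss)" unfolding Ss(1) using self by (auto simp: fib_def)
  next
    fix \<alpha> \<beta> assume "\<alpha> < length Ss" "\<beta> < length Ss" "\<alpha> \<noteq> \<beta>"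
    then have ne: "Ss ! \<alpha> \<noteq> Ss ! \<beta>" and in_Ss: "Ss ! \<alpha> \<in> set Ss" "Ss ! \<beta> \<in> set Ss"
      using Ss(2) by (simp_all add: nth_eq_iff_index_eq)
    have False if "x \<in> Ss ! \<alpha>" "x \<in> Ss ! \<beta>" for x
      using mem(2)[OF in_Ss(1) that(1)] mem(2)[OF in_Ss(2) that(2)] ne by simp
    then show "Ss ! \<alpha> \<inter> Ss ! \<beta> = {}" by blast
  next
    fix S assume S: "S \<in> set Ss"
    then obtain x0 where x0: "x0 \<in> X" "S = fib x0" using Ss(1) by auto
    show "\<exists>d. isomorphic_varieties \<A> S (affine_atlas d) (affine_space d)"
      using cell[OF x0(1)] unfolding x0(2) fib_def .
    \<comment> \<open>\<open>?U\<close> bounds every value from above and \<open>?C\<close> bounds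
      the total from below, which forces equality of all values on the intersection.\<close>
    let ?U = "{x \<in> X. \<forall>k\<in>K. d k x \<le> d k x0}" and ?C = "{x \<in> X. (\<Sum>k\<in>K. d k x0) \<le> (\<Sum>k\<in>K. d k x)}"
    have "closedin (subtopology (zariski \<A>) X) (X - ?U)"
    proof (rule cl)
      fix x y assume "x \<in> X - (X - ?U)" "y \<in> X" "\<forall>k\<in>K. d k y \<le> d k x"
      then have "y \<in> ?U" using order_trans by fastforce
      then show "y \<notin> X - ?U" by blast
    qed blast
    then have "openin (subtopology (zariski \<A>) X) (X - (X - ?U))"
      unfolding closedin_def top by blast
    moreover have "X - (X - ?U) = ?U" by auto
    ultimately have "openin (subtopology (zariski \<A>) X) ?U" by simp
    moreover have "closedin (subtopology (zariski \<A>) X) ?C"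
    proof (rule cl)
      fix x y assume "x \<in> X - ?C" "y \<in> X" "\<forall>k\<in>K. d k y \<le> d k x"
      then show "y \<notin> ?C" using sum_mono[of K "\<lambda>k. d k y" "\<lambda>k. d k x"] by auto
    qed auto
    moreover have "S = ?U \<inter> ?C"
    proof
      show "?U \<inter> ?C \<subseteq> S"
      proof
        fix x assume x: "x \<in> ?U \<inter> ?C"
        then have "(\<Sum>k\<in>K. d k x) = (\<Sum>k\<in>K. d k x0)"
          using sum_mono[of K "\<lambda>k. d k x" "\<lambda>k. d k x0"] by auto
        then have "d k x = d k x0" if "k \<in> K" for k
          using x that sum_mono_inv[of "\<lambda>k. d k x" K "\<lambda>k. d k x0" k] K by auto
        then show "x \<in> S" using x x0 by (auto simp: fib_def)
      qed
    qed (auto simp: x0 fib_def)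
    ultimately show "locally_closed_in (subtopology (zariski \<A>) X) S"
      unfolding locally_closed_in_def by blast
  next
    fix i assume i: "i \<le> length Ss"
    show "closedin (subtopology (zariski \<A>) X) (\<Union> (set (take i Ss)))"
    proof (rule cl)
      show "\<Union> (set (take i Ss)) \<subseteq> X" using mem(1) in_set_takeD by (metis Union_least subsetI)
    next
      fix x y assume x: "x \<in> X - \<Union> (set (take i Ss))" and y: "y \<in> X" and le: "\<forall>k\<in>K. d k y \<le> d k x"
      show "y \<notin> \<Union> (set (take i Ss))"
      proof
        assume "y \<in> \<Union> (set (take i Ss))"
        then obtain S where S: "S \<in> set (take i Ss)" "y \<in> S" by blast
        then have fy: "fib y \<in> set (take i Ss)"
          using mem(2)[OF in_set_takeD[OF S(1)] S(2)] by simp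
        then obtain p where p: "p < i" "p < length Ss" "Ss ! p = fib y"
          by (auto simp: in_set_conv_nth)
        have "fib x \<in> set Ss" using x Ss(1) by auto
        then obtain q where q: "q < length Ss" "Ss ! q = fib x"
          by (auto simp: in_set_conv_nth)
        have "q \<ge> i"
        proof (rule ccontr)
          assume "\<not> q \<ge> i"
          then have "Ss ! q \<in> set (take i Ss)"
            using q(1) i by (intro in_set_conv_nth[THEN iffD2] exI[of _ q]) simp
          then show False using x self[of x] q by auto
        qed
        then have "- int (tot (fib y)) \<le> - int (tot (fib x))"
          using sorted_nth_mono[OF Ss(3), of p q] p q by simp
        then have "tot (fib x) \<le> tot (fib y)" by linarith
        then have ge: "(\<Sum>k\<in>K. d k x) \<le> (\<Sum>k\<in>K. d k y)"
          using tot[of x] tot[OF y] x by simp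
        have "d k y = d k x" if "k \<in> K" for k
        proof (rule sum_mono_inv[OF _ _ that K])
          show "(\<Sum>k\<in>K. d k y) = (\<Sum>k\<in>K. d k x)"
            using ge sum_mono[of K "\<lambda>k. d k y" "\<lambda>k. d k x"] le by simp
        qed (use le in auto)
        then have "x \<in> fib y" using x by (auto simp: fib_def)
        then show False using fy x by auto
      qed
    qed
  qed
  moreover have "d k constant_on S" if "S \<in> set Ss" "k \<in> K" for S k
    using that Ss(1) by (auto simp: fib_def constant_on_def)
  ultimately show ?thesis by blast
qed

section \<open>The charts of the Grassmannians\<close>

lemma span_Un_plus: "vec.span (A \<union> B) = vec.span A + (vec.span B :: ('a::field ^ 'n) set)"
  unfolding vec.span_Un set_plus_def by blast

lemma independent_Un_bases:
  fixes BL BW :: "('a::field ^ 'n) set"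
  assumes "vec.independent BL" "vec.independent BW" "vec.span BL \<inter> vec.span BW = {0}"
  shows "vec.independent (BL \<union> BW)" "BL \<inter> BW = {}"
proof -
  have half: "a \<notin> vec.span (A \<union> C - {a})"
    if "vec.independent A" "vec.independent C" "vec.span A \<inter> vec.span C = {0}" "a \<in> A" for A C and a :: "'a ^ 'n"
  proof
    assume a: "a \<in> vec.span (A \<union> C - {a})"
    have "A \<union> C - {a} \<subseteq> (A - {a}) \<union> C" by auto
    then have "a \<in> vec.span ((A - {a}) \<union> C)" using a vec.span_mono by blast
    then obtain l g where lg: "l \<in> vec.span (A - {a})" "g \<in> vec.span C" "a = l + g"
      unfolding vec.span_Un by auto
    have "l \<in> vec.span A" using lg(1) vec.span_mono[of "A - {a}" A] by auto
    then have "a - l \<in> vec.span A" using that(4) by (intro vec.span_diff) (auto intro: vec.span_base)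
    then have "g \<in> vec.span A \<inter> vec.span C" using lg by auto
    then have "a = l" using that(3) lg by auto
    then show False using lg that(1,4) by (auto simp: vec.dependent_def)
  qed
  have "a \<notin> vec.span (BL \<union> BW - {a})" if "a \<in> BL \<union> BW" for a
    using half[OF assms, of a] half[OF assms(2,1), of a] assms(3) that
    by (auto simp: Int_commute Un_commute)
  then show "vec.independent (BL \<union> BW)"
    unfolding vec.dependent_def by blast
  show "BL \<inter> BW = {}"
  proof (rule ccontr)
    assume "BL \<inter> BW \<noteq> {}"
    then obtain a where "a \<in> BL" "a \<in> BW" by auto
    then have "a = 0" using assms(3) vec.span_base by blast
    then show False using \<open>a \<in> BL\<close> assms(1) vec.dependent_zero by blast
  qed
qed

lemma span_Int_span_Diff:
  fixes B :: "('a::field ^ 'n) set"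
  assumes B: "vec.independent B" and A: "A \<subseteq> B"
  shows "vec.span A \<inter> vec.span (B - A) = {0}"
proof -
  have "x = 0" if "x \<in> vec.span A" "x \<in> vec.span (B - A)" for x
  proof -
    have 1: "vec.representation B x = vec.representation A x"
      by (rule vec.representation_extend[OF B that(1) A])
    have 2: "vec.representation B x = vec.representation (B - A) x"
      by (rule vec.representation_extend[OF B that(2)]) auto
    have "vec.representation B x b = 0" for b
    proof (rule ccontr)
      assume "vec.representation B x b \<noteq> 0"
      then have "b \<in> A" "b \<in> B - A"
        using vec.representation_ne_zero[of A x b] vec.representation_ne_zero[of "B - A" x b] 1 2 by auto
      then show False by auto
    qed
    moreover have "x \<in> vec.span B" using that(1) vec.span_mono[OF A] by auto
    ultimately show "x = 0"
      using vec.sum_nonzero_representation_eq[OF B] by fastforce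
  qed
  then show ?thesis by (auto intro: vec.span_zero)
qed

lemma dim_add_le:
  fixes L W :: "('a::field ^ 'n) set"
  assumes "vec.subspace L" "vec.subspace W" "L \<inter> W = {0}" "L \<subseteq> G" "W \<subseteq> G"
  shows "vec.dim L + vec.dim W \<le> vec.dim G"
proof -
  obtain BL where BL: "BL \<subseteq> L" "vec.independent BL" "vec.span BL = L" "card BL = vec.dim L"
    using vec.basis_subspace_exists[OF assms(1)] by metis
  obtain BW where BW: "BW \<subseteq> W" "vec.independent BW" "vec.span BW = W" "card BW = vec.dim W"
    using vec.basis_subspace_exists[OF assms(2)] by metis
  have "vec.independent (BL \<union> BW)" "BL \<inter> BW = {}"
    using independent_Un_bases[OF BL(2) BW(2)] BL BW assms(3) by auto
  moreover have "BL \<union> BW \<subseteq> G" using BL(1) BW(1) assms(4,5) by blast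
  ultimately show ?thesis
    using vec.independent_card_le_dim[of "BL \<union> BW" G] BL(4) BW(4)
    by (simp add: card_Un_disjoint vec.finiteI_independent BL(2) BW(2))
qed

lemma complementaryI_dim:
  fixes L W :: "(complex ^ 'n) set"
  assumes "vec.subspace L" "vec.subspace W" "L \<inter> W = {0}" "CARD('n) \<le> vec.dim L + vec.dim W"
  shows "complementary L W"
proof -
  obtain BL where BL: "BL \<subseteq> L" "vec.independent BL" "vec.span BL = L" "card BL = vec.dim L"
    using vec.basis_subspace_exists[OF assms(1)] by metis
  obtain BW where BW: "BW \<subseteq> W" "vec.independent BW" "vec.span BW = W" "card BW = vec.dim W"
    using vec.basis_subspace_exists[OF assms(2)] by metis
  have ind: "vec.independent (BL \<union> BW)" "BL \<inter> BW = {}"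
    using independent_Un_bases[OF BL(2) BW(2)] BL BW assms(3) by auto
  have "UNIV \<subseteq> vec.span (BL \<union> BW)"
    by (rule vec.card_ge_dim_independent)
       (use ind BL BW assms(4) in \<open>auto simp: card_Un_disjoint vec.finiteI_independent card_cart_basis\<close>)
  then have "L + W = UNIV"
    using BL(3) BW(3) by (auto simp: span_Un_plus)
  then show ?thesis using assms by (auto simp: complementary_def)
qed

lemma complementary_dim:
  fixes L W :: "(complex ^ 'n) set"
  assumes "complementary L W"
  shows "vec.dim L + vec.dim W = CARD('n)"
proof -
  have s: "vec.subspace L" "vec.subspace W" "L \<inter> W = {0}" "L + W = UNIV"
    using assms by (auto simp: complementary_def)
  obtain BL where BL: "BL \<subseteq> L" "vec.independent BL" "vec.span BL = L" "card BL = vec.dim L"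
    using vec.basis_subspace_exists[OF s(1)] by metis
  obtain BW where BW: "BW \<subseteq> W" "vec.independent BW" "vec.span BW = W" "card BW = vec.dim W"
    using vec.basis_subspace_exists[OF s(2)] by metis
  have ind: "vec.independent (BL \<union> BW)" "BL \<inter> BW = {}"
    using independent_Un_bases[OF BL(2) BW(2)] BL BW s(3) by auto
  have "vec.span (BL \<union> BW) = UNIV"
    using s(4) BL(3) BW(3) by (simp add: span_Un_plus)
  then have "vec.dim (UNIV :: (complex ^ 'n) set) = card (BL \<union> BW)"
    using vec.dim_eq_card[of "BL \<union> BW" UNIV] ind by simp
  then show ?thesis
    using ind BL BW by (simp add: card_Un_disjoint vec.finiteI_independent card_cart_basis)
qed

lemma complementaryI_sum:
  fixes L W :: "(complex ^ 'n) set"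
  assumes "vec.subspace L" "vec.subspace W" "L + W = UNIV" "vec.dim L + vec.dim W \<le> CARD('n)"
  shows "complementary L W"
proof -
  obtain BL where BL: "BL \<subseteq> L" "vec.independent BL" "vec.span BL = L" "card BL = vec.dim L"
    using vec.basis_subspace_exists[OF assms(1)] by metis
  obtain BW where BW: "BW \<subseteq> W" "vec.independent BW" "vec.span BW = W" "card BW = vec.dim W"
    using vec.basis_subspace_exists[OF assms(2)] by metis
  have fin: "finite BL" "finite BW" using BL BW by (auto intro: vec.finiteI_independent)
  have sp: "vec.span (BL \<union> BW) = UNIV"
    using assms(3) BL(3) BW(3) by (simp add: span_Un_plus)
  have le: "card (BL \<union> BW) \<le> CARD('n)"
    using card_Un_le[of BL BW] BL BW assms(4) by linarith
  have ind: "vec.independent (BL \<union> BW)"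
    by (rule vec.card_le_dim_spanning[of _ UNIV]) (use sp le fin in \<open>auto simp: card_cart_basis\<close>)
  have "card (BL \<union> BW) = CARD('n)"
    using vec.dim_eq_card[of "BL \<union> BW" UNIV] ind sp by (simp add: card_cart_basis)
  then have "card (BL \<inter> BW) = 0"
    using card_Un_Int[OF fin] BL BW assms(4) by linarith
  then have disj: "BL \<inter> BW = {}" using fin by auto
  have "L \<inter> W = {0}"
    using span_Int_span_Diff[OF ind, of BL] disj BL BW by (simp add: Un_Diff Diff_triv inf_commute)
  then show ?thesis using assms by (auto simp: complementary_def)
qed

text \<open>Supplies charts around \<open>L\<close> that are adapted to a given subspace
  \<open>G\<close> transversal to \<open>L\<close>.\<close>

lemma complement_extending:
  fixes L G :: "(complex ^ 'n) set"
  assumes "vec.subspace L" "vec.subspace G" "L \<inter> G = {0}"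
  obtains W where "complementary L W" "G \<subseteq> W"
proof -
  obtain BL where BL: "BL \<subseteq> L" "vec.independent BL" "vec.span BL = L" "card BL = vec.dim L"
    using vec.basis_subspace_exists[OF assms(1)] by metis
  obtain BG where BG: "BG \<subseteq> G" "vec.independent BG" "vec.span BG = G" "card BG = vec.dim G"
    using vec.basis_subspace_exists[OF assms(2)] by metis
  have ind: "vec.independent (BL \<union> BG)" "BL \<inter> BG = {}"
    using independent_Un_bases[OF BL(2) BG(2)] BL BG assms(3) by auto
  obtain B where B: "BL \<union> BG \<subseteq> B" "vec.independent B" "UNIV \<subseteq> vec.span B"
    using vec.maximal_independent_subset_extend[OF _ ind(1), of UNIV] by auto
  have "BL \<union> (B - BL) = B" using B by auto
  then have "vec.span BL + vec.span (B - BL) = UNIV"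
    using B(3) by (metis span_Un_plus top.extremum_uniqueI)
  then have "complementary L (vec.span (B - BL))"
    using span_Int_span_Diff[OF B(2), of BL] B BL assms by (auto simp: complementary_def)
  moreover have "G \<subseteq> vec.span (B - BL)"
    using BG(3) vec.span_mono[of BG "B - BL"] B ind by blast
  ultimately show thesis by (rule that)
qed

section \<open>Projections along a complement\<close>

lemma proj_along_exists:
  assumes "complementary L W"
  shows "(\<forall>x\<in>L. proj_along W L *v x = x) \<and> (\<forall>w\<in>W. proj_along W L *v w = 0)"
  unfolding proj_along_def
proof (rule theI')
  have s: "vec.subspace L" "vec.subspace W" "L \<inter> W = {0}" "L + W = UNIV"
    using assms by (auto simp: complementary_def)
  have ex: "\<exists>y. y \<in> L \<and> x - y \<in> W" for x
  proof -
    obtain y w where "y \<in> L" "w \<in> W" "x = y + w"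
      using s(4) by (metis UNIV_I set_plus_elim)
    then show ?thesis by (intro exI[of _ y]) auto
  qed
  have un: "y = y'" if "y \<in> L" "x - y \<in> W" "y' \<in> L" "x - y' \<in> W" for x y y'
  proof -
    have "y - y' \<in> L" "(x - y') - (x - y) \<in> W" using that s by (blast intro: vec.subspace_diff)+
    then have "y - y' \<in> L \<inter> W" by simp
    then show ?thesis using s by auto
  qed
  define f where "f x = (SOME y. y \<in> L \<and> x - y \<in> W)" for x
  have f: "f x \<in> L" "x - f x \<in> W" for x
    using someI_ex[OF ex[of x]] by (auto simp: f_def)
  have lin: "Vector_Spaces.linear (*s) (*s) f"
  proof unfold_locales
    fix x y
    have e: "x + y - (f x + f y) = (x - f x) + (y - f y)" by simp
    show "f (x + y) = f x + f y"
      by (rule un[OF f]) (auto intro: vec.subspace_add s f simp only: e)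
    fix c
    have e: "c *s x - c *s f x = c *s (x - f x)" by (simp add: vector_ssub_ldistrib)
    show "f (c *s x) = c *s f x"
      by (rule un[OF f]) (auto intro: vec.subspace_scale s f simp only: e)
  qed
  have A: "matrix f *v x = f x" for x by (rule matrix_works[OF lin])
  show "\<exists>!A. (\<forall>x\<in>L. A *v x = x) \<and> (\<forall>w\<in>W. A *v w = 0)"
  proof (rule ex1I[of _ "matrix f"])
    show "(\<forall>x\<in>L. matrix f *v x = x) \<and> (\<forall>w\<in>W. matrix f *v w = 0)"
    proof safe
      fix x assume "x \<in> L" then show "matrix f *v x = x"
        unfolding A by (intro un[OF f]) (auto simp: s vec.subspace_0)
    next
      fix x assume "x \<in> W" then show "matrix f *v x = 0"
        unfolding A by (intro un[OF f]) (auto simp: s vec.subspace_0)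
    qed
    fix A' assume A': "(\<forall>x\<in>L. A' *v x = x) \<and> (\<forall>w\<in>W. A' *v w = 0)"
    have "A' *v x = f x" for x
    proof -
      have "A' *v x = A' *v f x + A' *v (x - f x)"
        by (simp flip: matrix_vector_right_distrib)
      also have "\<dots> = f x" using A' f by auto
      finally show ?thesis .
    qed
    then show "A' = matrix f" using A by (simp add: matrix_eq)
  qed
qed

lemma proj_along:
  assumes "complementary L W"
  shows "proj_along W L *v x \<in> L" "x - proj_along W L *v x \<in> W"
proof -
  obtain y w where yw: "y \<in> L" "w \<in> W" "x = y + w"
    using assms unfolding complementary_def by (metis UNIV_I set_plus_elim)
  then have "proj_along W L *v x = y"
    using proj_along_exists[OF assms] by (simp add: matrix_vector_right_distrib)
  then show "proj_along W L *v x \<in> L" "x - proj_along W L *v x \<in> W" using yw by auto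
qed

lemma proj_along_eqI:
  assumes "complementary L W" "y \<in> L" "x - y \<in> W"
  shows "proj_along W L *v x = y"
proof -
  have "proj_along W L *v x = proj_along W L *v y + proj_along W L *v (x - y)"
    by (simp flip: matrix_vector_right_distrib)
  then show ?thesis using proj_along_exists[OF assms(1)] assms by auto
qed

lemma proj_along_id: "complementary L W \<Longrightarrow> x \<in> L \<Longrightarrow> proj_along W L *v x = x"
  using proj_along_exists by blast

lemma proj_along_0: "complementary L W \<Longrightarrow> x \<in> W \<Longrightarrow> proj_along W L *v x = 0"
  using proj_along_exists by blast

section \<open>Polynomial change of chart\<close>

lemma polynomial_det:
  fixes T :: "('v \<Rightarrow> complex) \<Rightarrow> complex ^ 'n ^ 'n"
  assumes "\<And>a b. (\<lambda>x. T x $ a $ b) \<in> polynomial_functions"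
  shows "(\<lambda>x. det (T x)) \<in> polynomial_functions"
  unfolding det_def by (intro polynomial_intros assms)

lemma polynomial_matrix_mult:
  fixes T R :: "('v \<Rightarrow> complex) \<Rightarrow> complex ^ 'n ^ 'n"
  assumes "\<And>a b. (\<lambda>x. T x $ a $ b) \<in> polynomial_functions"
    "\<And>a b. (\<lambda>x. R x $ a $ b) \<in> polynomial_functions"
  shows "(\<lambda>x. (T x ** R x) $ a $ b) \<in> polynomial_functions"
  unfolding matrix_matrix_mult_def vec_lambda_beta by (intro polynomial_intros assms)

lemma subspaces_matrix_iso:
  fixes W W' :: "(complex ^ 'n) set"
  assumes "vec.subspace W" "vec.subspace W'" "vec.dim W = vec.dim W'"
  obtains S :: "complex ^ 'n ^ 'n" where "\<And>w. w \<in> W \<Longrightarrow> S *v w \<in> W'" "\<And>w. w \<in> W \<Longrightarrow> S *v w = 0 \<Longrightarrow> w = 0"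
proof -
  obtain f where f: "Vector_Spaces.linear (*s) (*s) f" "f ` W = W'" "inj_on f W"
    using vec.subspace_isomorphism[OF assms] by blast
  have eq: "matrix f *v x = f x" for x by (rule matrix_works[OF f(1)])
  show thesis
  proof (rule that[of "matrix f"])
    fix w assume w: "w \<in> W"
    then show "matrix f *v w \<in> W'" using f eq by auto
    assume "matrix f *v w = 0"
    then have "f w = f 0" using eq[of w] eq[of 0] by simp
    then show "w = 0" using f(3) w assms(1) by (auto simp: inj_on_def vec.subspace_0)
  qed
qed

text \<open>For a complement \<open>L0\<close> of \<open>W\<close> and an isomorphism \<open>S\<close> from \<open>W\<close> to \<open>W'\<close>, the matrix \<open>T\<close> below maps
  \<open>L0\<close> to \<open>L\<close> and \<open>W\<close> to \<open>W'\<close>. It is invertible iff \<open>L\<close> is a complement of \<open>W'\<close>, and then it conjugates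
  the projection onto \<open>L0\<close> along \<open>W\<close> to the projection onto \<open>L\<close> along \<open>W'\<close>.\<close>

lemma projection_transition:
  fixes L L0 W W' :: "(complex ^ 'n) set"
  assumes L: "complementary L W" and L0: "complementary L0 W" and W': "vec.subspace W'"
    and dim: "vec.dim W = vec.dim W'"
    and S: "\<And>w. w \<in> W \<Longrightarrow> S *v w \<in> W'" "\<And>w. w \<in> W \<Longrightarrow> S *v w = 0 \<Longrightarrow> w = 0"
  defines "T \<equiv> proj_along W L + S ** (mat 1 - proj_along W L0)"
  shows "complementary L W' \<longleftrightarrow> det T \<noteq> 0"
    and "complementary L W' \<Longrightarrow> T ** R = mat 1 \<Longrightarrow> proj_along W' L = T ** (proj_along W L0 ** R)"
proof -
  let ?A = "proj_along W L" and ?P = "proj_along W L0"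
  have T: "T *v z = ?A *v z + S *v (z - ?P *v z)" for z
    unfolding T_def matrix_vector_mult_add_rdistrib matrix_vector_mul_assoc[symmetric]
    by (simp add: matrix_vector_mult_diff_rdistrib)
  have sL: "vec.subspace L" "vec.subspace W" "L \<inter> W = {0}" "L0 \<inter> W = {0}"
    using L L0 by (auto simp: complementary_def)
  have nz: "T *v z = 0 \<Longrightarrow> z = 0" if c: "complementary L W'" for z
  proof -
    assume z: "T *v z = 0"
    have a: "?A *v z \<in> L" "S *v (z - ?P *v z) \<in> W'"
      using proj_along[OF L] proj_along[OF L0] S by auto
    have "?A *v z = - (S *v (z - ?P *v z))" using z T[of z] by (simp add: add_eq_0_iff2)
    then have "?A *v z \<in> W'" using vec.subspace_neg[OF W' a(2)] by (simp only:)
    then have "?A *v z \<in> L \<inter> W'" using a(1) by blast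
    then have A0: "?A *v z = 0" using c by (auto simp: complementary_def)
    then have "z - ?P *v z = 0"
      using z T[of z] S(2)[of "z - ?P *v z"] proj_along[OF L0] by auto
    then have "z \<in> L0" using proj_along[OF L0, of z] by simp
    moreover have "z \<in> W" using proj_along(2)[OF L, of z] A0 by simp
    ultimately show "z = 0" using sL by auto
  qed
  show iff: "complementary L W' \<longleftrightarrow> det T \<noteq> 0"
  proof
    assume c: "complementary L W'"
    have "inj ((*v) T)"
      using nz[OF c] by (simp add: vec.inj_iff_eq_0)
    then show "det T \<noteq> 0"
      by (simp add: invertible_det_nz[symmetric] invertible_left_inverse matrix_left_invertible_injective)
  next
    assume "det T \<noteq> 0"
    then obtain R where "T ** R = mat 1"
      using invertible_det_nz invertible_right_inverse by blast
    then have eq: "x = T *v (R *v x)" for x by (simp add: matrix_vector_mul_assoc)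
    have "x \<in> L + W'" for x
      using set_plus_intro[OF proj_along(1)[OF L, of "R *v x"], of "S *v (R *v x - ?P *v (R *v x))" W']
        S(1) proj_along(2)[OF L0, of "R *v x"] eq[of x] T by auto
    then have "L + W' = UNIV" by blast
    then show "complementary L W'"
      using complementaryI_sum[OF sL(1) W'] complementary_dim[OF L] dim by auto
  qed
  assume c: "complementary L W'" and R: "T ** R = mat 1"
  have "proj_along W' L *v x = (T ** (?P ** R)) *v x" for x
  proof (rule proj_along_eqI[OF c])
    let ?u = "R *v x"
    have "(T ** (?P ** R)) *v x = T *v (?P *v ?u)" by (simp add: matrix_vector_mul_assoc)
    also have "\<dots> = ?A *v (?P *v ?u)"
      using T[of "?P *v ?u"] proj_along_id[OF L0 proj_along(1)[OF L0]] by simp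
    finally show "(T ** (?P ** R)) *v x \<in> L" using proj_along(1)[OF L] by simp
    have "x - (T ** (?P ** R)) *v x = T *v (?u - ?P *v ?u)"
      using R by (simp add: matrix_vector_mult_diff_distrib matrix_vector_mul_assoc)
    also have "\<dots> = S *v (?u - ?P *v ?u)"
      using T[of "?u - ?P *v ?u"] proj_along_0[OF L proj_along(2)[OF L0]]
        proj_along_0[OF L0 proj_along(2)[OF L0]] by simp
    finally show "x - (T ** (?P ** R)) *v x \<in> W'" using S(1) proj_along(2)[OF L0] by simp
  qed
  then show "proj_along W' L = T ** (?P ** R)" by (simp add: matrix_eq)
qed

lemma matrix_vector_mult_axis: "A *v axis k 1 = column k A" for A :: "'a::comm_ring_1 ^ 'n ^ 'm"
  by (simp add: matrix_vector_mult_def column_def axis_def vec_eq_iff if_distrib cong: if_cong)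

text \<open>Cramer's rule exhibits the inverse with common denominator \<open>det T\<close> and
  numerators polynomial in the entries of \<open>T\<close>, which is the shape required of a
  transition function.\<close>

lemma matrix_right_inverse_cramer:
  fixes T :: "complex ^ 'n ^ 'n"
  assumes "det T \<noteq> 0"
  shows "T ** (\<chi> k l. det (\<chi> i j. if j = k then axis l 1 $ i else T $ i $ j) / det T) = mat 1"
proof -
  let ?R = "\<chi> k l. det (\<chi> i j. if j = k then axis l 1 $ i else T $ i $ j) / det T"
  have "T *v (?R *v axis l 1) = axis l 1" for l
    using cramer[OF assms, of "?R *v axis l 1" "axis l 1"]
    unfolding matrix_vector_mult_axis column_def by simp
  then have "(T ** ?R) *v axis l 1 = mat 1 *v axis l 1" for l by (simp add: matrix_vector_mul_assoc)
  then have "(T ** ?R) $ i $ l = mat 1 $ i $ l" for i l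
    unfolding matrix_vector_mult_axis column_def vec_eq_iff vec_lambda_beta by blast
  then show ?thesis unfolding vec_eq_iff by blast
qed

text \<open>\<open>L0\<close> and \<open>S\<close> depend on the two charts only. So the conjugating
  matrix \<open>T\<close> is affine in the coordinates of \<open>L\<close>, its determinant cuts out
  the overlap, and Cramer's rule controls the denominators.\<close>

lemma projection_transition_polynomial:
  fixes W W' :: "(complex ^ 'n) set" and j :: 'j
  shows "\<exists>\<Delta>\<in>polynomial_functions. \<exists>F. (\<forall>a b. F a b \<in> polynomial_functions) \<and>
    (\<forall>L x. complementary L W \<longrightarrow> (\<forall>a b. x (j, a, b) = proj_along W L $ a $ b) \<longrightarrow>
       (complementary L W' \<longleftrightarrow> \<Delta> x \<noteq> 0) \<and>
       (complementary L W' \<longrightarrow> (\<forall>a b. proj_along W' L $ a $ b = F a b x / \<Delta> x)))"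
proof (cases "vec.subspace W' \<and> vec.dim W = vec.dim W' \<and> (\<exists>L0. complementary L0 W)")
  case False
  \<comment> \<open>Here the charts of \<open>W\<close> and \<open>W'\<close> do not meet, and the
    zero polynomial describes the empty overlap.\<close>
  have "\<not> complementary L W'" if "complementary L W" for L
    using False that complementary_dim[of L W] complementary_dim[of L W'] by (auto simp: complementary_def)
  then show ?thesis
    by (intro bexI[of _ "\<lambda>_. 0"] exI[of _ "\<lambda>_ _ _. 0"]) (simp_all add: polynomial_functions.const)
next
  case True
  then obtain L0 where W': "vec.subspace W'" "vec.dim W = vec.dim W'" and L0: "complementary L0 W"
    by auto
  have W: "vec.subspace W" using L0 by (auto simp: complementary_def)
  obtain S where S: "\<And>w. w \<in> W \<Longrightarrow> S *v w \<in> W'" "\<And>w. w \<in> W \<Longrightarrow> S *v w = 0 \<Longrightarrow> w = 0"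
    using subspaces_matrix_iso[OF W W'] by metis
  let ?P = "proj_along W L0"
  define T :: "('j \<times> 'n \<times> 'n \<Rightarrow> complex) \<Rightarrow> complex ^ 'n ^ 'n"
    where "T x = (\<chi> a b. x (j, a, b)) + S ** (mat 1 - ?P)" for x
  define N :: "('j \<times> 'n \<times> 'n \<Rightarrow> complex) \<Rightarrow> complex ^ 'n ^ 'n"
    where "N x = (\<chi> k l. det (\<chi> i j. if j = k then axis l 1 $ i else T x $ i $ j))" for x
  have T: "(\<lambda>x. T x $ a $ b) \<in> polynomial_functions" for a b
    unfolding T_def vector_add_component vec_lambda_beta by (intro polynomial_intros)
  have N: "(\<lambda>x. N x $ a $ b) \<in> polynomial_functions" for a b
    unfolding N_def vec_lambda_beta
  proof (rule polynomial_det)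
    show "(\<lambda>x. (\<chi> i j. if j = a then axis b 1 $ i else T x $ i $ j) $ c $ d) \<in> polynomial_functions" for c d
      by (cases "d = a") (simp_all add: T polynomial_functions.const)
  qed
  show ?thesis
  proof (rule bexI[where x = "\<lambda>x. det (T x)"], rule exI[where x = "\<lambda>a b x. (T x ** (?P ** N x)) $ a $ b"],
      intro conjI allI impI)
    show "(\<lambda>x. det (T x)) \<in> polynomial_functions" by (rule polynomial_det[OF T])
    show "(\<lambda>x. (T x ** (?P ** N x)) $ a $ b) \<in> polynomial_functions" for a b
      by (intro polynomial_matrix_mult T N polynomial_functions.const)
  next
    fix L x assume L: "complementary L W" and x: "\<forall>a b. x (j, a, b) = proj_along W L $ a $ b"
    have "(\<chi> a b. x (j, a, b)) = proj_along W L" using x by (simp add: vec_eq_iff)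
    then have Tx: "T x = proj_along W L + S ** (mat 1 - ?P)" by (simp add: T_def)
    show iff: "complementary L W' \<longleftrightarrow> det (T x) \<noteq> 0"
      unfolding Tx by (rule projection_transition(1)[OF L L0 W' S])
    assume c: "complementary L W'"
    let ?R = "\<chi> k l. N x $ k $ l / det (T x)"
    have "T x ** ?R = mat 1"
      using matrix_right_inverse_cramer[of "T x"] iff c by (simp add: N_def)
    then have "proj_along W' L = T x ** (?P ** ?R)"
      using projection_transition(2)[OF L L0 W' S c] unfolding Tx by blast
    then show "proj_along W' L $ a $ b = (T x ** (?P ** N x)) $ a $ b / det (T x)" for a b
      by (simp add: matrix_matrix_mult_def sum_divide_distrib sum_distrib_left)
  qed
qed

lemma compatible_chart_grassmann:
  fixes W :: "'j \<Rightarrow> (complex ^ 'n) set"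
  assumes J: "finite J"
  shows "compatible_chart (grassmann_atlas J) (grassmann_chart J W) (grassmann_coords J W)"
  unfolding compatible_chart_def
proof (intro conjI ballI)
  show "(grassmann_chart J W, grassmann_coords J W) \<in> grassmann_atlas J"
    unfolding grassmann_atlas_def by blast
  fix Dc assume "Dc \<in> (grassmann_atlas J :: ('j \<Rightarrow> (complex ^ 'n) set, 'j \<times> 'n \<times> 'n) atlas)"
  then obtain W' where Dc: "Dc = (grassmann_chart J W', grassmann_coords J W')"
    unfolding grassmann_atlas_def by blast
  define good where "good j \<delta> f \<longleftrightarrow> \<delta> \<in> polynomial_functions \<and> (\<forall>a b. f a b \<in> polynomial_functions) \<and>
    (\<forall>L x. complementary L (W j) \<longrightarrow> (\<forall>a b. x (j, a, b) = proj_along (W j) L $ a $ b) \<longrightarrow>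
       (complementary L (W' j) \<longleftrightarrow> \<delta> x \<noteq> 0) \<and>
       (complementary L (W' j) \<longrightarrow> (\<forall>a b. proj_along (W' j) L $ a $ b = f a b x / \<delta> x)))"
    for j and \<delta> :: "('j \<times> 'n \<times> 'n \<Rightarrow> complex) \<Rightarrow> complex" and f
  have "\<exists>\<delta> f. good j \<delta> f" for j
    using projection_transition_polynomial[where W = "W j" and W' = "W' j" and j = j]
    unfolding good_def by blast
  then obtain \<Delta> F where good: "\<And>j. good j (\<Delta> j) (F j)" by metis
  have \<Delta>: "\<Delta> j \<in> polynomial_functions" and F: "F j a b \<in> polynomial_functions" for j a b
    using good unfolding good_def by blast+
  have *: "(complementary L (W' j) \<longleftrightarrow> \<Delta> j x \<noteq> 0) \<and>
       (complementary L (W' j) \<longrightarrow> (\<forall>a b. proj_along (W' j) L $ a $ b = F j a b x / \<Delta> j x))"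
    if "complementary L (W j)" "\<forall>a b. x (j, a, b) = proj_along (W j) L $ a $ b" for j L x
    using good[of j] that unfolding good_def by blast
  let ?\<Delta> = "\<lambda>x. \<Prod>j\<in>J. \<Delta> j x" and ?c = "grassmann_coords J W" and ?D = "grassmann_chart J W"
  have co: "(\<forall>a b. ?c p (j, a, b) = proj_along (W j) (p j) $ a $ b)" "complementary (p j) (W j)"
    if "p \<in> ?D" "j \<in> J" for p j
    using that by (auto simp: grassmann_coords_def grassmann_chart_def)
  have dom: "p \<in> grassmann_chart J W' \<longleftrightarrow> ?\<Delta> (?c p) \<noteq> 0" if p: "p \<in> ?D" for p
  proof -
    have "p \<in> grassmann_chart J W' \<longleftrightarrow> (\<forall>j\<in>J. complementary (p j) (W' j))"
      using p by (auto simp: grassmann_chart_def)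
    also have "\<dots> \<longleftrightarrow> (\<forall>j\<in>J. \<Delta> j (?c p) \<noteq> 0)"
      using *[OF co(2)[OF p] co(1)[OF p]] by blast
    finally show ?thesis using J by simp
  qed
  have tr: "\<exists>G\<in>polynomial_functions. \<forall>p\<in>?D \<inter> grassmann_chart J W'.
       grassmann_coords J W' p (j, a, b) = G (?c p) / ?\<Delta> (?c p)" for j a b
  proof (cases "j \<in> J")
    case False
    then show ?thesis
      by (intro bexI[of _ "\<lambda>_. 0"]) (simp_all add: grassmann_coords_def polynomial_functions.const)
  next
    case True
    \<comment> \<open>All factors of the product must share one denominator, the product of all
      \<open>\<Delta> i\<close>, so the numerator for \<open>j\<close> is multiplied by the
      remaining ones.\<close>
    let ?G = "\<lambda>x. F j a b x * (\<Prod>i\<in>J - {j}. \<Delta> i x)"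
    have G: "?G \<in> polynomial_functions" by (intro polynomial_intros F \<Delta>)
    have "grassmann_coords J W' p (j, a, b) = ?G (?c p) / ?\<Delta> (?c p)"
      if p: "p \<in> ?D" "p \<in> grassmann_chart J W'" for p
    proof -
      have c': "complementary (p j) (W' j)" using p True by (auto simp: grassmann_chart_def)
      have "grassmann_coords J W' p (j, a, b) = F j a b (?c p) / \<Delta> j (?c p)"
        using *[OF co(2)[OF p(1) True] co(1)[OF p(1) True]] c' True by (simp add: grassmann_coords_def)
      moreover have "(\<Prod>i\<in>J - {j}. \<Delta> i (?c p)) \<noteq> 0"
        using dom[OF p(1)] p(2) J by auto
      ultimately show ?thesis
        using J True by (simp add: prod.remove[of J j])
    qed
    then show ?thesis by (intro bexI[OF _ G] ballI) simp
  qed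
  show "case Dc of (D', c') \<Rightarrow> \<exists>\<Delta>\<in>polynomial_functions.
     (\<forall>p\<in>?D. (p \<in> D') = (\<Delta> (?c p) \<noteq> 0)) \<and>
     (\<forall>v. \<exists>F\<in>polynomial_functions. \<forall>p\<in>?D \<inter> D'. c' p v = F (?c p) / \<Delta> (?c p))"
    unfolding Dc prod.case
  proof (rule bexI[where x = ?\<Delta>], intro conjI ballI allI)
    show "?\<Delta> \<in> polynomial_functions" by (intro polynomial_intros \<Delta>)
    fix v :: "'j \<times> 'n \<times> 'n"
    show "\<exists>F\<in>polynomial_functions. \<forall>p\<in>?D \<inter> grassmann_chart J W'.
        grassmann_coords J W' p v = F (?c p) / ?\<Delta> (?c p)"
      by (cases v) (simp only: tr)
  qed (rule dom)
qed

text \<open>\<open>W j\<close> is chosen to contain a complement of \<open>x j \<inter> G\<close> in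
  \<open>G\<close>; a complement of \<open>x j\<close> cannot meet \<open>G\<close> in a larger
  dimension.\<close>

lemma transversal_grassmann_chart:
  fixes x :: "'j \<Rightarrow> (complex ^ 'n) set"
  assumes "x \<in> extensional J" "\<And>j. j \<in> J \<Longrightarrow> vec.subspace (x j)" "vec.subspace G"
  obtains W where "x \<in> grassmann_chart J W" "\<And>j. j \<in> J \<Longrightarrow> vec.dim (x j \<inter> G) + vec.dim (G \<inter> W j) \<ge> vec.dim G"
proof -
  have "\<exists>W. complementary (x j) W \<and> vec.dim (x j \<inter> G) + vec.dim (G \<inter> W) \<ge> vec.dim G" if j: "j \<in> J" for j
  proof -
    let ?I = "x j \<inter> G"
    have sI: "vec.subspace ?I" using assms that by (simp add: vec.subspace_inter)
    obtain BI where BI: "BI \<subseteq> ?I" "vec.independent BI" "vec.span BI = ?I" "card BI = vec.dim ?I"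
      using vec.basis_subspace_exists[OF sI] by metis
    obtain BG where BG: "BI \<subseteq> BG" "BG \<subseteq> G" "vec.independent BG" "G \<subseteq> vec.span BG"
      using vec.maximal_independent_subset_extend[of BI G] BI by auto
    have spG: "vec.span BG = G"
      using BG assms(3) by (simp add: subset_antisym vec.span_minimal)
    let ?G' = "vec.span (BG - BI)"
    have sub: "?G' \<subseteq> G" using vec.span_mono[of "BG - BI" BG] spG by auto
    have "x j \<inter> ?G' = {0}"
      using span_Int_span_Diff[OF BG(3,1)] BI(3) sub by (auto simp: vec.span_zero)
    then obtain W where W: "complementary (x j) W" "?G' \<subseteq> W"
      using complement_extending[OF assms(2)[OF j] vec.subspace_span] by metis
    have fin: "finite BG" using BG(3) by (rule vec.finiteI_independent)
    have "vec.dim G = card BG" using vec.dim_eq_card[of BG G] BG(3) spG vec.span_eq_iff assms(3) by metis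
    moreover have "vec.dim ?G' = card (BG - BI)"
      using vec.dim_span_eq_card_independent vec.independent_mono[OF BG(3)] by blast
    moreover have "card BG = card BI + card (BG - BI)"
      using fin BG(1) by (metis card_Diff_subset card_mono finite_subset le_add_diff_inverse)
    moreover have "vec.dim ?G' \<le> vec.dim (G \<inter> W)" using sub W by (intro vec.dim_subset) auto
    ultimately have "vec.dim ?I + vec.dim (G \<inter> W) \<ge> vec.dim G" using BI(4) by linarith
    then show ?thesis using W by blast
  qed
  then obtain W where "\<And>j. j \<in> J \<Longrightarrow> complementary (x j) (W j) \<and> vec.dim (x j \<inter> G) + vec.dim (G \<inter> W j) \<ge> vec.dim G"
    by metis
  then show thesis using that[of W] assms(1) by (auto simp: grassmann_chart_def)
qed

text \<open>No minors are needed: for every \<open>y\<close> in the chart transversal to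
  \<open>G\<close> at \<open>x\<close>, the subspaces \<open>y j \<inter> G\<close> and
  \<open>G \<inter> W j\<close> are independent in \<open>G\<close>, and the second leaves room only
  for dimension \<open>vec.dim (x j \<inter> G)\<close>.\<close>

lemma dim_Int_semicontinuous:
  fixes x :: "'j \<Rightarrow> (complex ^ 'n) set"
  assumes "x \<in> extensional J" "\<And>j. j \<in> J \<Longrightarrow> vec.subspace (x j)" "vec.subspace G" "j \<in> J"
  shows "\<exists>U. openin (zariski (grassmann_atlas J)) U \<and> x \<in> U \<and>
    (\<forall>y\<in>U. vec.dim (y j \<inter> G) \<le> vec.dim (x j \<inter> G))"
proof -
  obtain W where W: "x \<in> grassmann_chart J W"
    "\<And>j. j \<in> J \<Longrightarrow> vec.dim (x j \<inter> G) + vec.dim (G \<inter> W j) \<ge> vec.dim G"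
    using transversal_grassmann_chart[OF assms(1-3)] by metis
  have "vec.dim (y j \<inter> G) \<le> vec.dim (x j \<inter> G)" if "y \<in> grassmann_chart J W" for y
  proof -
    have c: "complementary (y j) (W j)" using that assms(4) by (auto simp: grassmann_chart_def)
    then have "vec.subspace (y j)" "vec.subspace (W j)" "y j \<inter> W j = {0}"
      by (auto simp: complementary_def)
    then have "vec.dim (y j \<inter> G) + vec.dim (G \<inter> W j) \<le> vec.dim G"
      using assms(3) by (intro dim_add_le vec.subspace_inter) (auto intro: vec.subspace_0)
    then show ?thesis using W(2)[OF assms(4)] by linarith
  qed
  moreover have "openin (zariski (grassmann_atlas J)) (grassmann_chart J W)"
    by (rule openin_zariski_chart[of _ "grassmann_coords J W"]) (auto simp: grassmann_atlas_def)
  ultimately show ?thesis using W(1) by blast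
qed

section \<open>Adapted Witt bases\<close>

text \<open>
  The third alternative for \<open>\<nu> k\<close> is needed if \<open>N\<close> and \<open>N\<^sup>\<bottom>\<close> are both, up to radicals and hyperbolic
  planes, spanned by a vector that is not isotropic. The two vectors span a hyperbolic plane whose isotropic
  lines are neither in \<open>N\<close> nor in \<open>N\<^sup>\<bottom>\<close>.
\<close>

definition witt_frame ::
  "(complex ^ 'n) set \<Rightarrow> (complex ^ 'n \<Rightarrow> complex ^ 'n \<Rightarrow> complex) \<Rightarrow> complex \<Rightarrow> (complex ^ 'n) set
    \<Rightarrow> nat \<Rightarrow> (nat \<Rightarrow> complex ^ 'n) \<Rightarrow> nat \<Rightarrow> nat set \<Rightarrow> (nat \<Rightarrow> complex ^ 'n) \<Rightarrow> bool" where
  "witt_frame V b \<epsilon> N n e r I \<nu> \<longleftrightarrow>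
     vec.span (e ` {1..n}) = V \<and>
     (\<forall>i\<in>{1..n}. \<forall>j\<in>{1..n}. b (e i) (e j) \<noteq> 0 \<longleftrightarrow> i + j = Suc n) \<and>
     {1..r} \<subseteq> I \<and> I \<subseteq> {1..n - r} \<and>
     rad V b N = vec.span (e ` {1..r}) \<and> N = vec.span (\<nu> ` I) \<and>
     (\<forall>k\<in>I. \<nu> k = e k \<and> k \<le> r \<or> \<nu> k = e k \<and> Suc n - k \<in> I \<or>
        \<epsilon> = 1 \<and> 2 * k = n + 2 \<and> k - 1 \<notin> I \<and> \<nu> k = e k - e (k - 1))"

locale reflexive_form =
  fixes V :: "(complex ^ 'n) set" and b :: "complex ^ 'n \<Rightarrow> complex ^ 'n \<Rightarrow> complex" and \<epsilon> :: complex
  assumes subspace_V: "vec.subspace V" and bilinear: "bilinear_form_on V b"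
    and reflexive: "\<And>u v. u \<in> V \<Longrightarrow> v \<in> V \<Longrightarrow> b u v = \<epsilon> * b v u"
    and sign: "\<epsilon> = 1 \<or> \<epsilon> = -1"
begin

lemma sign_square: "\<epsilon> * \<epsilon> = 1" using sign by auto

lemma sign_nonzero: "\<epsilon> \<noteq> 0" using sign by auto

lemma mem_V:
  "0 \<in> V" "u \<in> V \<Longrightarrow> v \<in> V \<Longrightarrow> u + v \<in> V" "u \<in> V \<Longrightarrow> v \<in> V \<Longrightarrow> u - v \<in> V" "u \<in> V \<Longrightarrow> c *s u \<in> V"
  using subspace_V by (auto intro: vec.subspace_0 vec.subspace_add vec.subspace_diff vec.subspace_scale)

lemma add_left: "u \<in> V \<Longrightarrow> v \<in> V \<Longrightarrow> w \<in> V \<Longrightarrow> b (u + v) w = b u w + b v w"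
  and add_right: "u \<in> V \<Longrightarrow> v \<in> V \<Longrightarrow> w \<in> V \<Longrightarrow> b w (u + v) = b w u + b w v"
  and scale_left: "u \<in> V \<Longrightarrow> v \<in> V \<Longrightarrow> b (c *s u) v = c * b u v"
  and scale_right: "u \<in> V \<Longrightarrow> v \<in> V \<Longrightarrow> b u (c *s v) = c * b u v"
  using bilinear unfolding bilinear_form_on_def by blast+

lemma zero_left: "v \<in> V \<Longrightarrow> b 0 v = 0" and zero_right: "v \<in> V \<Longrightarrow> b v 0 = 0"
  using scale_left[of 0 v 0] scale_right[of v 0 0] by (simp_all add: mem_V)

lemma diff_left: "u \<in> V \<Longrightarrow> v \<in> V \<Longrightarrow> w \<in> V \<Longrightarrow> b (u - v) w = b u w - b v w"
  and diff_right: "u \<in> V \<Longrightarrow> v \<in> V \<Longrightarrow> w \<in> V \<Longrightarrow> b w (u - v) = b w u - b w v"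
  using add_left[of "u - v" v w] add_right[of "u - v" v w] by (simp_all add: mem_V)

lemmas bilin = add_left add_right scale_left scale_right diff_left diff_right zero_left zero_right

lemma sum_mem: "(\<And>i. i \<in> I \<Longrightarrow> f i \<in> V) \<Longrightarrow> (\<Sum>i\<in>I. f i) \<in> V"
  by (rule vec.subspace_sum[OF subspace_V])

lemma sum_left: "(\<And>i. i \<in> I \<Longrightarrow> f i \<in> V) \<Longrightarrow> v \<in> V \<Longrightarrow> b (\<Sum>i\<in>I. f i) v = (\<Sum>i\<in>I. b (f i) v)"
  by (induction I rule: infinite_finite_induct) (auto simp: bilin sum_mem)

lemma subspace_kernel: "u \<in> V \<Longrightarrow> vec.subspace {w \<in> V. b u w = 0}"
  by (auto intro!: vec.subspaceI simp: mem_V bilin)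

lemma orthogonal_span:
  "u \<in> V \<Longrightarrow> (\<And>x. x \<in> B \<Longrightarrow> x \<in> V \<and> b u x = 0) \<Longrightarrow> w \<in> vec.span B \<Longrightarrow> b u w = 0"
  using vec.span_minimal[OF _ subspace_kernel, of B u] by blast

text \<open>The component \<open>a\<close> solves \<open>b a u = b v u\<close> for all
  \<open>u\<close> in a basis \<open>B\<close> of \<open>N\<close>. The Gram map of \<open>N\<close>
  is extended by the identity on a complement \<open>W\<close> to an endomorphism \<open>g\<close>
  of the ambient space; the trivial radical makes \<open>g\<close> injective, hence
  surjective.\<close>

lemma orthogonal_decomposition:
  assumes N: "vec.subspace N" "N \<subseteq> V" and rad: "rad V b N = {0}" and v: "v \<in> V"
  obtains a where "a \<in> N" "v - a \<in> perp V b N"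
proof -
  obtain W where W: "complementary N W"
    using complement_extending[OF N(1) vec.subspace_single_0] N(1) by (metis Int_insert_right_if1 inf_bot_right vec.subspace_0)
  obtain B where B: "B \<subseteq> N" "vec.independent B" "vec.span B = N"
    using vec.basis_subspace_exists[OF N(1)] by metis
  have fB: "finite B" using B(2) by (rule vec.finiteI_independent)
  let ?p = "\<lambda>x. proj_along W N *v x"
  define g where "g x = (\<Sum>u\<in>B. b (?p x) u *s u) + (x - ?p x)" for x
  have pN: "?p x \<in> N" and pV: "?p x \<in> V" for x using proj_along(1)[OF W, of x] N by auto
  have BV: "u \<in> V" if "u \<in> B" for u using that B N by auto
  have lin: "Vector_Spaces.linear (*s) (*s) g"
  proof unfold_locales
    show "g (x + y) = g x + g y" for x y
      by (simp add: g_def matrix_vector_right_distrib bilin pV BV vec.scale_left_distrib sum.distrib cong: sum.cong)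
    show "g (c *s x) = c *s g x" for c x
      by (simp add: g_def vec.scale_right_distrib vec.scale_right_diff_distrib vec.scale_sum_right bilin pV BV
          vector_scalar_commute cong: sum.cong)
  qed
  have sumN: "(\<Sum>u\<in>B. c u *s u) \<in> N" for c
    by (rule vec.subspace_sum[OF N(1)]) (use B N in \<open>auto intro: vec.subspace_scale\<close>)
  have split: "x - ?p x = 0 \<and> (\<forall>u\<in>B. b (?p x) u = c u)" if "g x = (\<Sum>u\<in>B. c u *s u)" for x c
  proof -
    have eq: "(\<Sum>u\<in>B. c u *s u) - (\<Sum>u\<in>B. b (?p x) u *s u) = x - ?p x"
      using that by (simp add: g_def algebra_simps)
    then have "x - ?p x \<in> N \<inter> W"
      using proj_along(2)[OF W, of x] vec.subspace_diff[OF N(1) sumN[of c] sumN[of "b (?p x)"]] by simp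
    then have 0: "x - ?p x = 0" using W unfolding complementary_def by blast
    then have "(\<Sum>u\<in>B. (c u - b (?p x) u) *s u) = 0"
      using eq by (simp add: vec.scale_left_diff_distrib sum_subtractf)
    then have "\<forall>u\<in>B. c u - b (?p x) u = 0"
      using vec.independentD[OF B(2) fB subset_refl, of "\<lambda>u. c u - b (?p x) u"] by blast
    then show ?thesis using 0 by auto
  qed
  have "x = 0" if "g x = 0" for x
  proof -
    have *: "x - ?p x = 0" "\<forall>u\<in>B. b (?p x) u = 0" using split[of x "\<lambda>_. 0"] that by auto
    have "b (?p x) w = 0" if "w \<in> vec.span B" for w
      by (rule orthogonal_span[OF pV _ that]) (use * BV in blast)
    then have "?p x \<in> rad V b N" using pN pV B by (auto simp: rad_def perp_def)
    then show "x = 0" using rad * by auto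
  qed
  then have "inj g" using vec.linear_inj_iff_eq_0[OF lin] by blast
  then have "surj g" using vec.linear_injective_imp_surjective[OF lin] by blast
  then obtain x where x: "g x = (\<Sum>u\<in>B. b v u *s u)" by (metis surjD)
  have *: "x = ?p x" "\<forall>u\<in>B. b (?p x) u = b v u" using split[OF x] by auto
  have xN: "x \<in> N" "x \<in> V" using *(1) pN[of x] N by auto
  have "b (v - x) w = 0" if "w \<in> vec.span B" for w
  proof (rule orthogonal_span[OF mem_V(3)[OF v xN(2)] _ that])
    fix u assume u: "u \<in> B"
    have "b x u = b v u" using * u by metis
    then show "u \<in> V \<and> b (v - x) u = 0" using BV[OF u] v xN by (simp add: bilin)
  qed
  then have "v - x \<in> perp V b N" using v xN B by (auto simp: perp_def mem_V)
  then show thesis using that xN by blast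
qed

text \<open>Over the complex numbers an anisotropic space has dimension at most one: for a nonzero
  \<open>w'\<close> orthogonal to \<open>u\<close>, some \<open>u + t *s w'\<close> is isotropic.
  Square roots also permit any nonzero value \<open>c\<close> for \<open>b u u\<close>.\<close>

lemma normalized_vector:
  assumes U: "vec.subspace U" "U \<subseteq> V" and aniso: "\<And>x. x \<in> U \<Longrightarrow> b x x = 0 \<Longrightarrow> x = 0"
    and \<epsilon>: "\<epsilon> = 1" and c: "c \<noteq> 0"
  obtains "U = {0}" | u where "U = vec.span {u}" "b u u = c"
proof (cases "U = {0}")
  case False
  then obtain x where x: "x \<in> U" "x \<noteq> 0" using U vec.subspace_0 by blast
  then have bx: "b x x \<noteq> 0" using aniso by blast
  define u where "u = csqrt (c / b x x) *s x"
  have uU: "u \<in> U" using x U by (auto simp: u_def intro: vec.subspace_scale)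
  have xV: "x \<in> V" using x U by auto
  have "b u u = (csqrt (c / b x x))\<^sup>2 * b x x"
    using xV by (simp add: u_def bilin mem_V power2_eq_square)
  then have bu: "b u u = c" using bx by simp
  have "w \<in> vec.span {u}" if w: "w \<in> U" for w
  proof -
    define w' where "w' = w - (b u w / c) *s u"
    have wV: "w \<in> V" "u \<in> V" using w uU U by auto
    have w'U: "w' \<in> U" using w uU U by (auto simp: w'_def intro: vec.subspace_diff vec.subspace_scale)
    then have w'V: "w' \<in> V" using U by auto
    have uw': "b u w' = 0" using wV bu c by (simp add: w'_def bilin mem_V)
    have w'u: "b w' u = 0" using uw' reflexive[OF w'V wV(2)] by simp
    have "w' = 0"
    proof (rule ccontr)
      assume "w' \<noteq> 0"
      then have bw': "b w' w' \<noteq> 0" using aniso w'U by blast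
      define t where "t = csqrt (- c / b w' w')"
      have t: "t * (t * b w' w') = - c"
      proof -
        have "t\<^sup>2 = - c / b w' w'" by (simp add: t_def)
        then show ?thesis using bw' by (simp add: power2_eq_square field_simps)
      qed
      have "b (u + t *s w') (u + t *s w') = 0"
        using wV w'V uw' w'u bu t by (simp add: bilin mem_V)
      moreover have "u + t *s w' \<in> U" using uU w'U U by (auto intro: vec.subspace_add vec.subspace_scale)
      ultimately have "u + t *s w' = 0" using aniso by blast
      then have "b u (u + t *s w') = 0" using wV by (simp add: zero_right)
      then show False using wV w'V uw' bu c by (simp add: bilin mem_V)
    qed
    then have "w = (b u w / c) *s u" by (simp add: w'_def)
    then show ?thesis by (metis vec.span_base vec.span_scale singletonI)
  qed
  moreover have "vec.span {u} \<subseteq> U" using uU U by (simp add: vec.span_minimal)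
  ultimately show thesis using that(2) bu by blast
qed (rule that(1))

text \<open>Base case of the Witt decomposition. \<open>N\<close> and its orthogonal complement have
  dimension at most one each; for \<open>\<epsilon> = -1\<close> both vanish, because every vector
  is isotropic.\<close>

lemma witt_frame_anisotropic:
  assumes N: "vec.subspace N" "N \<subseteq> V" and rad: "rad V b N = {0}"
    and aniso: "\<And>x. x \<in> N \<Longrightarrow> b x x = 0 \<Longrightarrow> x = 0" "\<And>x. x \<in> perp V b N \<Longrightarrow> b x x = 0 \<Longrightarrow> x = 0"
  shows "\<exists>n e r I \<nu>. witt_frame V b \<epsilon> N n e r I \<nu>"
proof -
  let ?P = "perp V b N"
  have P: "vec.subspace ?P" "?P \<subseteq> V"
    unfolding perp_def using N by (auto intro!: vec.subspaceI simp: mem_V bilin subset_iff)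
  have dec: "\<exists>a\<in>N. \<exists>p\<in>?P. v = a + p" if v: "v \<in> V" for v
  proof -
    obtain a where "a \<in> N" "v - a \<in> ?P" using orthogonal_decomposition[OF N rad v] .
    then show ?thesis by (intro bexI[of _ a] bexI[of _ "v - a"]) auto
  qed
  have zero: ?thesis if "N = {0}" "?P = {0}"
  proof -
    have "V = {0}" using dec that mem_V(1) by auto
    then have "witt_frame V b \<epsilon> N 0 (\<lambda>_. 0) 0 {} (\<lambda>_. 0)"
      using that rad by (simp add: witt_frame_def)
    then show ?thesis by blast
  qed
  show ?thesis
  proof (cases "\<epsilon> = 1")
    case False
    have "b x x = 0" if "x \<in> V" for x using reflexive[OF that that] sign False by simp
    then have "N = {0}" "?P = {0}" using N P aniso vec.subspace_0 by blast+
    then show ?thesis by (rule zero)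
  next
    case True
    show ?thesis
    proof (rule normalized_vector[OF N aniso(1) True, of 1])
      assume N0: "N = {0}"
      show ?thesis
      proof (rule normalized_vector[OF P aniso(2) True, of "-1"])
        fix w assume w: "?P = vec.span {w}" "b w w = -1"
        have "V = vec.span {w}" using dec N0 P(2) w(1) by fastforce
        then have "witt_frame V b \<epsilon> N 1 (\<lambda>_. w) 0 {} (\<lambda>_. w)"
          using N0 rad w by (simp add: witt_frame_def)
        then show ?thesis by blast
      qed (use zero N0 in auto)
    next
      fix u assume u: "N = vec.span {u}" "b u u = 1"
      have uV: "u \<in> N" "u \<in> V" using u N vec.span_base by auto
      show ?thesis
      \<comment> \<open>The value -1, opposite to \<open>b u u = 1\<close>, makes
        \<open>w - u\<close> and \<open>w + u\<close> isotropic. They form the basis, and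
        \<open>N\<close> is spanned by their difference, a multiple of \<open>u\<close>. This is the
        origin of the exceptional vector, with leading position 2.\<close>
      proof (rule normalized_vector[OF P aniso(2) True, of "-1"])
        assume P0: "?P = {0}"
        have "V = vec.span {u}" using dec P0 N(2) u(1) by fastforce
        then have "witt_frame V b \<epsilon> N 1 (\<lambda>_. u) 0 {1} (\<lambda>_. u)"
          using P0 rad u by (simp add: witt_frame_def)
        then show ?thesis by blast
      next
        fix w assume w: "?P = vec.span {w}" "b w w = -1"
        have wV: "w \<in> ?P" "w \<in> V" using w P vec.span_base by auto
        have wu: "b w u = 0" using wV uV by (auto simp: perp_def)
        have uw: "b u w = 0" using reflexive[OF uV(2) wV(2)] wu by simp
        define e where "e i = (if i = (1::nat) then w - u else w + u)" for i
        have atm: "{1..2} = {1, 2::nat}" by auto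
        have im: "e ` {1..2} = {w - u, w + u}" unfolding atm by (simp add: e_def insert_commute)
        have in1: "w - u \<in> vec.span {w - u, w + u}" "w + u \<in> vec.span {w - u, w + u}"
          by (auto intro: vec.span_base)
        have "(1/2) *s ((w + u) - (w - u)) \<in> vec.span {w - u, w + u}"
          by (rule vec.span_scale[OF vec.span_diff[OF in1(2,1)]])
        moreover have "(1/2) *s ((w + u) + (w - u)) \<in> vec.span {w - u, w + u}"
          by (rule vec.span_scale[OF vec.span_add[OF in1(2,1)]])
        moreover have "(1/2) *s ((w + u) - (w - u)) = u" "(1/2) *s ((w + u) + (w - u)) = w"
          by (simp_all add: vec_eq_iff)
        ultimately have in2: "u \<in> vec.span {w - u, w + u}" "w \<in> vec.span {w - u, w + u}" by simp_all
        have span: "vec.span (e ` {1..2}) = V"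
        proof
          show "vec.span (e ` {1..2}) \<subseteq> V"
            unfolding im by (rule vec.span_minimal) (use uV wV subspace_V mem_V in auto)
          show "V \<subseteq> vec.span (e ` {1..2})"
          proof
            fix v assume "v \<in> V"
            then obtain a p where "a \<in> vec.span {u}" "p \<in> vec.span {w}" "v = a + p"
              using dec u w by blast
            moreover have "vec.span {u} \<subseteq> vec.span {w - u, w + u}" "vec.span {w} \<subseteq> vec.span {w - u, w + u}"
              using in2 by (simp_all add: vec.span_minimal)
            ultimately show "v \<in> vec.span (e ` {1..2})"
              unfolding im by (auto intro: vec.span_add)
          qed
        qed
        have N': "N = vec.span {e 2 - e 1}"
        proof -
          have eq: "e 2 - e 1 = 2 *s u" by (simp add: e_def vec_eq_iff)
          have "vec.span {2 *s u} = vec.span {u}"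
            using vec.span_image_scale[of "{u}" "\<lambda>_. 2"] by simp
          then show ?thesis using eq u by simp
        qed
        have "witt_frame V b \<epsilon> N 2 e 0 {2} (\<lambda>k. e k - e (k - 1))"
          unfolding witt_frame_def
          using span N' rad True uV wV uw wu u w
          by (auto simp: atm e_def bilin mem_V)
        then show ?thesis by blast
      qed auto
    qed auto
  qed
qed

text \<open>The hyperbolic pair is placed at the two ends and the old basis is shifted by one, which
  preserves both the duality of positions and the exceptional middle position. \<open>A\<close>
  records the ends that belong to \<open>N\<close>: none, both, or only the first one if
  \<open>x\<close> is radical.\<close>

lemma witt_frame_extend:
  fixes N N' V' :: "(complex ^ 'n) set" and e' :: "nat \<Rightarrow> complex ^ 'n"
  defines "e \<equiv> \<lambda>n' x y i. if i = 1 then x else if i = n' + 2 then y else e' (i - 1)"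
  assumes x: "x \<in> V" "b x x = 0" and y: "y \<in> V" "b y y = 0" and xy: "b x y = 1"
    and V': "V' = {v \<in> V. b x v = 0 \<and> b y v = 0}"
    and fr: "witt_frame V' b \<epsilon> N' n' e' r' I' \<nu>'"
    and N: "N = vec.span (e n' x y ` A \<union> N')" and rad: "rad V b N = vec.span (e n' x y ` {1..r})"
    and A: "r = 0 \<and> r' = 0 \<and> (A = {} \<or> A = {1, n' + 2}) \<or> r = Suc r' \<and> A = {1}"
  shows "witt_frame V b \<epsilon> N (n' + 2) (e n' x y) r (A \<union> Suc ` I')
    (\<lambda>i. if i \<in> A then e n' x y i else \<nu>' (i - 1))"
proof -
  let ?e = "e n' x y" and ?n = "n' + 2"
  have fr: "vec.span (e' ` {1..n'}) = V'" "\<And>i j. i \<in> {1..n'} \<Longrightarrow> j \<in> {1..n'} \<Longrightarrow> b (e' i) (e' j) \<noteq> 0 \<longleftrightarrow> i + j = Suc n'"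
    "{1..r'} \<subseteq> I'" "I' \<subseteq> {1..n' - r'}" "N' = vec.span (\<nu>' ` I')"
    "\<And>k. k \<in> I' \<Longrightarrow> \<nu>' k = e' k \<and> k \<le> r' \<or> \<nu>' k = e' k \<and> Suc n' - k \<in> I' \<or>
        \<epsilon> = 1 \<and> 2 * k = n' + 2 \<and> k - 1 \<notin> I' \<and> \<nu>' k = e' k - e' (k - 1)"
    using fr unfolding witt_frame_def by blast+
  have e1: "?e 1 = x" "?e ?n = y" and eS: "\<And>i. i \<in> {1..n'} \<Longrightarrow> ?e (Suc i) = e' i"
    by (auto simp: e_def)
  have I': "i \<in> {1..n'}" if "i \<in> I'" for i
    using subsetD[OF fr(4) that] diff_le_self[of n' r'] unfolding atLeastAtMost_iff by linarith
  have e'V: "e' i \<in> V \<and> b x (e' i) = 0 \<and> b y (e' i) = 0" if "i \<in> {1..n'}" for i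
  proof -
    have "e' i \<in> V'" using fr(1) that vec.span_base by blast
    then show ?thesis using V' by blast
  qed
  have e'V2: "b (e' i) x = 0" "b (e' i) y = 0" if "i \<in> {1..n'}" for i
    using reflexive[of "e' i" x] reflexive[of "e' i" y] e'V[OF that] x y by simp_all
  have yx: "b y x = \<epsilon>" using reflexive[OF y(1) x(1)] xy by simp
  have ivl: "{1..?n} = insert 1 (insert ?n (Suc ` {1..n'}))"
    unfolding image_Suc_atLeastAtMost by auto
  have "(\<lambda>i. ?e (Suc i)) ` {1..n'} = e' ` {1..n'}" by (rule image_cong) (simp_all only: eS)
  then have im: "?e ` {1..?n} = insert x (insert y (e' ` {1..n'}))"
    unfolding ivl image_insert e1 image_image by (rule arg_cong)
  have span: "vec.span (?e ` {1..?n}) = V"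
  proof
    show "vec.span (?e ` {1..?n}) \<subseteq> V"
      unfolding im using e'V x y by (intro vec.span_minimal[OF _ subspace_V]) auto
    show "V \<subseteq> vec.span (?e ` {1..?n})"
    proof
      fix v assume v: "v \<in> V"
      \<comment> \<open>The coefficient of \<open>x\<close> carries the sign because
        \<open>b y x = \<epsilon>\<close>, and \<open>\<epsilon> * \<epsilon> = 1\<close>.\<close>
      define v0 where "v0 = v - (\<epsilon> * b y v) *s x - b x v *s y"
      have "v0 \<in> V'"
        using v x y xy yx sign_square by (simp add: V' v0_def bilin mem_V flip: mult.assoc)
      then have "v0 \<in> vec.span (?e ` {1..?n})"
        using fr(1) vec.span_mono[of "e' ` {1..n'}" "?e ` {1..?n}"] unfolding im by auto
      moreover have "x \<in> vec.span (?e ` {1..?n})" "y \<in> vec.span (?e ` {1..?n})"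
        unfolding im by (auto intro: vec.span_base)
      moreover have "v = v0 + (\<epsilon> * b y v) *s x + b x v *s y" by (simp add: v0_def)
      ultimately show "v \<in> vec.span (?e ` {1..?n})"
        by (metis vec.span_add vec.span_scale)
    qed
  qed
  have pair: "b (?e i) (?e j) \<noteq> 0 \<longleftrightarrow> i + j = Suc ?n" if "i \<in> {1..?n}" "j \<in> {1..?n}" for i j
  proof -
    have ne: "\<epsilon> \<noteq> 0" by (rule sign_nonzero)
    have "i = 1 \<or> i = ?n \<or> (\<exists>i'\<in>{1..n'}. i = Suc i')" using that(1) unfolding ivl by blast
    moreover have "j = 1 \<or> j = ?n \<or> (\<exists>j'\<in>{1..n'}. j = Suc j')" using that(2) unfolding ivl by blast
    ultimately show ?thesis
      by (elim disjE bexE; simp only: e1 eS x y xy yx e'V e'V2 fr(2); auto simp: ne)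
  qed
  have disj: "A \<inter> Suc ` I' = {}" using A I' by fastforce
  have r'n: "r' \<le> n'"
  proof (cases "r' = 0")
    case False
    then have "r' \<in> I'" using fr(3) by auto
    then show ?thesis using I' by simp
  qed simp
  have I1: "{1..r} \<subseteq> A \<union> Suc ` I'"
  proof -
    have "{1..Suc r'} = insert 1 (Suc ` {1..r'})" unfolding image_Suc_atLeastAtMost by auto
    then have *: "{1..Suc r'} \<subseteq> insert 1 (Suc ` I')" using fr(3) by blast
    from A show ?thesis
    proof (elim disjE conjE)
      assume "r = Suc r'" "A = {1}"
      then show ?thesis using * by simp
    qed simp_all
  qed
  have I2: "A \<union> Suc ` I' \<subseteq> {1..?n - r}"
    using A
  proof (elim disjE conjE)
    assume "r = Suc r'" "A = {1}"
    moreover have "Suc i \<in> {1..?n - Suc r'}" if "i \<in> I'" for i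
      using subsetD[OF fr(4) that] r'n by auto
    ultimately show ?thesis using r'n by auto
  qed (use I' in force)+
  have N2: "N = vec.span ((\<lambda>i. if i \<in> A then ?e i else \<nu>' (i - 1)) ` (A \<union> Suc ` I'))"
  proof -
    define g where "g = (\<lambda>i. if i \<in> A then ?e i else \<nu>' (i - 1))"
    have "g ` (Suc ` I') = \<nu>' ` I'"
      unfolding image_image by (rule image_cong) (use disj in \<open>auto simp: g_def\<close>)
    moreover have "g ` A = ?e ` A"
      by (rule image_cong) (auto simp: g_def)
    moreover have "vec.span (?e ` A \<union> vec.span (\<nu>' ` I')) = vec.span (?e ` A \<union> \<nu>' ` I')"
      unfolding vec.span_Un vec.span_span ..
    ultimately show ?thesis unfolding N fr(5) g_def[symmetric] image_Un by simp
  qed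
  have nu: "(if k \<in> A then ?e k else \<nu>' (k - 1)) = ?e k \<and> k \<le> r \<or>
      (if k \<in> A then ?e k else \<nu>' (k - 1)) = ?e k \<and> Suc ?n - k \<in> A \<union> Suc ` I' \<or>
        \<epsilon> = 1 \<and> 2 * k = ?n + 2 \<and> k - 1 \<notin> A \<union> Suc ` I' \<and>
        (if k \<in> A then ?e k else \<nu>' (k - 1)) = ?e k - ?e (k - 1)" if "k \<in> A \<union> Suc ` I'" for k
    using that
  proof
    assume "k \<in> A"
    then show ?thesis using A by auto
  next
    assume "k \<in> Suc ` I'"
    then obtain l where l: "k = Suc l" "l \<in> I'" by auto
    have kA: "k \<notin> A" using disj l by auto
    have l1: "l \<in> {1..n'}" using I' l by auto
    have r: "l \<le> r' \<Longrightarrow> k \<le> r" using A l l1 by auto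
    show ?thesis
      using fr(6)[OF l(2)]
    proof (elim disjE conjE)
      assume "\<nu>' l = e' l" "Suc n' - l \<in> I'"
      moreover have "Suc ?n - k = Suc (Suc n' - l)" using l l1 by auto
      ultimately show ?thesis using kA l eS[OF l1] by simp
    next
      assume *: "\<epsilon> = 1" "2 * l = n' + 2" "l - 1 \<notin> I'" "\<nu>' l = e' l - e' (l - 1)"
      have l2: "l - 1 \<in> {1..n'}" "Suc (l - 1) = l" using * l1 by auto
      have "l \<notin> Suc ` I'" using *(3) by auto
      moreover have "l \<notin> A" using A l1 l2 by auto
      ultimately show ?thesis using * kA l eS[OF l1] eS[OF l2(1)] l2(2) by simp
    qed (use kA l eS[OF l1] r in simp)
  qed
  show ?thesis
    unfolding witt_frame_def using span pair I1 I2 rad N2 nu by blast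
qed

end

section \<open>Splitting off a hyperbolic plane\<close>

context reflexive_form
begin

lemma subspace_perp: "N \<subseteq> V \<Longrightarrow> vec.subspace (perp V b N)"
  unfolding perp_def by (auto intro!: vec.subspaceI simp: mem_V bilin subset_iff)

lemma subspace_rad: "vec.subspace N \<Longrightarrow> N \<subseteq> V \<Longrightarrow> vec.subspace (rad V b N)"
  unfolding rad_def by (intro vec.subspace_inter subspace_perp)

text \<open>Subtracting a multiple of \<open>x\<close> makes \<open>w\<close> isotropic without
  changing \<open>b x w\<close>. In the skew case \<open>b w w\<close> is already zero, so one
  formula serves both signs.\<close>

lemma hyperbolic_partner:
  assumes U: "vec.subspace U" "U \<subseteq> V" and x: "x \<in> U" "b x x = 0" and z: "z \<in> U" "b x z \<noteq> 0"
  obtains y where "y \<in> U" "b y y = 0" "b x y = 1"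
proof -
  define w where "w = (1 / b x z) *s z"
  define y where "y = w - (b w w / 2) *s x"
  have mem: "w \<in> U" "y \<in> U" using U x z by (auto simp: w_def y_def intro: vec.subspace_diff vec.subspace_scale)
  then have V: "x \<in> V" "z \<in> V" "w \<in> V" "y \<in> V" using U x z by auto
  have xw: "b x w = 1" using V z by (simp add: w_def bilin)
  have wx: "b w x = \<epsilon>" using reflexive[OF V(3,1)] xw by simp
  have ww: "b w w = \<epsilon> * b w w" using reflexive[OF V(3,3)] .
  have "b y y = b w w - (b w w / 2) * (1 + \<epsilon>)"
    using V x xw wx by (simp add: y_def bilin mem_V field_simps)
  also have "\<dots> = 0" using sign ww by (auto simp: field_simps)
  finally show thesis using that mem V x xw by (simp add: y_def bilin mem_V)
qed

context
  fixes x y V'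
  assumes x: "x \<in> V" "b x x = 0" and y: "y \<in> V" "b y y = 0" and xy: "b x y = 1"
    and V'_def: "V' = {v \<in> V. b x v = 0 \<and> b y v = 0}"
begin

lemma hyperbolic_component:
  assumes "v \<in> V"
  shows "v - (\<epsilon> * b y v) *s x - b x v *s y \<in> V'"
proof -
  have yx: "b y x = \<epsilon>" using reflexive[OF y(1) x(1)] xy by simp
  show ?thesis
    using assms x y xy yx sign_square by (simp add: V'_def bilin mem_V flip: mult.assoc)
qed

lemma subspace_V': "vec.subspace V'"
  unfolding V'_def using x y by (auto intro!: vec.subspaceI simp: mem_V bilin)

lemma reflexive_form_V': "reflexive_form V' b \<epsilon>"
proof
  show "vec.subspace V'" by (rule subspace_V')
  show "bilinear_form_on V' b"
    using bilinear unfolding bilinear_form_on_def V'_def by blast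
  show "b u v = \<epsilon> * b v u" if "u \<in> V'" "v \<in> V'" for u v
    using that by (intro reflexive) (simp_all add: V'_def)
qed (rule sign)

lemma orthogonal_V': "v \<in> V' \<Longrightarrow> b v x = 0 \<and> b v y = 0"
  using reflexive[of v x] reflexive[of v y] x y by (simp add: V'_def)

lemma nondegenerate_V':
  assumes "nondegenerate_on V b"
  shows "nondegenerate_on V' b"
  unfolding nondegenerate_on_def
proof (intro ballI impI)
  fix u assume u: "u \<in> V'" "\<forall>w\<in>V'. b u w = 0"
  have uV: "u \<in> V" using u by (simp add: V'_def)
  have "b u v = 0" if v: "v \<in> V" for v
  proof -
    let ?w = "v - (\<epsilon> * b y v) *s x - b x v *s y"
    have "b u ?w = 0" using u hyperbolic_component[OF v] by blast
    then show ?thesis using uV v x y orthogonal_V'[OF u(1)] by (simp add: bilin mem_V)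
  qed
  then show "u = 0" using assms uV unfolding nondegenerate_on_def by blast
qed

lemma dim_V': "vec.dim V' < vec.dim V"
proof (rule vec.dim_psubset)
  have yx: "b y x \<noteq> 0" using reflexive[OF y(1) x(1)] xy sign_nonzero by simp
  then have "V' \<subset> V" using x by (auto simp: V'_def)
  then show "vec.span V' \<subset> vec.span V"
    using subspace_V subspace_V' vec.span_eq_iff by metis
qed

end

end

text \<open>Induction on the dimension, splitting off a hyperbolic plane that contains an isotropic
  vector of the radical, of \<open>N\<close> or of its orthogonal complement, until both are
  anisotropic. Radical vectors are treated first and thus get the outermost positions, so they
  become the first basis vectors.\<close>

lemma witt_frame_exists:
  assumes "reflexive_form V b \<epsilon>" "nondegenerate_on V b" "vec.subspace N" "N \<subseteq> V"
  shows "\<exists>n e r I \<nu>. witt_frame V b \<epsilon> N n e r I \<nu>"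
  using assms
proof (induction "vec.dim V" arbitrary: V N rule: less_induct)
  case less
  interpret reflexive_form V b \<epsilon> by (rule less.prems)
  note nd = less.prems(2) and N = less.prems(3,4)
  let ?P = "perp V b N"
  have P: "vec.subspace ?P" "?P \<subseteq> V" using subspace_perp N by (auto simp: perp_def)
  \<comment> \<open>The part common to the three reductions; \<open>A\<close> is the contribution of
    the hyperbolic plane to \<open>N\<close>.\<close>
  have step: "\<exists>n e r I \<nu>. witt_frame V b \<epsilon> N n e r I \<nu>"
    if x: "x \<in> V" "b x x = 0" and y: "y \<in> V" "b y y = 0" and xy: "b x y = 1"
      and V': "V' = {v \<in> V. b x v = 0 \<and> b y v = 0}"
      and N': "vec.subspace N'" "N' \<subseteq> V'" "N = vec.span (A \<union> N')"
      and A: "rad V' b N' = {0} \<and> rad V b N = {0} \<and> (A = {} \<or> A = {x, y}) \<or>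
        A = {x} \<and> rad V b N = vec.span (insert x (rad V' b N'))"
    for x y V' N' A
  proof -
    obtain n' e' r' I' \<nu>' where fr: "witt_frame V' b \<epsilon> N' n' e' r' I' \<nu>'"
      using less.hyps[OF dim_V'[OF x y xy V'] reflexive_form_V'[OF x y xy V']
          nondegenerate_V'[OF x y xy V' nd] N'(1,2)] by blast
    have sp: "rad V' b N' = vec.span (e' ` {1..r'})" and pair: "\<And>i j. i \<in> {1..n'} \<Longrightarrow> j \<in> {1..n'} \<Longrightarrow>
        b (e' i) (e' j) \<noteq> 0 \<longleftrightarrow> i + j = Suc n'" and r': "{1..r'} \<subseteq> I'" "I' \<subseteq> {1..n' - r'}"
      and eV: "vec.span (e' ` {1..n'}) = V'"
      using fr unfolding witt_frame_def by blast+
    \<comment> \<open>Otherwise \<open>e' 1\<close> would lie in the zero radical, although it pairs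
      nontrivially with \<open>e' n'\<close>.\<close>
    have r'0: "r' = 0" if "rad V' b N' = {0}"
    proof (rule ccontr)
      assume "r' \<noteq> 0"
      then have 1: "1 \<in> {1..r'}" by simp
      then have "1 \<in> {1..n' - r'}" using r' by blast
      then have n': "1 \<in> {1..n'}" "n' \<in> {1..n'}" by auto
      have "e' 1 \<in> rad V' b N'" unfolding sp using 1 by (intro vec.span_base imageI)
      then have "e' 1 = 0" using that by simp
      moreover have "e' n' \<in> V'" using n' eV vec.span_base by blast
      ultimately have "b (e' 1) (e' n') = 0" using V' by (auto simp: zero_left)
      then show False using pair[OF n'] by simp
    qed
    define e where "e = (\<lambda>i. if i = 1 then x else if i = n' + 2 then y else e' (i - 1))"
    have e1: "e ` {} = {}" "e ` {1} = {x}" "e ` {1, n' + 2} = {x, y}" by (auto simp: e_def)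
    have "r' \<le> n'"
    proof (cases "r' = 0")
      case False
      then have "r' \<in> {1..r'}" by simp
      then have "r' \<in> {1..n' - r'}" using r' by blast
      then show ?thesis by auto
    qed simp
    then have "(\<lambda>i. e (Suc i)) ` {1..r'} = e' ` {1..r'}"
      by (intro image_cong) (auto simp: e_def)
    moreover have "{1..Suc r'} = insert 1 (Suc ` {1..r'})" unfolding image_Suc_atLeastAtMost by auto
    moreover have "e 1 = x" by (simp add: e_def)
    ultimately have eS: "e ` {1..Suc r'} = insert x (e' ` {1..r'})"
      by (simp only: image_insert image_image)
    from A show ?thesis
    proof (elim disjE conjE)
      assume *: "rad V' b N' = {0}" "rad V b N = {0}" "A = {}"
      have "N = vec.span (e ` {} \<union> N')" "rad V b N = vec.span (e ` {1..0})" using N'(3) * by auto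
      from witt_frame_extend[OF x y xy V' fr this[unfolded e_def]] r'0[OF *(1)]
      show ?thesis by blast
    next
      assume *: "rad V' b N' = {0}" "rad V b N = {0}" "A = {x, y}"
      have "N = vec.span (e ` {1, n' + 2} \<union> N')" "rad V b N = vec.span (e ` {1..0})"
        unfolding e1 using N'(3) * by auto
      from witt_frame_extend[OF x y xy V' fr this[unfolded e_def]] r'0[OF *(1)]
      show ?thesis by blast
    next
      assume *: "A = {x}" "rad V b N = vec.span (insert x (rad V' b N'))"
      have "vec.span (insert x (vec.span (e' ` {1..r'}))) = vec.span (insert x (e' ` {1..r'}))"
        using vec.span_Un[of "{x}" "e' ` {1..r'}"] vec.span_Un[of "{x}" "vec.span (e' ` {1..r'})"]
        by (simp only: vec.span_span insert_is_Un[symmetric])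
      then have "N = vec.span (e ` {1} \<union> N')" "rad V b N = vec.span (e ` {1..Suc r'})"
        unfolding e1 eS using N'(3) * sp by auto
      from witt_frame_extend[OF x y xy V' fr this[unfolded e_def]]
      show ?thesis by blast
    qed
  qed
  consider x where "x \<in> rad V b N" "x \<noteq> 0"
    | x where "rad V b N = {0}" "x \<in> N" "b x x = 0" "x \<noteq> 0"
    | x where "rad V b N = {0}" "x \<in> ?P" "b x x = 0" "x \<noteq> 0"
    | "rad V b N = {0}" "\<And>x. x \<in> N \<Longrightarrow> b x x = 0 \<Longrightarrow> x = 0" "\<And>x. x \<in> ?P \<Longrightarrow> b x x = 0 \<Longrightarrow> x = 0"
    using vec.subspace_0[OF subspace_rad[OF N]] by blast
  then show ?case
  proof cases
    case (1 x)
    have x: "x \<in> N" "x \<in> V" "b x x = 0" "\<And>w. w \<in> N \<Longrightarrow> b x w = 0"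
      using 1 by (auto simp: rad_def perp_def)
    obtain z where z: "z \<in> V" "b x z \<noteq> 0"
      using nd x(2) 1(2) unfolding nondegenerate_on_def by blast
    obtain y where y: "y \<in> V" "b y y = 0" "b x y = 1"
      using hyperbolic_partner[OF subspace_V subset_refl x(2,3) z] .
    let ?V' = "{v \<in> V. b x v = 0 \<and> b y v = 0}"
    note hc = hyperbolic_component[OF x(2,3) y refl]
    let ?N' = "N \<inter> ?V'"
    have sV': "vec.subspace ?V'" by (rule subspace_V'[OF x(2,3) y refl])
    \<comment> \<open>There is no component along \<open>y\<close> to remove, since the radical
      vector \<open>x\<close> is orthogonal to \<open>w\<close>.\<close>
    have comp: "w - (\<epsilon> * b y w) *s x \<in> ?N'" if w: "w \<in> N" for w
      using hc[of w] w x N vec.subspace_diff[OF N(1) w vec.subspace_scale[OF N(1) x(1)]] by auto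
    have in_span: "w \<in> vec.span (insert x U)" if "w - c *s x \<in> U" for w c U
    proof -
      have "w = (w - c *s x) + c *s x" by simp
      then show ?thesis using that
        by (metis insertI1 insertI2 vec.span_add vec.span_base vec.span_scale)
    qed
    show ?thesis
    proof (rule step[OF x(2,3) y refl, of ?N' "{x}"])
      show "vec.subspace ?N'" by (rule vec.subspace_inter[OF N(1) sV'])
      have "N \<subseteq> vec.span (insert x ?N')" using in_span[OF comp] by blast
      moreover have "vec.span (insert x ?N') \<subseteq> N" using x(1) by (intro vec.span_minimal[OF _ N(1)]) auto
      ultimately show "N = vec.span ({x} \<union> ?N')" by auto
      have "rad V b N = vec.span (insert x (rad ?V' b ?N'))"
      proof
        show "vec.span (insert x (rad ?V' b ?N')) \<subseteq> rad V b N"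
        proof (rule vec.span_minimal[OF _ subspace_rad[OF N]])
          have "u \<in> rad V b N" if u: "u \<in> rad ?V' b ?N'" for u
          proof -
            have uN: "u \<in> N" "u \<in> V" "u \<in> ?V'" "\<And>w. w \<in> ?N' \<Longrightarrow> b u w = 0"
              using u by (auto simp: rad_def perp_def)
            have ux: "b u x = 0" using orthogonal_V'[OF x(2,3) y refl uN(3)] by blast
            have "b u w = 0" if w: "w \<in> N" for w
            proof -
              have "b u (w - (\<epsilon> * b y w) *s x) = 0" using uN(4)[OF comp[OF w]] .
              then show ?thesis using uN w N x ux by (simp add: bilin mem_V subset_iff)
            qed
            then show ?thesis using uN by (auto simp: rad_def perp_def)
          qed
          then show "insert x (rad ?V' b ?N') \<subseteq> rad V b N" using 1(1) by auto
        qed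
        show "rad V b N \<subseteq> vec.span (insert x (rad ?V' b ?N'))"
        proof
          fix u assume u: "u \<in> rad V b N"
          then have uN: "u \<in> N" "u \<in> V" "\<And>w. w \<in> N \<Longrightarrow> b u w = 0" by (auto simp: rad_def perp_def)
          have "b (u - (\<epsilon> * b y u) *s x) w = 0" if "w \<in> ?N'" for w
            using that uN x by (simp add: bilin mem_V)
          then have "u - (\<epsilon> * b y u) *s x \<in> rad ?V' b ?N'"
            using comp[OF uN(1)] by (auto simp: rad_def perp_def)
          then show "u \<in> vec.span (insert x (rad ?V' b ?N'))" by (rule in_span)
        qed
      qed
      then show "rad ?V' b ?N' = {0} \<and> rad V b N = {0} \<and> ({x} = {} \<or> {x} = {x, y}) \<or>
        {x} = {x} \<and> rad V b N = vec.span (insert x (rad ?V' b ?N'))" by blast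
    qed auto
  next
    case (2 x)
    have xV: "x \<in> V" using 2 N by auto
    have "x \<notin> rad V b N" using 2 by auto
    then obtain z where z: "z \<in> N" "b x z \<noteq> 0" using 2 xV by (auto simp: rad_def perp_def)
    obtain y where yN: "y \<in> N" and y': "b y y = 0" "b x y = 1"
      using hyperbolic_partner[OF N 2(2,3) z] .
    have y: "y \<in> V" "b y y = 0" "b x y = 1" using yN y' N by auto
    let ?V' = "{v \<in> V. b x v = 0 \<and> b y v = 0}"
    let ?N' = "N \<inter> ?V'"
    have sV': "vec.subspace ?V'" by (rule subspace_V'[OF xV 2(3) y refl])
    have comp: "w - (\<epsilon> * b y w) *s x - b x w *s y \<in> ?N'" if w: "w \<in> N" for w
    proof -
      have "w - (\<epsilon> * b y w) *s x - b x w *s y \<in> N"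
        using w yN 2(2) N by (intro vec.subspace_diff vec.subspace_scale) auto
      then show ?thesis using hyperbolic_component[OF xV 2(3) y refl, of w] w N by auto
    qed
    show ?thesis
    proof (rule step[OF xV 2(3) y refl, of ?N' "{x, y}"])
      show "vec.subspace ?N'" by (rule vec.subspace_inter[OF N(1) sV'])
      have "w \<in> vec.span ({x, y} \<union> ?N')" if w: "w \<in> N" for w
      proof -
        have "w = (w - (\<epsilon> * b y w) *s x - b x w *s y) + (\<epsilon> * b y w) *s x + b x w *s y" by simp
        then show ?thesis using comp[OF w]
          by (metis (no_types, lifting) Un_iff insertCI vec.span_add vec.span_base vec.span_scale)
      qed
      then show "N = vec.span ({x, y} \<union> ?N')"
        using vec.span_minimal[OF _ N(1), of "{x, y} \<union> ?N'"] 2(2) yN by auto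
      have "u \<in> rad V b N" if u: "u \<in> rad ?V' b ?N'" for u
      proof -
        have uN: "u \<in> N" "u \<in> V" "u \<in> ?V'" "\<And>w. w \<in> ?N' \<Longrightarrow> b u w = 0"
          using u by (auto simp: rad_def perp_def)
        have ux: "b u x = 0" "b u y = 0" using orthogonal_V'[OF xV 2(3) y refl uN(3)] by blast+
        have "b u w = 0" if w: "w \<in> N" for w
        proof -
          have "b u (w - (\<epsilon> * b y w) *s x - b x w *s y) = 0" using uN(4)[OF comp[OF w]] .
          then show ?thesis using uN w N xV y ux by (simp add: bilin mem_V subset_iff)
        qed
        then show ?thesis using uN by (auto simp: rad_def perp_def)
      qed
      moreover have "0 \<in> rad ?V' b ?N'"
        using N(1) vec.subspace_0 mem_V(1) xV y by (auto simp: rad_def perp_def zero_left zero_right)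
      ultimately have "rad ?V' b ?N' = {0}" using 2(1) by auto
      then show "rad ?V' b ?N' = {0} \<and> rad V b N = {0} \<and> ({x, y} = {} \<or> {x, y} = {x, y}) \<or>
        {x, y} = {x} \<and> rad V b N = vec.span (insert x (rad ?V' b ?N'))" using 2(1) by blast
    qed auto
  next
    case (3 x)
    have xV: "x \<in> V" and xN: "\<And>w. w \<in> N \<Longrightarrow> b x w = 0" using 3 by (auto simp: perp_def)
    obtain z where z: "z \<in> V" "b x z \<noteq> 0"
      using nd xV 3(4) unfolding nondegenerate_on_def by blast
    \<comment> \<open>A partner of \<open>x\<close> inside \<open>?P\<close>: the component
      \<open>a\<close> of \<open>z\<close> in \<open>N\<close> is invisible to \<open>x\<close>, so
      \<open>z - a\<close> still pairs nontrivially with \<open>x\<close>.\<close>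
    obtain a where a: "a \<in> N" "z - a \<in> ?P" using orthogonal_decomposition[OF N 3(1) z(1)] .
    have "b x (z - a) \<noteq> 0" using z a xN[OF a(1)] xV N by (simp add: bilin subset_iff)
    then obtain y where yP: "y \<in> ?P" and y': "b y y = 0" "b x y = 1"
      using hyperbolic_partner[OF P 3(2,3) a(2)] by metis
    have y: "y \<in> V" "b y y = 0" "b x y = 1" using yP y' P by auto
    have yN: "\<And>w. w \<in> N \<Longrightarrow> b y w = 0" using yP by (auto simp: perp_def)
    let ?V' = "{v \<in> V. b x v = 0 \<and> b y v = 0}"
    have NV': "N \<subseteq> ?V'" using N xN yN by auto
    show ?thesis
    proof (rule step[OF xV 3(3) y refl, of N "{}"])
      show "vec.subspace N" by (rule N)
      show "N \<subseteq> ?V'" by (rule NV')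
      show "N = vec.span ({} \<union> N)"
        unfolding Un_empty_left by (rule sym, rule vec.span_eq_iff[THEN iffD2, OF N(1)])
      have "rad ?V' b N = rad V b N" using NV' by (auto simp: rad_def perp_def)
      then show "rad ?V' b N = {0} \<and> rad V b N = {0} \<and> ({} = {} \<or> {} = {x, y}) \<or>
        {} = {x} \<and> rad V b N = vec.span (insert x (rad ?V' b N))" using 3(1) by simp
    qed
  next
    case 4
    then show ?thesis by (rule witt_frame_anisotropic[OF N])
  qed
qed

section \<open>Triangular systems of polynomial equations\<close>

text \<open>The assumption \<open>diff\<close> says that \<open>E v\<close> is
  \<open>\<gamma> v * x v\<close> plus a function of the coordinates of smaller rank.
  \<open>\<Phi>\<close> corrects all pivots simultaneously; after \<open>n\<close> rounds the pivots
  of rank below \<open>n\<close> depend on the free coordinates only. So finitely many rounds solve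
  the system, and the solution is polynomial.\<close>

lemma triangular_elimination:
  fixes E :: "'v \<Rightarrow> ('v \<Rightarrow> complex) \<Rightarrow> complex" and \<rho> :: "'v \<Rightarrow> nat"
  assumes P: "finite P" and poly: "\<And>v. v \<in> P \<Longrightarrow> E v \<in> polynomial_functions"
    and \<gamma>: "\<And>v. v \<in> P \<Longrightarrow> \<gamma> v \<noteq> 0"
    and diff: "\<And>v x y. v \<in> P \<Longrightarrow> (\<And>w. \<rho> w < \<rho> v \<Longrightarrow> x w = y w) \<Longrightarrow> E v x - E v y = \<gamma> v * (x v - y v)"
  obtains G where "\<And>v. (\<lambda>x. G x v) \<in> polynomial_functions" "\<And>x v. v \<in> P \<Longrightarrow> E v (G x) = 0"
    "\<And>x v. v \<notin> P \<Longrightarrow> G x v = x v"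
    "\<And>x y. (\<And>v. v \<in> P \<Longrightarrow> E v x = 0) \<Longrightarrow> (\<And>v. v \<notin> P \<Longrightarrow> x v = y v) \<Longrightarrow> G y = x"
proof -
  define \<Phi> where "\<Phi> x = (\<lambda>v. if v \<in> P then x v - E v x / \<gamma> v else x v)" for x
  have \<Phi>: "v \<in> P \<Longrightarrow> \<Phi> x v = x v - E v x / \<gamma> v" "v \<notin> P \<Longrightarrow> \<Phi> x v = x v" for x v
    by (auto simp: \<Phi>_def)
  obtain K where K: "\<And>v. v \<in> P \<Longrightarrow> \<rho> v < K"
    using P by (metis finite_imageI finite_nat_set_iff_bounded imageI)
  have off: "(\<Phi> ^^ n) x v = x v" if "v \<notin> P" for n x v
    using that by (induction n) (auto simp: \<Phi>)
  have stable: "(\<Phi> ^^ n) x v = (\<Phi> ^^ n) y v"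
    if xy: "\<And>v. v \<notin> P \<Longrightarrow> x v = y v" and v: "v \<in> P \<Longrightarrow> \<rho> v < n" for n x y v
    using v
  proof (induction n arbitrary: v)
    case 0
    then show ?case using xy by auto
  next
    case (Suc n)
    show ?case
    proof (cases "v \<in> P")
      case True
      have "E v ((\<Phi> ^^ n) x) - E v ((\<Phi> ^^ n) y) = \<gamma> v * ((\<Phi> ^^ n) x v - (\<Phi> ^^ n) y v)"
      proof (rule diff[OF True])
        fix w assume "\<rho> w < \<rho> v"
        then show "(\<Phi> ^^ n) x w = (\<Phi> ^^ n) y w" using Suc.prems[OF True] by (intro Suc.IH) simp
      qed
      then show ?thesis using True \<gamma>[OF True] by (simp add: \<Phi> field_simps)
    next
      case False
      then show ?thesis using xy off by metis
    qed
  qed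
  have G_cong: "(\<Phi> ^^ K) x = (\<Phi> ^^ K) y" if "\<And>v. v \<notin> P \<Longrightarrow> x v = y v" for x y
    by (rule ext, rule stable) (use that K in auto)
  have fixed: "(\<Phi> ^^ n) x = x" if "\<And>v. v \<in> P \<Longrightarrow> E v x = 0" for x n
  proof -
    have "\<Phi> x v = x v" for v using that by (cases "v \<in> P") (simp_all add: \<Phi>)
    then have "\<Phi> x = x" by (rule ext)
    then show ?thesis by (induction n) auto
  qed
  show thesis
  proof (rule that[of "\<Phi> ^^ K"])
    have step: "(\<lambda>x. \<Phi> x v) \<in> polynomial_functions" for v
    proof (cases "v \<in> P")
      case True
      have "(\<lambda>x. x v - E v x * (1 / \<gamma> v)) \<in> polynomial_functions"
        by (intro polynomial_intros poly True)
      then show ?thesis using True by (simp add: \<Phi>)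
    qed (simp add: \<Phi> polynomial_functions.var)
    show "(\<lambda>x. (\<Phi> ^^ K) x v) \<in> polynomial_functions" for v
    proof (induction K arbitrary: v)
      case (Suc K)
      show ?case using polynomial_subst[OF step Suc] by simp
    qed (simp add: polynomial_functions.var)
    show "E v ((\<Phi> ^^ K) x) = 0" if "v \<in> P" for x v
    proof -
      \<comment> \<open>An additional first round changes only pivots and so does not affect the
        result. Hence the result is a fixed point of \<open>\<Phi>\<close>, that is, a
        solution.\<close>
      have "(\<Phi> ^^ K) (\<Phi> x) = (\<Phi> ^^ K) x" by (rule G_cong) (simp add: \<Phi>)
      then have "\<Phi> ((\<Phi> ^^ K) x) v = (\<Phi> ^^ K) x v" by (simp add: funpow_swap1)
      then show ?thesis using that \<gamma>[OF that] by (simp add: \<Phi>)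
    qed
    show "(\<Phi> ^^ K) x v = x v" if "v \<notin> P" for x v by (rule off[OF that])
    show "(\<Phi> ^^ K) y = x" if "\<And>v. v \<in> P \<Longrightarrow> E v x = 0" "\<And>v. v \<notin> P \<Longrightarrow> x v = y v" for x y
      using fixed[OF that(1)] G_cong[of y x] that(2) by simp
  qed
qed

section \<open>Echelon forms\<close>

locale frame =
  fixes T :: "nat set" and E :: "nat \<Rightarrow> complex ^ 'n"
  assumes finite_T: "finite T" and inj_E: "inj_on E T"
    and independent_E: "vec.independent (E ` T)" and span_E: "vec.span (E ` T) = UNIV"
begin

text \<open>The value 0 outside \<open>T\<close> allows conditions such as \<open>s > t\<close> to
  range over all natural numbers.\<close>

definition co :: "nat \<Rightarrow> complex ^ 'n \<Rightarrow> complex" where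
  "co t x = (if t \<in> T then vec.representation (E ` T) x (E t) else 0)"

lemma co_add: "co t (x + y) = co t x + co t y"
  by (simp add: co_def vec.representation_add[OF independent_E] span_E)

lemma co_scale: "co t (c *s x) = c * co t x"
  by (simp add: co_def vec.representation_scale[OF independent_E] span_E)

lemma co_zero: "co t 0 = 0" using co_scale[of t 0 0] by simp

lemma co_diff: "co t (x - y) = co t x - co t y"
  using co_add[of t "x - y" y] by simp

lemma co_sum: "co t (\<Sum>i\<in>I. f i) = (\<Sum>i\<in>I. co t (f i))"
  by (induction I rule: infinite_finite_induct) (auto simp: co_add co_zero)

lemmas co_simps = co_add co_scale co_zero co_diff co_sum

lemma co_E: "t \<in> T \<Longrightarrow> co s (E t) = (if s = t then 1 else 0)"
  using inj_E by (auto simp: co_def vec.representation_basis[OF independent_E] inj_on_def)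

lemma co_outside: "t \<notin> T \<Longrightarrow> co t x = 0" by (simp add: co_def)

lemma expansion: "x = (\<Sum>t\<in>T. co t x *s E t)"
proof -
  have "x = (\<Sum>b\<in>E ` T. vec.representation (E ` T) x b *s b)"
    using vec.sum_representation_eq[OF independent_E, of x "E ` T"] finite_T span_E by auto
  also have "\<dots> = (\<Sum>t\<in>T. co t x *s E t)"
    by (simp add: sum.reindex[OF inj_E] co_def)
  finally show ?thesis .
qed

lemma co_ext: "(\<And>t. t \<in> T \<Longrightarrow> co t x = co t y) \<Longrightarrow> x = y"
  by (subst expansion, subst (2) expansion, rule sum.cong) auto

lemma co_axis: "co t x = (\<Sum>a\<in>UNIV. x $ a * co t (axis a 1))"
proof -
  have "x = (\<Sum>a\<in>UNIV. x $ a *s axis a 1)" by (simp add: basis_expansion)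
  then have "co t x = co t (\<Sum>a\<in>UNIV. x $ a *s axis a 1)" by simp
  then show ?thesis by (simp only: co_simps)
qed

lemma card_T: "card T = CARD('n)"
  using vec.dim_eq_card[of "E ` T" UNIV] independent_E span_E card_image[OF inj_E]
  by (simp add: card_cart_basis)

text \<open>Two uses: for \<open>J\<close> the jumps of a subspace it is the complement that defines
  a chart, and for \<open>J\<close> the rest of a lower set of \<open>T\<close> it is a member of
  the flag.\<close>

definition coord_subspace :: "nat set \<Rightarrow> (complex ^ 'n) set" where
  "coord_subspace J = {x. \<forall>t\<in>J. co t x = 0}"

lemma subspace_coord: "vec.subspace (coord_subspace J)"
  unfolding coord_subspace_def by (auto intro!: vec.subspaceI simp: co_simps)

lemma coord_subspace_eq_span: "J \<subseteq> T \<Longrightarrow> coord_subspace J = vec.span (E ` (T - J))"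
proof
  assume J: "J \<subseteq> T"
  show "vec.span (E ` (T - J)) \<subseteq> coord_subspace J"
    by (rule vec.span_minimal[OF _ subspace_coord]) (auto simp: coord_subspace_def co_E)
  show "coord_subspace J \<subseteq> vec.span (E ` (T - J))"
  proof
    fix x assume x: "x \<in> coord_subspace J"
    have "(\<Sum>t\<in>T. co t x *s E t) = (\<Sum>t\<in>T - J. co t x *s E t)"
      by (rule sum.mono_neutral_right) (use finite_T x in \<open>auto simp: coord_subspace_def\<close>)
    then have "x = (\<Sum>t\<in>T - J. co t x *s E t)" using expansion[of x] by simp
    moreover have "(\<Sum>t\<in>T - J. co t x *s E t) \<in> vec.span (E ` (T - J))"
      by (intro vec.span_sum vec.span_scale vec.span_base imageI)
    ultimately show "x \<in> vec.span (E ` (T - J))" by simp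
  qed
qed

lemma dim_coord_subspace: "J \<subseteq> T \<Longrightarrow> vec.dim (coord_subspace J) + card J = CARD('n)"
proof -
  assume J: "J \<subseteq> T"
  have "vec.dim (coord_subspace J) = card (E ` (T - J))"
    unfolding coord_subspace_eq_span[OF J]
    by (rule vec.dim_span_eq_card_independent) (rule vec.independent_mono[OF independent_E], auto)
  also have "\<dots> = card (T - J)" by (rule card_image) (rule inj_on_subset[OF inj_E], auto)
  finally show ?thesis
    using card_T J finite_T by (metis card_Diff_subset card_mono finite_subset le_add_diff_inverse2)
qed

section \<open>Leading coordinates and jumps\<close>

definition lead :: "nat \<Rightarrow> complex ^ 'n \<Rightarrow> bool" where
  "lead t v \<longleftrightarrow> co t v = 1 \<and> (\<forall>s>t. co s v = 0)"

definition jumps :: "(complex ^ 'n) set \<Rightarrow> nat set" where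
  "jumps L = {t. \<exists>v\<in>L. lead t v}"

lemma lead_in_T: "lead t v \<Longrightarrow> t \<in> T"
  by (auto simp: lead_def co_def split: if_splits)

lemma jumps_subset: "jumps L \<subseteq> T"
  using lead_in_T by (auto simp: jumps_def)

lemma finite_jumps: "finite (jumps L)"
  using jumps_subset finite_T finite_subset by blast

lemma jumps_mono: "L \<subseteq> L' \<Longrightarrow> jumps L \<subseteq> jumps L'"
  by (auto simp: jumps_def)

lemma lead_unique: "lead s v \<Longrightarrow> lead t v \<Longrightarrow> s = t"
  unfolding lead_def by (metis linorder_neqE_nat zero_neq_one)

lemma leading_index:
  assumes "x \<noteq> 0"
  obtains t where "t \<in> T" "co t x \<noteq> 0" "\<And>s. s > t \<Longrightarrow> co s x = 0"
proof -
  let ?S = "{t \<in> T. co t x \<noteq> 0}"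
  have "?S \<noteq> {}" using co_ext[of x 0] assms by (auto simp: co_zero)
  moreover have fin: "finite ?S" using finite_T by auto
  ultimately have m: "Max ?S \<in> ?S" by (rule Max_in[rotated])
  have "co s x = 0" if "s > Max ?S" for s
    using Max_ge[OF fin, of s] that co_outside[of s x] by fastforce
  then show thesis using that m by blast
qed

lemma jumpsI:
  assumes "vec.subspace L" "x \<in> L" "co t x \<noteq> 0" "\<And>s. s > t \<Longrightarrow> co s x = 0"
  shows "t \<in> jumps L"
proof -
  have "(1 / co t x) *s x \<in> L" using assms by (auto intro: vec.subspace_scale)
  moreover have "lead t ((1 / co t x) *s x)" using assms by (simp add: lead_def co_simps)
  ultimately show ?thesis by (auto simp: jumps_def)
qed

lemma zero_on_jumps:
  assumes "vec.subspace L" "x \<in> L" "\<And>t. t \<in> jumps L \<Longrightarrow> co t x = 0"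
  shows "x = 0"
  using leading_index[of x] jumpsI[OF assms(1,2)] assms(3) by metis

lemma lead_independent:
  assumes J: "finite J" and v: "\<And>t. t \<in> J \<Longrightarrow> lead t (v t)"
  shows "inj_on v J" "vec.independent (v ` J)"
proof -
  show inj: "inj_on v J" using v lead_unique by (metis inj_onI)
  show "vec.independent (v ` J)"
  proof (rule vec.independent_if_scalars_zero)
    show "finite (v ` J)" using J by simp
    fix f x assume 0: "(\<Sum>x\<in>v ` J. f x *s x) = 0" and x: "x \<in> v ` J"
    have sum0: "(\<Sum>t\<in>J. f (v t) *s v t) = 0" using 0 by (simp add: sum.reindex[OF inj])
    let ?S = "{t \<in> J. f (v t) \<noteq> 0}"
    show "f x = 0"
    proof (rule ccontr)
      assume "f x \<noteq> 0"
      then have "?S \<noteq> {}" using x by auto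
      moreover have fin: "finite ?S" using J by auto
      ultimately have m: "Max ?S \<in> ?S" by (rule Max_in[rotated])
      let ?m = "Max ?S"
      have "f (v t) * co ?m (v t) = 0" if t: "t \<in> J - {?m}" for t
      proof (cases "f (v t) = 0")
        case False
        then have "t < ?m" using Max_ge[OF fin, of t] t by fastforce
        then show ?thesis using v[of t] t by (simp add: lead_def)
      qed simp
      then have "(\<Sum>t\<in>J - {?m}. f (v t) * co ?m (v t)) = 0"
        by (intro sum.neutral ballI) blast
      moreover have "?m \<in> J" using m by blast
      ultimately have "(\<Sum>t\<in>J. f (v t) * co ?m (v t)) = f (v ?m) * co ?m (v ?m)"
        using sum.remove[OF J, of ?m "\<lambda>t. f (v t) * co ?m (v t)"] by simp
      moreover have "(\<Sum>t\<in>J. f (v t) * co ?m (v t)) = 0"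
        using sum0 co_sum[of ?m "\<lambda>t. f (v t) *s v t" J] by (simp add: co_simps)
      ultimately show False using m v[of ?m] by (auto simp: lead_def)
    qed
  qed
qed

text \<open>The leading position of a nonzero vector of \<open>L\<close> is a jump, so no such
  vector vanishes at all jumps; vectors with distinct leading positions give the dimension. In
  consequence all subspaces with the same jumps lie in one chart.\<close>

lemma complementary_jumps:
  assumes L: "vec.subspace L"
  shows "complementary L (coord_subspace (jumps L))" and "vec.dim L = card (jumps L)"
proof -
  have int: "L \<inter> coord_subspace (jumps L) = {0}"
    using zero_on_jumps[OF L] L by (auto simp: coord_subspace_def co_zero vec.subspace_0)
  have "\<exists>v. \<forall>t\<in>jumps L. v t \<in> L \<and> lead t (v t)"
    by (rule bchoice) (auto simp: jumps_def)
  then obtain v where v: "\<And>t. t \<in> jumps L \<Longrightarrow> v t \<in> L \<and> lead t (v t)" by blast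
  have "card (jumps L) = card (v ` jumps L)"
    using card_image[OF lead_independent(1)[OF finite_jumps, of L v]] v by simp
  also have "\<dots> \<le> vec.dim L"
    by (rule vec.independent_card_le_dim) (use v lead_independent(2)[OF finite_jumps, of L v] in auto)
  finally have le: "card (jumps L) \<le> vec.dim L" .
  then show c: "complementary L (coord_subspace (jumps L))"
    using dim_coord_subspace[OF jumps_subset, of L] by (intro complementaryI_dim L subspace_coord int) auto
  show "vec.dim L = card (jumps L)"
    using complementary_dim[OF c] dim_coord_subspace[OF jumps_subset, of L] by simp
qed

lemma span_leads:
  assumes L: "vec.subspace L" and v: "\<And>t. t \<in> jumps L \<Longrightarrow> v t \<in> L \<and> lead t (v t)"
  shows "vec.span (v ` jumps L) = L"
proof
  show "vec.span (v ` jumps L) \<subseteq> L" using v by (intro vec.span_minimal L) auto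
  have ind: "vec.independent (v ` jumps L)" "inj_on v (jumps L)"
    using lead_independent[OF finite_jumps, of L v] v by simp_all
  show "L \<subseteq> vec.span (v ` jumps L)"
    by (rule vec.card_ge_dim_independent)
       (use v ind complementary_jumps(2)[OF L] in \<open>auto simp: card_image\<close>)
qed

lemma jumps_span:
  assumes J: "finite J" and v: "\<And>t. t \<in> J \<Longrightarrow> lead t (v t)"
  shows "jumps (vec.span (v ` J)) = J" "vec.dim (vec.span (v ` J)) = card J"
proof -
  note ind = lead_independent[OF J v]
  show dim: "vec.dim (vec.span (v ` J)) = card J"
    using vec.dim_span_eq_card_independent[OF ind(2)] card_image[OF ind(1)] by simp
  have "J \<subseteq> jumps (vec.span (v ` J))"
    using v vec.span_base unfolding jumps_def by blast
  then show "jumps (vec.span (v ` J)) = J"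
    using card_subset_eq[OF finite_jumps, of J "vec.span (v ` J)"]
      complementary_jumps(2)[OF vec.subspace_span, of "v ` J"] dim by simp
qed

lemma jumps_Int_flag:
  assumes L: "vec.subspace L" and D: "\<And>s t. t \<in> D \<Longrightarrow> s \<in> T \<Longrightarrow> s \<le> t \<Longrightarrow> s \<in> D"
  shows "jumps (L \<inter> coord_subspace (T - D)) = jumps L \<inter> D"
    "vec.dim (L \<inter> coord_subspace (T - D)) = card (jumps L \<inter> D)"
proof -
  show *: "jumps (L \<inter> coord_subspace (T - D)) = jumps L \<inter> D"
  proof (intro equalityI subsetI)
    fix t assume "t \<in> jumps (L \<inter> coord_subspace (T - D))"
    then obtain v where v: "v \<in> L" "v \<in> coord_subspace (T - D)" "lead t v" by (auto simp: jumps_def)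
    then have "t \<in> D" using lead_in_T[of t v] by (force simp: coord_subspace_def lead_def)
    then show "t \<in> jumps L \<inter> D" using v by (auto simp: jumps_def)
  next
    fix t assume t: "t \<in> jumps L \<inter> D"
    then obtain v where v: "v \<in> L" "lead t v" by (auto simp: jumps_def)
    have "co s v = 0" if "s \<in> T - D" for s
      using D[of t s] that t v(2) by (force simp: lead_def not_le)
    then have "v \<in> coord_subspace (T - D)" by (auto simp: coord_subspace_def)
    then show "t \<in> jumps (L \<inter> coord_subspace (T - D))" using v by (auto simp: jumps_def)
  qed
  show "vec.dim (L \<inter> coord_subspace (T - D)) = card (jumps L \<inter> D)"
    using complementary_jumps(2)[OF vec.subspace_inter[OF L subspace_coord]] * by metis
qed

text \<open>Translates jumps into dimensions of intersections with the flag, for which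
  semicontinuity is known.\<close>

lemma jumps_iff_dim:
  assumes L: "vec.subspace L" and t: "t \<in> T"
  shows "t \<in> jumps L \<longleftrightarrow>
    vec.dim (L \<inter> coord_subspace {s \<in> T. s > t}) \<noteq> vec.dim (L \<inter> coord_subspace {s \<in> T. s \<ge> t})"
proof -
  have "{s \<in> T. s > t} = T - {..t}" "{s \<in> T. s \<ge> t} = T - {..<t}" by auto
  then have "vec.dim (L \<inter> coord_subspace {s \<in> T. s > t}) = card (jumps L \<inter> {..t})"
    "vec.dim (L \<inter> coord_subspace {s \<in> T. s \<ge> t}) = card (jumps L \<inter> {..<t})"
    using jumps_Int_flag(2)[OF L, of "{..t}"] jumps_Int_flag(2)[OF L, of "{..<t}"] by auto
  moreover have "jumps L \<inter> {..t} = (if t \<in> jumps L then insert t (jumps L \<inter> {..<t}) else jumps L \<inter> {..<t})"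
    by (auto simp: less_le)
  ultimately show ?thesis using finite_jumps[of L] by auto
qed

section \<open>The reduced echelon basis, read off from the chart\<close>

definition ech :: "(complex ^ 'n) set \<Rightarrow> nat \<Rightarrow> complex ^ 'n" where
  "ech L t = proj_along (coord_subspace (jumps L)) L *v E t"

lemma ech:
  assumes L: "vec.subspace L" and t: "t \<in> jumps L"
  shows "ech L t \<in> L" "\<And>s. s \<in> jumps L \<Longrightarrow> co s (ech L t) = (if s = t then 1 else 0)" "lead t (ech L t)"
proof -
  note c = complementary_jumps(1)[OF L]
  show in_L: "ech L t \<in> L" unfolding ech_def by (rule proj_along(1)[OF c])
  have "E t - ech L t \<in> coord_subspace (jumps L)" unfolding ech_def by (rule proj_along(2)[OF c])
  then show co: "co s (ech L t) = (if s = t then 1 else 0)" if "s \<in> jumps L" for s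
    using that co_E[of t s] t jumps_subset[of L] by (auto simp: coord_subspace_def co_diff)
  have ne: "ech L t \<noteq> 0" using co[OF t] by (auto simp: co_zero)
  obtain s where s: "s \<in> T" "co s (ech L t) \<noteq> 0" "\<And>r. r > s \<Longrightarrow> co r (ech L t) = 0"
    using leading_index[OF ne] by metis
  then have "s \<in> jumps L" using jumpsI[OF L in_L] by blast
  then have "s = t" using co s(2) by (metis (full_types))
  then show "lead t (ech L t)" using s(3) co[OF t] by (auto simp: lead_def)
qed

lemma ech_unique:
  assumes L: "vec.subspace L" and t: "t \<in> jumps L" and v: "v \<in> L"
    and co: "\<And>s. s \<in> jumps L \<Longrightarrow> co s v = (if s = t then 1 else 0)"
  shows "v = ech L t"
proof -
  have "v - ech L t = 0"
    by (rule zero_on_jumps[OF L]) (use v ech[OF L t] co in \<open>auto simp: co_diff intro: vec.subspace_diff[OF L]\<close>)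
  then show ?thesis by simp
qed

lemma proj_along_expansion:
  assumes L: "vec.subspace L"
  shows "proj_along (coord_subspace (jumps L)) L *v z = (\<Sum>t\<in>jumps L. co t z *s ech L t)"
proof (rule proj_along_eqI[OF complementary_jumps(1)[OF L]])
  show "(\<Sum>t\<in>jumps L. co t z *s ech L t) \<in> L"
    by (intro vec.subspace_sum[OF L] vec.subspace_scale[OF L] ech[OF L])
  have "co s (\<Sum>t\<in>jumps L. co t z *s ech L t) = co s z" if s: "s \<in> jumps L" for s
  proof -
    have "co s (\<Sum>t\<in>jumps L. co t z *s ech L t) = (\<Sum>t\<in>jumps L. if s = t then co t z else 0)"
      using ech(2)[OF L _ s] by (auto simp: co_simps intro!: sum.cong)
    then show ?thesis using s finite_jumps[of L] by simp
  qed
  then show "z - (\<Sum>t\<in>jumps L. co t z *s ech L t) \<in> coord_subspace (jumps L)"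
    by (auto simp: coord_subspace_def co_diff)
qed

lemma polynomial_co:
  "(\<And>a. (\<lambda>x. f x $ a) \<in> polynomial_functions) \<Longrightarrow> (\<lambda>x. co t (f x)) \<in> polynomial_functions"
  by (subst co_axis) (intro polynomial_intros)

text \<open>The leading coefficients are 1, so the passage from the \<open>w t x\<close> to the
  reduced echelon basis requires no division. The entries of the projection are linear in that
  basis.\<close>

lemma polynomial_proj_along:
  fixes w :: "nat \<Rightarrow> ('v \<Rightarrow> complex) \<Rightarrow> complex ^ 'n"
  assumes J: "finite J" and lead: "\<And>t x. t \<in> J \<Longrightarrow> lead t (w t x)"
    and poly: "\<And>t a. t \<in> J \<Longrightarrow> (\<lambda>x. w t x $ a) \<in> polynomial_functions"
  shows "(\<lambda>x. proj_along (coord_subspace J) (vec.span ((\<lambda>t. w t x) ` J)) $ a $ b) \<in> polynomial_functions"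
proof -
  let ?L = "\<lambda>x. vec.span ((\<lambda>t. w t x) ` J)"
  have jumps: "jumps (?L x) = J" for x by (rule jumps_span(1)[OF J lead])
  \<comment> \<open>Back substitution: the coordinates of \<open>w t x\<close> at smaller jumps are
    cleared with the reduced vectors already found.\<close>
  have rec: "ech (?L x) t = w t x - (\<Sum>s\<in>{s \<in> J. s < t}. co s (w t x) *s ech (?L x) s)" if t: "t \<in> J" for t x
  proof (rule sym, rule ech_unique[OF vec.subspace_span])
    show "t \<in> jumps (?L x)" using jumps t by simp
    have "ech (?L x) s \<in> ?L x" if "s \<in> J" for s
      using ech(1)[OF vec.subspace_span, of s "(\<lambda>t. w t x) ` J"] jumps that by simp
    moreover have "w t x \<in> ?L x" using t by (intro vec.span_base imageI)
    ultimately show "w t x - (\<Sum>s\<in>{s \<in> J. s < t}. co s (w t x) *s ech (?L x) s) \<in> ?L x"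
      by (intro vec.span_diff vec.span_sum vec.span_scale) auto
    fix r assume "r \<in> jumps (?L x)"
    then have r: "r \<in> J" using jumps by simp
    have "co r (\<Sum>s\<in>{s \<in> J. s < t}. co s (w t x) *s ech (?L x) s) =
      (\<Sum>s\<in>{s \<in> J. s < t}. if r = s then co s (w t x) else 0)"
      unfolding co_sum
    proof (rule sum.cong[OF refl])
      fix s assume "s \<in> {s \<in> J. s < t}"
      then have "co r (ech (?L x) s) = (if r = s then 1 else 0)"
        using ech(2)[OF vec.subspace_span, of s "(\<lambda>t. w t x) ` J" r] jumps r by simp
      then show "co r (co s (w t x) *s ech (?L x) s) = (if r = s then co s (w t x) else 0)"
        by (simp add: co_scale)
    qed
    also have "\<dots> = (if r < t then co r (w t x) else 0)" using J r by (simp add: sum.delta)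
    finally show "co r (w t x - (\<Sum>s\<in>{s \<in> J. s < t}. co s (w t x) *s ech (?L x) s)) = (if r = t then 1 else 0)"
      using lead[OF t, of x] by (auto simp: co_diff lead_def not_less)
  qed
  have ech_poly: "(\<lambda>x. ech (?L x) t $ a) \<in> polynomial_functions" if "t \<in> J" for t a
    using that
  proof (induction t arbitrary: a rule: less_induct)
    case (less t)
    have "(\<lambda>x. w t x $ a - (\<Sum>s\<in>{s \<in> J. s < t}. co s (w t x) * ech (?L x) s $ a)) \<in> polynomial_functions"
      by (intro polynomial_diff polynomial_sum polynomial_functions.mult polynomial_co poly less) auto
    then show ?case using rec[OF less.prems] by (simp add: sum_component)
  qed
  have "proj_along (coord_subspace J) (?L x) $ a $ b = (\<Sum>t\<in>J. co t (axis b 1) * ech (?L x) t $ a)" for x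
  proof -
    have "proj_along (coord_subspace J) (?L x) $ a $ b = (proj_along (coord_subspace J) (?L x) *v axis b 1) $ a"
      by (simp add: matrix_vector_mult_axis column_def)
    also have "\<dots> = (\<Sum>t\<in>J. co t (axis b 1) *s ech (?L x) t) $ a"
      using proj_along_expansion[OF vec.subspace_span, of "(\<lambda>t. w t x) ` J"] jumps by simp
    finally show ?thesis by (simp add: sum_component)
  qed
  moreover have "(\<lambda>x. \<Sum>t\<in>J. co t (axis b 1) * ech (?L x) t $ a) \<in> polynomial_functions"
    by (intro polynomial_sum polynomial_functions.mult polynomial_functions.const ech_poly)
  ultimately show ?thesis by simp
qed

end

section \<open>The equations of a cell\<close>

text \<open>A coordinate model of the orthogonal sum of the forms: \<open>blk\<close> is the summand
  of a basis vector, \<open>star\<close> the dual index, and \<open>c\<close> the value of the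
  pairing with the dual vector. By \<open>star_sum\<close>, \<open>star\<close> reverses the order
  of each block.\<close>

locale graded_form = frame T E for T :: "nat set" and E :: "nat \<Rightarrow> complex ^ 'n" +
  fixes blk star :: "nat \<Rightarrow> nat" and c \<epsilon> :: "nat \<Rightarrow> complex"
  assumes star_T: "t \<in> T \<Longrightarrow> star t \<in> T" and blk_star: "t \<in> T \<Longrightarrow> blk (star t) = blk t"
    and star_star: "t \<in> T \<Longrightarrow> star (star t) = t"
    and star_sum: "s \<in> T \<Longrightarrow> t \<in> T \<Longrightarrow> blk s = blk t \<Longrightarrow> s + star s = t + star t"
    and c_nonzero: "t \<in> T \<Longrightarrow> c t \<noteq> 0" and c_star: "t \<in> T \<Longrightarrow> c (star t) = \<epsilon> (blk t) * c t"
    and sign: "t \<in> T \<Longrightarrow> \<epsilon> (blk t) = 1 \<or> \<epsilon> (blk t) = -1"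
begin

definition block_proj :: "nat \<Rightarrow> complex ^ 'n \<Rightarrow> complex ^ 'n" where
  "block_proj i x = (\<Sum>t\<in>{t \<in> T. blk t = i}. co t x *s E t)"

lemma co_block_proj: "co s (block_proj i x) = (if s \<in> T \<and> blk s = i then co s x else 0)"
proof -
  have "co s (block_proj i x) = (\<Sum>t\<in>{t \<in> T. blk t = i}. if s = t then co t x else 0)"
    unfolding block_proj_def co_sum by (rule sum.cong) (auto simp: co_scale co_E)
  also have "\<dots> = (if s \<in> T \<and> blk s = i then co s x else 0)"
    using finite_T by simp
  finally show ?thesis .
qed

definition form :: "complex ^ 'n \<Rightarrow> complex ^ 'n \<Rightarrow> complex" where
  "form x y = (\<Sum>s\<in>T. co s x * co (star s) y * c s)"

lemma form_diff_left: "form (x - y) z = form x z - form y z"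
  and form_diff_right: "form z (x - y) = form z x - form z y"
  by (simp_all add: form_def co_diff algebra_simps sum_subtractf)

lemma form_reflexive:
  assumes y: "\<And>s. s \<in> T \<Longrightarrow> blk s \<noteq> i \<Longrightarrow> co s y = 0"
  shows "form x y = \<epsilon> i * form y x"
proof -
  have bij: "bij_betw star T T"
    by (rule bij_betw_byWitness[where f' = star]) (auto simp: star_T star_star)
  have "form y x = (\<Sum>s\<in>T. co (star s) y * co (star (star s)) x * c (star s))"
    unfolding form_def by (rule sum.reindex_bij_betw[OF bij, symmetric])
  then have "\<epsilon> i * form y x = (\<Sum>s\<in>T. \<epsilon> i * (co (star s) y * co (star (star s)) x * c (star s)))"
    by (simp add: sum_distrib_left)
  also have "\<dots> = form x y"
    unfolding form_def
  proof (rule sum.cong[OF refl])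
    fix s assume s: "s \<in> T"
    have sq: "\<epsilon> (blk s) * \<epsilon> (blk s) = 1" using sign[OF s] by auto
    show "\<epsilon> i * (co (star s) y * co (star (star s)) x * c (star s)) = co s x * co (star s) y * c s"
    proof (cases "blk s = i")
      case True
      then have "\<epsilon> i * (co (star s) y * co (star (star s)) x * c (star s)) =
        (\<epsilon> (blk s) * \<epsilon> (blk s)) * (co s x * co (star s) y * c s)"
        using s by (simp add: star_star c_star algebra_simps)
      then show ?thesis using sq by simp
    next
      case False
      then show ?thesis using y[of "star s"] s by (simp add: star_T blk_star)
    qed
  qed
  finally show ?thesis by simp
qed

lemma star_less: "s \<in> T \<Longrightarrow> t \<in> T \<Longrightarrow> blk s = blk t \<Longrightarrow> s < t \<Longrightarrow> star t < star s"
  using star_sum[of s t] by simp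

text \<open>Within the block of \<open>l\<close>, terms at positions above \<open>l\<close> are
  killed by \<open>u\<close>, and those below \<open>l\<close> by \<open>v\<close>, because
  \<open>star\<close> reverses the order.\<close>

lemma form_pairing:
  assumes l: "l \<in> T" and u: "\<And>s. s \<in> T \<Longrightarrow> blk s = blk l \<Longrightarrow> s > l \<Longrightarrow> co s u = 0"
    and v: "\<And>s. s \<in> T \<Longrightarrow> blk s = blk l \<Longrightarrow> s > star l \<Longrightarrow> co s v = 0"
    and v': "\<And>s. s \<in> T \<Longrightarrow> blk s \<noteq> blk l \<Longrightarrow> co s v = 0"
  shows "form u v = co l u * co (star l) v * c l"
proof -
  have "co s u * co (star s) v * c s = 0" if s: "s \<in> T - {l}" for s
  proof -
    consider "blk s \<noteq> blk l" | "blk s = blk l" "s > l" | "blk s = blk l" "s < l" using s by force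
    then show ?thesis
    proof cases
      case 1
      then show ?thesis using v'[of "star s"] s by (simp add: star_T blk_star)
    next
      case 2
      then show ?thesis using u[of s] s by simp
    next
      case 3
      then have "star s > star l" using star_less[of s l] s l by simp
      then show ?thesis using v[of "star s"] s 3 by (simp add: star_T blk_star)
    qed
  qed
  then have "(\<Sum>s\<in>T - {l}. co s u * co (star s) v * c s) = 0" by (intro sum.neutral ballI) blast
  then show ?thesis unfolding form_def by (simp add: sum.remove[OF finite_T l])
qed

lemma form_lead:
  assumes "lead j u" "lead k v" "blk j = blk k" "\<And>s. s \<in> T \<Longrightarrow> blk s \<noteq> blk k \<Longrightarrow> co s v = 0"
  shows "k < star j \<Longrightarrow> form u v = 0" "k = star j \<Longrightarrow> form u v = c j"
proof -
  have T: "j \<in> T" using assms(1) lead_in_T by auto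
  have *: "form u v = co (star j) v * c j" if "k \<le> star j"
    using form_pairing[OF T, of u v] assms that by (simp add: lead_def)
  show "k < star j \<Longrightarrow> form u v = 0" "k = star j \<Longrightarrow> form u v = c j"
    using * assms(2) by (auto simp: lead_def)
qed

text \<open>The differences of the arguments live at and below \<open>star k\<close> and
  \<open>star j\<close>. By \<open>form_pairing\<close> they meet only the leading coordinates of
  \<open>v\<close> and \<open>u'\<close>, which are 1. This makes the equations of a cell linear in
  their coordinates of top degree.\<close>

lemma form_diff:
  assumes lead: "lead j u'" "lead k v" and jk: "j \<in> T" "k \<in> T" "blk j = blk k"
    and u: "\<And>s. s > star k \<Longrightarrow> co s u = co s u'" and v: "\<And>s. s > star j \<Longrightarrow> co s v = co s v'"
    and vb: "\<And>s. s \<in> T \<Longrightarrow> blk s \<noteq> blk k \<Longrightarrow> co s v = 0" "\<And>s. s \<in> T \<Longrightarrow> blk s \<noteq> blk k \<Longrightarrow> co s v' = 0"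
  shows "form u v - form u' v' =
    (co (star k) u - co (star k) u') * c (star k) + (co (star j) v - co (star j) v') * c j"
proof -
  have "form u v - form u' v' = form (u - u') v + form u' (v - v')"
    by (simp add: form_diff_left form_diff_right)
  moreover have "form (u - u') v = co (star k) (u - u') * co (star (star k)) v * c (star k)"
    by (rule form_pairing) (use lead jk u vb in \<open>auto simp: star_T star_star blk_star co_diff lead_def\<close>)
  moreover have "form u' (v - v') = co j u' * co (star j) (v - v') * c j"
    by (rule form_pairing) (use lead jk v vb in \<open>auto simp: co_diff lead_def\<close>)
  ultimately show ?thesis using lead jk by (simp add: star_star co_diff lead_def)
qed

lemma form_block_proj:
  assumes "\<And>s. s \<in> T \<Longrightarrow> blk s \<noteq> i \<Longrightarrow> co s v = 0"
  shows "form (block_proj i u) v = form u v"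
  unfolding form_def
proof (rule sum.cong[OF refl])
  fix s assume s: "s \<in> T"
  show "co s (block_proj i u) * co (star s) v * c s = co s u * co (star s) v * c s"
    using assms[of "star s"] s by (auto simp: co_block_proj star_T blk_star)
qed

end

text \<open>
  The chain of the \<open>P_i\<close> and \<open>H_i\<close> is spanned by vectors \<open>w j\<close>, the isotropic spaces by vectors \<open>z k\<close>, with
  coordinates \<open>x\<close>. The sets \<open>JQ\<close>, \<open>JR\<close> and \<open>JP\<close> contain the jumps of the spaces \<open>pr_i P_i\<close>, \<open>pr_i H_i\<close> and
  \<open>P~_i\<close> for all \<open>i\<close>, and \<open>lev j\<close> is the position in the chain where the jump \<open>j\<close> appears.
\<close>

locale cell = graded_form T E blk star c \<epsilon>
  for T :: "nat set" and E :: "nat \<Rightarrow> complex ^ 'n" and blk star :: "nat \<Rightarrow> nat" and c \<epsilon> :: "nat \<Rightarrow> complex" +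
  fixes M :: "(complex ^ 'n) set" and lev :: "nat \<Rightarrow> nat" and JQ JR JP reg :: "nat set"
  assumes subspace_M: "vec.subspace M"
    and JR_subset: "JR \<subseteq> jumps M" and JQ_subset: "JQ \<subseteq> JR" "JQ \<subseteq> JP" and JP_subset: "JP \<subseteq> T"
    and lev_less: "j \<in> JR \<Longrightarrow> l \<in> jumps M \<Longrightarrow> blk l = blk j \<Longrightarrow> l \<notin> JR \<Longrightarrow> lev j < lev l"
    and star_JP: "k \<in> JP \<Longrightarrow> star k \<notin> JP" and star_JR: "j \<in> JR \<Longrightarrow> star j \<notin> JP"
    and reg: "JR \<inter> JP \<subseteq> reg"
    and star_reg: "k \<in> JP \<Longrightarrow> k \<in> reg \<Longrightarrow> j \<in> JR \<Longrightarrow> blk j = blk k \<Longrightarrow> star k < j \<Longrightarrow> star k \<in> jumps M"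
begin

lemmas in_T = subsetD[OF JP_subset] subsetD[OF subset_trans[OF JR_subset jumps_subset]]

text \<open>\<open>w j\<close> is the reduced echelon vector with leading position \<open>j\<close>
  in the chain space where \<open>j\<close> first appears. A jump \<open>t\<close> with
  \<open>lev t \<le> lev j\<close> belongs to that space too, so the coordinate there is zero if
  \<open>t\<close> differs from \<open>j\<close>.\<close>

definition w_vars :: "nat \<Rightarrow> nat set" where
  "w_vars j = {t \<in> jumps M. t < j \<and> lev j < lev t}"

definition p_vars :: "nat \<Rightarrow> nat set" where
  "p_vars k = {t \<in> T. t < k \<and> blk t = blk k \<and> t \<notin> JP}"

text \<open>Expanding in \<open>ech M\<close> instead of \<open>E\<close> keeps these vectors in
  \<open>M\<close> for every choice of coordinates.\<close>

definition w :: "(bool \<times> nat \<times> nat \<Rightarrow> complex) \<Rightarrow> nat \<Rightarrow> complex ^ 'n" where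
  "w x j = ech M j + (\<Sum>t\<in>w_vars j. x (True, t, j) *s ech M t)"

text \<open>For \<open>k\<close> in \<open>JQ\<close> a vector with this leading position is forced
  into \<open>P~_i\<close> by \<open>pr_i P_i\<close>; taking it avoids new coordinates and builds
  the inclusion into the parametrization.\<close>

definition z :: "(bool \<times> nat \<times> nat \<Rightarrow> complex) \<Rightarrow> nat \<Rightarrow> complex ^ 'n" where
  "z x k = (if k \<in> JQ then block_proj (blk k) (w x k)
     else E k + (\<Sum>t\<in>p_vars k. x (False, t, k) *s E t))"

lemma finite_vars: "finite (w_vars j)" "finite (p_vars k)"
  unfolding w_vars_def p_vars_def using finite_T finite_jumps by auto

lemma co_w_sum: "co s (w x j) = co s (ech M j) + (\<Sum>t\<in>w_vars j. x (True, t, j) * co s (ech M t))"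
  by (simp add: w_def co_simps)

lemma ech_M: "t \<in> jumps M \<Longrightarrow> s > t \<Longrightarrow> co s (ech M t) = 0" "t \<in> jumps M \<Longrightarrow> co t (ech M t) = 1"
  using ech(3)[OF subspace_M] by (auto simp: lead_def)

lemma lead_w: "j \<in> jumps M \<Longrightarrow> lead j (w x j)"
  using ech_M by (auto simp: lead_def co_w_sum w_vars_def intro!: sum.neutral)

lemma co_p: "k \<notin> JQ \<Longrightarrow> k \<in> T \<Longrightarrow>
  co s (z x k) = (if s = k then 1 else if s \<in> p_vars k then x (False, s, k) else 0)"
proof -
  assume k: "k \<notin> JQ" "k \<in> T"
  have "co s (\<Sum>t\<in>p_vars k. x (False, t, k) *s E t) = (\<Sum>t\<in>p_vars k. if s = t then x (False, t, k) else 0)"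
    unfolding co_sum by (rule sum.cong) (auto simp: co_scale co_E p_vars_def)
  also have "\<dots> = (if s \<in> p_vars k then x (False, s, k) else 0)"
    using finite_vars by simp
  finally show ?thesis using k by (auto simp: z_def co_add co_E p_vars_def)
qed

lemma z_block: "k \<in> JP \<Longrightarrow> blk s \<noteq> blk k \<Longrightarrow> co s (z x k) = 0"
proof (cases "k \<in> JQ")
  case True
  assume "blk s \<noteq> blk k"
  with True show ?thesis by (simp add: z_def co_block_proj)
qed (auto simp: co_p p_vars_def in_T)

lemma lead_z: "k \<in> JP \<Longrightarrow> lead k (z x k)"
proof (cases "k \<in> JQ")
  case True
  assume "k \<in> JP"
  moreover have "lead k (w x k)" using lead_w True JQ_subset JR_subset by blast
  ultimately show ?thesis using True by (auto simp: lead_def z_def co_block_proj in_T)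
qed (auto simp: lead_def co_p p_vars_def in_T)

lemma w_agree:
  assumes j: "j \<in> jumps M" and agree: "\<And>t. l < t \<Longrightarrow> t \<in> w_vars j \<Longrightarrow> x (True, t, j) = y (True, t, j)"
  shows "s > l \<Longrightarrow> co s (w x j) = co s (w y j)"
    and "co l (w x j) - co l (w y j) = (if l \<in> w_vars j then x (True, l, j) - y (True, l, j) else 0)"
proof -
  have M: "t \<in> jumps M" if "t \<in> w_vars j" for t using that by (auto simp: w_vars_def)
  show "co s (w x j) = co s (w y j)" if "s > l"
  proof -
    have "x (True, t, j) * co s (ech M t) = y (True, t, j) * co s (ech M t)" if "t \<in> w_vars j" for t
      using agree[OF _ that] ech_M(1)[OF M[OF that], of s] \<open>s > l\<close> by (cases "t > l") auto
    then have "(\<Sum>t\<in>w_vars j. x (True, t, j) * co s (ech M t)) = (\<Sum>t\<in>w_vars j. y (True, t, j) * co s (ech M t))"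
      by (rule sum.cong[OF refl])
    then show ?thesis by (simp only: co_w_sum)
  qed
  have "co l (w x j) - co l (w y j) = (\<Sum>t\<in>w_vars j. (x (True, t, j) - y (True, t, j)) * co l (ech M t))"
    by (simp add: co_w_sum left_diff_distrib sum_subtractf)
  also have "\<dots> = (\<Sum>t\<in>w_vars j. if l = t then x (True, t, j) - y (True, t, j) else 0)"
  proof (rule sum.cong[OF refl])
    fix t assume t: "t \<in> w_vars j"
    show "(x (True, t, j) - y (True, t, j)) * co l (ech M t) = (if l = t then x (True, t, j) - y (True, t, j) else 0)"
      using agree[OF _ t] ech_M[OF M[OF t]] by (cases l t rule: linorder_cases) auto
  qed
  also have "\<dots> = (if l \<in> w_vars j then x (True, l, j) - y (True, l, j) else 0)"
    using finite_vars by simp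
  finally show "co l (w x j) - co l (w y j) = (if l \<in> w_vars j then x (True, l, j) - y (True, l, j) else 0)" .
qed

definition z_vars :: "nat \<Rightarrow> nat set" where "z_vars k = (if k \<in> JQ then w_vars k else p_vars k)"

lemma z_agree:
  assumes k: "k \<in> JP" and l: "l \<in> T" "blk l = blk k"
    and agree: "\<And>t. l < t \<Longrightarrow> t \<in> z_vars k \<Longrightarrow> x (k \<in> JQ, t, k) = y (k \<in> JQ, t, k)"
  shows "s > l \<Longrightarrow> co s (z x k) = co s (z y k)"
    and "co l (z x k) - co l (z y k) = (if l \<in> z_vars k then x (k \<in> JQ, l, k) - y (k \<in> JQ, l, k) else 0)"
proof -
  have kT: "k \<in> T" using k in_T by auto
  have *: "(s > l \<longrightarrow> co s (z x k) = co s (z y k)) \<and>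
    co l (z x k) - co l (z y k) = (if l \<in> z_vars k then x (k \<in> JQ, l, k) - y (k \<in> JQ, l, k) else 0)" for s
  proof (cases "k \<in> JQ")
    case True
    then have "k \<in> jumps M" using JQ_subset JR_subset by blast
    note wa = w_agree[OF this, of l x y]
    show ?thesis
      using wa(1)[of s] wa(2) agree True l by (auto simp: z_def co_block_proj z_vars_def)
  next
    case False
    then show ?thesis
      using agree l kT by (auto simp: co_p z_vars_def) (auto simp: p_vars_def)
  qed
  show "s > l \<Longrightarrow> co s (z x k) = co s (z y k)"
    "co l (z x k) - co l (z y k) = (if l \<in> z_vars k then x (k \<in> JQ, l, k) - y (k \<in> JQ, l, k) else 0)"
    using * by blast+
qed

section \<open>The equations and their pivots\<close>

definition solution :: "(bool \<times> nat \<times> nat \<Rightarrow> complex) \<Rightarrow> bool" where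
  "solution x \<longleftrightarrow> (\<forall>k\<in>JP. (\<forall>j\<in>JR. blk j = blk k \<longrightarrow> form (w x j) (z x k) = 0) \<and>
     (\<forall>j\<in>JP - JQ. k \<notin> JQ \<and> blk j = blk k \<longrightarrow> form (z x j) (z x k) = 0))"

text \<open>
  Each equation \<open>form (w j) (z k) = 0\<close> or \<open>form (z j) (z k) = 0\<close> with \<open>star j < k\<close> is solved for one of the
  coordinates of its arguments at \<open>star k\<close> and \<open>star j\<close>, on which it depends linearly. The other coordinates
  of the same degree have smaller rank.
\<close>

definition precedes :: "nat \<Rightarrow> nat \<Rightarrow> bool" where
  "precedes j k \<longleftrightarrow> j < k \<or> j = k \<and> \<epsilon> (blk k) = 1"

text \<open>Of a regular and a nonregular index, the coordinate of the regular one is eliminated: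
  that of the nonregular one may be needed as the pivot of an equation with a vector
  \<open>w\<close>.\<close>

definition precedes_reg :: "nat \<Rightarrow> nat \<Rightarrow> bool" where
  "precedes_reg j k \<longleftrightarrow> (j \<notin> reg \<and> k \<in> reg) \<or> ((j \<in> reg \<longleftrightarrow> k \<in> reg) \<and> precedes j k)"

text \<open>A coordinate of \<open>w j\<close> at \<open>l\<close> exists only if \<open>l\<close>
  is a jump of \<open>M\<close>, which \<open>star_reg\<close> ensures for regular
  \<open>star l\<close>; for nonregular indices the equation with \<open>w\<close> is solved for
  \<open>z\<close>. If \<open>j\<close> and \<open>star l\<close> both lie in \<open>JQ\<close>, the
  equation agrees up to sign with its mirror image, and \<open>precedes\<close> keeps one of the
  two.\<close>

fun pivot :: "bool \<times> nat \<times> nat \<Rightarrow> bool" where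
  "pivot (True, l, j) \<longleftrightarrow> j \<in> JR \<and> l \<in> w_vars j \<and> blk l = blk j \<and> star l \<in> JP \<and> star l \<in> reg \<and>
     (j \<in> JQ \<and> star l \<in> JQ \<longrightarrow> precedes (star l) j)"
| "pivot (False, l, k) \<longleftrightarrow> k \<in> JP - JQ \<and> l \<in> p_vars k \<and>
     (k \<notin> reg \<and> star l \<in> JR \<or> star l \<in> JP - JQ \<and> precedes_reg (star l) k)"

fun equation :: "bool \<times> nat \<times> nat \<Rightarrow> (bool \<times> nat \<times> nat \<Rightarrow> complex) \<Rightarrow> complex" where
  "equation (True, l, j) x = form (w x j) (z x (star l))"
| "equation (False, l, k) x =
     (if k \<notin> reg \<and> star l \<in> JR then form (w x (star l)) (z x k) else form (z x (star l)) (z x k))"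

text \<open>The degree \<open>j - l\<close> dominates; a remainder below 4 breaks ties between the
  two top coordinates of one equation. Nonpivots have remainder 0. A \<open>w\<close> pivot paired
  with a \<open>z\<close> coordinate needs 2 to exceed the remainder 1 that the latter may have;
  paired with another \<open>w\<close> coordinate it may need 3. A \<open>z\<close> pivot gets 2
  where its partner may itself be the pivot of an equation with \<open>w\<close>.\<close>

fun rank :: "bool \<times> nat \<times> nat \<Rightarrow> nat" where
  "rank (True, l, j) = 4 * (j - l) + (if pivot (True, l, j) then if star l \<in> JQ then 3 else 2 else 0)"
| "rank (False, l, k) = 4 * (k - l) + (if pivot (False, l, k) then if star l \<notin> reg \<and> k \<in> reg then 2 else 1 else 0)"

text \<open>For a pivot, the factor 2 occurs on the diagonal, where both top coordinates of the
  equation are the same one. This concerns \<open>\<epsilon> = 1\<close> only, since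
  \<open>precedes\<close> excludes the diagonal otherwise.\<close>

fun coefficient :: "bool \<times> nat \<times> nat \<Rightarrow> complex" where
  "coefficient (q, l, j) = (if star l = j \<and> (q \<longrightarrow> j \<in> JQ) then 2 * c j else if q then c l else c (star l))"

lemma rank_less_if_closer: "l < t \<Longrightarrow> t < j \<Longrightarrow> j - l = j' - l' \<Longrightarrow> rank (q, t, j) < rank (q', l', j')"
proof -
  assume *: "l < t" "t < j" "j - l = j' - l'"
  have "rank (q, t, j) \<le> 4 * (j - t) + 3" by (cases q) auto
  moreover have "4 * (j' - l') \<le> rank (q', l', j')" by (cases q') auto
  ultimately show ?thesis using * by linarith
qed

text \<open>By \<open>form_diff\<close> two coordinates enter at top degree. One is
  \<open>v\<close>; the other coincides with \<open>v\<close>, is absent, or has the same degree and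
  a smaller tie-breaker. Coordinates closer to the leading positions have smaller degree and agree
  by assumption.\<close>

lemma equation_diff:
  assumes v: "pivot v" and agree: "\<And>u. rank u < rank v \<Longrightarrow> x u = y u"
  shows "equation v x - equation v y = coefficient v * (x v - y v)"
proof -
  obtain q l j where vq: "v = (q, l, j)" by (cases v) auto
  show ?thesis
  proof (cases q)
    case True
    define k where "k = star l"
    have p: "j \<in> JR" "l \<in> w_vars j" "blk l = blk j" "k \<in> JP" "k \<in> reg"
      "j \<in> JQ \<Longrightarrow> k \<in> JQ \<Longrightarrow> precedes k j"
      using v True by (auto simp: vq k_def)
    have lT: "l \<in> T" using p(2) jumps_subset by (auto simp: w_vars_def)
    have T: "j \<in> T" "k \<in> T" "star j \<in> T" using p in_T star_T by blast+
    have sk: "star k = l" using lT by (simp add: k_def star_star)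
    have bk: "blk k = blk j" using lT p(3) by (simp add: k_def blk_star)
    have lj: "l < j" using p(2) by (auto simp: w_vars_def)
    \<comment> \<open>By \<open>star_sum\<close> both top coordinates have the same degree, so only
      the tie-breakers of \<open>rank\<close> decide.\<close>
    have deg: "k - star j = j - l" using star_sum[of j k] T bk sk lj by simp
    have jM: "j \<in> jumps M" using p(1) JR_subset by blast
    have a1: "x (True, t, j) = y (True, t, j)" if "l < t" "t \<in> w_vars j" for t
      using rank_less_if_closer[of l t j j l True q] that vq by (intro agree) (auto simp: w_vars_def)
    have a2: "x (k \<in> JQ, t, k) = y (k \<in> JQ, t, k)" if "star j < t" "t \<in> z_vars k" for t
      using rank_less_if_closer[of "star j" t k j l "k \<in> JQ" q] that vq deg
      by (intro agree) (auto simp: w_vars_def p_vars_def z_vars_def split: if_splits)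
    have "equation v x - equation v y = (co l (w x j) - co l (w y j)) * c l +
        (co (star j) (z x k) - co (star j) (z y k)) * c j"
      using form_diff[of j "w y j" k "z x k" "w x j" "z y k"] lead_w[OF jM] lead_z[OF p(4)] T bk sk
        w_agree(1)[OF jM, of l x y, OF a1] z_agree(1)[OF p(4) T(3), of x y, OF _ a2] z_block[OF p(4)]
      by (simp add: vq True k_def[symmetric] blk_star)
    also have "co l (w x j) - co l (w y j) = x v - y v"
      using w_agree(2)[OF jM, of l x y, OF a1] p(2) by (simp add: vq True)
    also have "co (star j) (z x k) - co (star j) (z y k) =
      (if star j \<in> z_vars k then x (k \<in> JQ, star j, k) - y (k \<in> JQ, star j, k) else 0)"
      by (rule z_agree(2)[OF p(4) T(3)]) (use T bk blk_star a2 in auto)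
    finally have eq: "equation v x - equation v y = (x v - y v) * c l +
      (if star j \<in> z_vars k then x (k \<in> JQ, star j, k) - y (k \<in> JQ, star j, k) else 0) * c j" .
    show ?thesis
    proof (cases "k = j \<and> j \<in> JQ")
      case same: True
      then have "\<epsilon> (blk j) = 1" using p(6) by (auto simp: precedes_def)
      then have h1: "c l = c j" using c_star[OF T(1)] sk same by simp
      have h2: "star j \<in> z_vars k" using same p(2) sk by (simp add: z_vars_def)
      have h3: "x (k \<in> JQ, star j, k) - y (k \<in> JQ, star j, k) = x v - y v"
        using same sk by (simp add: vq True)
      have "equation v x - equation v y = (x v - y v) * c j + (x v - y v) * c j"
        using eq h2 unfolding h1 h3 by simp
      moreover have "coefficient v = 2 * c j" using same by (simp add: vq True k_def[symmetric])
      ultimately show ?thesis by (simp add: algebra_simps)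
    next
      case diff: False
      have "x (k \<in> JQ, star j, k) = y (k \<in> JQ, star j, k)"
      proof (rule agree)
        have 1: "rank v = 4 * (j - l) + (if k \<in> JQ then 3 else 2)"
          using v by (simp add: vq True k_def)
        show "rank (k \<in> JQ, star j, k) < rank v"
        proof (cases "k \<in> JQ")
          case kQ: True
          \<comment> \<open>If \<open>j\<close> lies in \<open>JQ\<close>, the partner belongs to
            the mirror equation, which \<open>precedes\<close> discards; otherwise its tie-breaker
            is at most 2.\<close>
          have "\<not> (pivot (True, star j, k) \<and> j \<in> JQ)"
            using diff kQ p(6) T by (auto simp: star_star precedes_def)
          then show ?thesis unfolding 1 using kQ deg T by (auto simp: star_star)
        next
          case False
          \<comment> \<open>Since \<open>k\<close> is regular, such a pivot requires
            \<open>j\<close> in \<open>JP\<close>; but \<open>j\<close> lies in \<open>JR\<close>,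
            and \<open>JR \<inter> JP\<close> is regular. So the tie-breaker of the partner is at
            most 1.\<close>
          have "\<not> (pivot (False, star j, k) \<and> j \<notin> reg)"
            using p(1,5) T reg by (auto simp: star_star)
          then show ?thesis unfolding 1 using False deg T by (auto simp: star_star)
        qed
      qed
      then show ?thesis using eq diff by (auto simp: vq True k_def[symmetric])
    qed
  next
    case False
    define i where "i = star l"
    have p: "j \<in> JP" "j \<notin> JQ" "l \<in> p_vars j"
      and p': "j \<notin> reg \<and> i \<in> JR \<or> i \<in> JP - JQ \<and> precedes_reg i j"
      using v False by (auto simp: vq i_def)
    have lT: "l \<in> T" "blk l = blk j" "l < j" using p(3) by (auto simp: p_vars_def)
    have T: "j \<in> T" "i \<in> T" "star j \<in> T" using p in_T star_T lT by (auto simp: i_def)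
    have si: "star i = l" using lT by (simp add: i_def star_star)
    have bi: "blk i = blk j" using lT by (simp add: i_def blk_star)
    have deg: "i - star j = j - l" using star_sum[of i j] T bi si lT by simp
    have zv: "z_vars j = p_vars j" using p by (simp add: z_vars_def)
    have a2: "x (j \<in> JQ, t, j) = y (j \<in> JQ, t, j)" if "l < t" "t \<in> z_vars j" for t
      using rank_less_if_closer[of l t j j l False q] that vq p(2) zv by (intro agree) (auto simp: p_vars_def)
    have z2: "co l (z x j) - co l (z y j) = x v - y v"
      using z_agree(2)[OF p(1) lT(1,2), of x y, OF a2] p zv by (simp add: vq False)
    show ?thesis
    proof (cases "j \<notin> reg \<and> i \<in> JR")
      case B: True
      have iM: "i \<in> jumps M" using B JR_subset by blast
      have a1: "x (True, t, i) = y (True, t, i)" if "star j < t" "t \<in> w_vars i" for t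
        using rank_less_if_closer[of "star j" t i j l True q] that vq deg by (intro agree) (auto simp: w_vars_def)
      have "equation v x - equation v y = (co (star j) (w x i) - co (star j) (w y i)) * c (star j) +
          (co l (z x j) - co l (z y j)) * c i"
        using form_diff[of i "w y i" j "z x j" "w x i" "z y j"] lead_w[OF iM] lead_z[OF p(1)] T bi si
          w_agree(1)[OF iM, of "star j" x y, OF a1] z_agree(1)[OF p(1) lT(1,2), of x y, OF a2] z_block[OF p(1)] B
        by (simp add: vq False i_def[symmetric])
      moreover have "co (star j) (w x i) = co (star j) (w y i)"
      proof -
        have "x (True, star j, i) = y (True, star j, i)"
        proof (rule agree)
          \<comment> \<open>A pivot of \<open>w\<close> at \<open>star j\<close> would require its
            dual index \<open>j\<close> to be regular.\<close>
          have "\<not> pivot (True, star j, i)" using B T by (simp add: star_star)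
          then have "rank (True, star j, i) = 4 * (j - l)" using deg by (simp del: pivot.simps)
          moreover have "4 * (j - l) < rank v" using v by (simp add: vq False del: pivot.simps)
          ultimately show "rank (True, star j, i) < rank v" by simp
        qed
        then show ?thesis using w_agree(2)[OF iM, of "star j" x y, OF a1] by (simp split: if_splits)
      qed
      moreover have "i \<noteq> j" using B p(1) reg by auto
      ultimately show ?thesis using z2 by (simp add: vq False i_def[symmetric])
    next
      case C: False
      then have i: "i \<in> JP" "i \<notin> JQ" "precedes_reg i j" using p' by auto
      have zi: "z_vars i = p_vars i" using i by (simp add: z_vars_def)
      have a1: "x (i \<in> JQ, t, i) = y (i \<in> JQ, t, i)" if "star j < t" "t \<in> z_vars i" for t
        using rank_less_if_closer[of "star j" t i j l False q] that vq deg i zi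
        by (intro agree) (auto simp: p_vars_def)
      have bsj: "blk (star j) = blk i" using T bi by (simp add: blk_star)
      have "equation v u = form (z u i) (z u j)" for u using C by (auto simp: vq False i_def[symmetric])
      then have "equation v x - equation v y = (co (star j) (z x i) - co (star j) (z y i)) * c (star j) +
          (co l (z x j) - co l (z y j)) * c i"
        using form_diff[of i "z y i" j "z x j" "z x i" "z y j"] lead_z[OF i(1)] lead_z[OF p(1)] T bi si
          z_agree(1)[OF i(1) T(3) bsj, of x y, OF a1] z_agree(1)[OF p(1) lT(1,2), of x y, OF a2] z_block[OF p(1)]
        by simp
      moreover have zi2: "co (star j) (z x i) - co (star j) (z y i) =
          (if star j \<in> p_vars i then x (False, star j, i) - y (False, star j, i) else 0)"
        using z_agree(2)[OF i(1) T(3) bsj, of x y, OF a1] i zi by simp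
      ultimately have eq: "equation v x - equation v y = (x v - y v) * c i +
          (if star j \<in> p_vars i then x (False, star j, i) - y (False, star j, i) else 0) * c (star j)"
        using z2 by simp
      show ?thesis
      proof (cases "i = j")
        case same: True
        then have "\<epsilon> (blk j) = 1" using i by (auto simp: precedes_reg_def precedes_def)
        then have h1: "c (star j) = c j" using c_star[OF T(1)] by simp
        have h3: "x (False, star j, i) - y (False, star j, i) = x v - y v"
          using same si by (simp add: vq False)
        have "equation v x - equation v y = (x v - y v) * c j + (x v - y v) * c j"
          using eq same si p(3) unfolding h1 h3 by simp
        moreover have "coefficient v = 2 * c j" using same by (simp add: vq False i_def[symmetric])
        ultimately show ?thesis by (simp add: algebra_simps)
      next
        case diff: False
        have "x (False, star j, i) = y (False, star j, i)"
        proof (rule agree)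
          have 1: "rank v = 4 * (j - l) + (if i \<notin> reg \<and> j \<in> reg then 2 else 1)"
            using v by (simp add: vq False i_def)
          have 2: "rank (False, star j, i) =
              4 * (i - star j) + (if pivot (False, star j, i) then if j \<notin> reg \<and> i \<in> reg then 2 else 1 else 0)"
            using T by (simp add: star_star del: pivot.simps)
          show "rank (False, star j, i) < rank v"
          proof (cases "pivot (False, star j, i)")
            case True
            have "\<not> precedes_reg j i" using i(3) diff by (auto simp: precedes_reg_def precedes_def)
            \<comment> \<open>The mirror equation is ruled out, so the partner is the pivot of an
              equation with \<open>w\<close>. This is the case for which \<open>rank\<close> gives
              \<open>v\<close> the tie-breaker 2.\<close>
            then have "i \<notin> reg" "j \<in> JR" using True T by (auto simp: star_star)
            moreover then have "j \<in> reg" using reg p(1) by auto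
            ultimately show ?thesis unfolding 1 2 deg using True by (simp del: pivot.simps)
          qed (unfold 1 2 deg, simp del: pivot.simps)
        qed
        then show ?thesis using eq diff by (simp add: vq False i_def[symmetric])
      qed
    qed
  qed
qed

text \<open>An equation with leading positions \<open>j\<close> and \<open>k\<close> is void for
  \<open>k < star j\<close>, and \<open>k = star j\<close> is excluded by \<open>star_JP\<close> and
  \<open>star_JR\<close>. Otherwise it or its mirror image belongs to a pivot, except for the
  diagonal of a skew form, where it holds automatically.\<close>

lemma pivot_solution:
  assumes eqs: "\<And>v. pivot v \<Longrightarrow> equation v x = 0"
  shows "solution x"
proof -
  have W: "form (w x j) (z x k) = 0" if k: "k \<in> JP" and j: "j \<in> JR" and b: "blk j = blk k" for j k
  proof -
    have T: "j \<in> T" "k \<in> T" "star j \<in> T" "star k \<in> T" using k j in_T star_T by blast+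
    have jM: "j \<in> jumps M" using j JR_subset by blast
    have "k \<noteq> star j" using k star_JR[OF j] by blast
    then consider "k < star j" | "star j < k" by linarith
    then show ?thesis
    proof cases
      case 1
      then show ?thesis by (intro form_lead(1)[OF lead_w[OF jM] lead_z[OF k] b z_block[OF k]])
    next
      case 2
      then have lt: "star k < j" using star_less[of "star j" k] T b by (simp add: star_star blk_star)
      show ?thesis
      proof (cases "k \<in> reg")
        case True
        have sM: "star k \<in> jumps M" by (rule star_reg[OF k True j b lt])
        \<comment> \<open>Hence \<open>star k\<close> enters the chain after \<open>j\<close>, and
          \<open>w j\<close> has a variable there.\<close>
        have "star k \<notin> JR" using star_JR[of "star k"] k T by (auto simp: star_star)
        then have "star k \<in> w_vars j"
          using lev_less[OF j sM] sM lt b T by (simp add: w_vars_def blk_star)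
        then have *: "form (w x j) (z x k) = 0" if "j \<in> JQ \<and> k \<in> JQ \<longrightarrow> precedes k j"
          using eqs[of "(True, star k, j)"] j k True b T that by (simp add: star_star blk_star)
        show ?thesis
        proof (cases "j \<in> JQ \<and> k \<in> JQ \<longrightarrow> precedes k j")
          case False
          then have Q: "j \<in> JQ" "k \<in> JQ" "\<not> precedes k j" by auto
          then have M: "k \<in> jumps M" "k \<in> JR" "j \<in> JP" "j \<in> reg" using JQ_subset JR_subset reg by blast+
          have refl': "form (w x j) (z x k) = \<epsilon> (blk k) * form (w x k) (z x j)"
          proof -
            have "form (w x j) (z x k) = form (z x j) (z x k)"
              using form_block_proj[of "blk j" "z x k" "w x j"] z_block[OF k] b Q by (simp add: z_def)
            also have "\<dots> = \<epsilon> (blk k) * form (z x k) (z x j)"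
              by (rule form_reflexive) (use z_block[OF k] in auto)
            also have "form (z x k) (z x j) = form (w x k) (z x j)"
              using form_block_proj[of "blk k" "z x j" "w x k"] z_block[OF M(3)] b Q by (simp add: z_def)
            finally show ?thesis .
          qed
          show ?thesis
          proof (cases "j = k")
            case True
            then have "\<epsilon> (blk k) = -1" using Q sign[OF T(2)] by (auto simp: precedes_def)
            then show ?thesis using refl' True by simp
          next
            case jk: False
            then have "precedes j k" using Q by (auto simp: precedes_def)
            moreover have sjM: "star j \<in> jumps M" using star_reg[OF M(3,4,2)] b 2 by simp
            moreover have "star j \<notin> JR" using star_JR[of "star j"] M T by (auto simp: star_star)
            ultimately have "form (w x k) (z x j) = 0"
              using eqs[of "(True, star j, k)"] lev_less[OF M(2) sjM] M b T 2
              by (simp add: star_star blk_star w_vars_def)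
            then show ?thesis using refl' by simp
          qed
        qed (rule *)
      next
        case False
        then have "k \<notin> JQ" using reg JQ_subset by blast
        then show ?thesis
          using eqs[of "(False, star j, k)"] False k j b T 2 star_JR[OF j]
          by (simp add: star_star blk_star p_vars_def)
      qed
    qed
  qed
  have Z: "form (z x j) (z x k) = 0" if k: "k \<in> JP" "k \<notin> JQ" and j: "j \<in> JP" "j \<notin> JQ" and b: "blk j = blk k" for j k
  proof -
    have T: "j \<in> T" "k \<in> T" "star j \<in> T" "star k \<in> T" using k j in_T star_T by blast+
    have "k \<noteq> star j" using k star_JP[OF j(1)] by blast
    then consider "k < star j" | "star j < k" by linarith
    then show ?thesis
    proof cases
      case 1
      then show ?thesis by (intro form_lead(1)[OF lead_z[OF j(1)] lead_z[OF k(1)] b z_block[OF k(1)]])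
    next
      case 2
      then have lt: "star k < j" using star_less[of "star j" k] T b by (simp add: star_star blk_star)
      have *: "form (z x j) (z x k) = 0" if "precedes_reg j k" "j \<in> JP" "j \<notin> JQ" "k \<in> JP" "k \<notin> JQ" "blk j = blk k" "star j < k" for j k
      proof -
        have jT: "j \<in> T" using that in_T by blast
        have "\<not> (k \<notin> reg \<and> j \<in> JR)" using that reg by (auto simp: precedes_reg_def)
        then show ?thesis
          using eqs[of "(False, star j, k)"] that jT star_JP[of j] by (auto simp: star_star star_T blk_star p_vars_def)
      qed
      have refl': "form (z x j) (z x k) = \<epsilon> (blk k) * form (z x k) (z x j)"
        by (rule form_reflexive) (use z_block[OF k(1)] in auto)
      consider "precedes_reg j k" | "precedes_reg k j" | "j = k" "\<epsilon> (blk k) = -1"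
        using sign[OF T(2)] b unfolding precedes_reg_def precedes_def
        by (cases j k rule: linorder_cases; cases "j \<in> reg"; cases "k \<in> reg") auto
      then show ?thesis
      proof cases
        case 1
        then show ?thesis using *[of j k] k j b 2 by simp
      next
        case 2
        then show ?thesis using *[of k j] k j b lt refl' by simp
      next
        case 3
        then show ?thesis using refl' by simp
      qed
    qed
  qed
  show ?thesis unfolding solution_def using W Z by blast
qed

lemma solution_pivot:
  assumes x: "solution x" and v: "pivot v"
  shows "equation v x = 0"
proof -
  obtain q l j where vq: "v = (q, l, j)" by (cases v) auto
  show ?thesis
  proof (cases q)
    case True
    then have "j \<in> JR" "star l \<in> JP" "blk l = blk j" "l \<in> T"
      using v jumps_subset by (auto simp: vq w_vars_def)
    then show ?thesis using x by (simp add: solution_def vq True blk_star)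
  next
    case False
    then have "j \<in> JP" "j \<notin> JQ" "l \<in> T" "blk l = blk j" "star l \<in> JR \<and> j \<notin> reg \<or> star l \<in> JP - JQ"
      using v by (auto simp: vq p_vars_def)
    then show ?thesis using x by (auto simp: solution_def vq False blk_star)
  qed
qed

section \<open>Polynomial parametrization of the solutions\<close>

lemma polynomial_w: "(\<lambda>x. w x j $ a) \<in> polynomial_functions"
  unfolding w_def vector_add_component sum_component vector_smult_component
  by (intro polynomial_functions.add polynomial_sum polynomial_functions.mult polynomial_functions.const
      polynomial_functions.var)

lemma polynomial_z: "(\<lambda>x. z x k $ a) \<in> polynomial_functions"
proof (cases "k \<in> JQ")
  case True
  then show ?thesis
    unfolding z_def block_proj_def sum_component vector_smult_component if_P[OF True]
    by (intro polynomial_sum polynomial_functions.mult polynomial_functions.const polynomial_co polynomial_w)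
next
  case False
  then show ?thesis
    unfolding z_def vector_add_component sum_component vector_smult_component if_not_P[OF False]
    by (intro polynomial_functions.add polynomial_sum polynomial_functions.mult polynomial_functions.const
        polynomial_functions.var)
qed

lemma polynomial_equation: "equation v \<in> polynomial_functions"
proof -
  have form: "(\<lambda>x. form (f x) (g x)) \<in> polynomial_functions"
    if "\<And>a. (\<lambda>x. f x $ a) \<in> polynomial_functions" "\<And>a. (\<lambda>x. g x $ a) \<in> polynomial_functions"
    for f g :: "(bool \<times> nat \<times> nat \<Rightarrow> complex) \<Rightarrow> complex ^ 'n"
    unfolding form_def
    by (intro polynomial_sum polynomial_functions.mult polynomial_co polynomial_functions.const that)
  obtain q l j where vq: "v = (q, l, j)" by (cases v) auto
  have "equation v = (\<lambda>x. form (w x j) (z x (star l))) \<or> equation v = (\<lambda>x. form (w x (star l)) (z x j)) \<or>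
    equation v = (\<lambda>x. form (z x (star l)) (z x j))"
    unfolding vq by (cases q) (auto simp: fun_eq_iff)
  then show ?thesis by (elim disjE) (simp_all only: form polynomial_w polynomial_z)
qed

definition variables :: "(bool \<times> nat \<times> nat) set" where
  "variables = {(True, l, j) | l j. j \<in> jumps M \<and> l \<in> w_vars j} \<union>
     {(False, l, k) | l k. k \<in> JP - JQ \<and> l \<in> p_vars k}"

lemma finite_variables: "finite variables"
proof (rule finite_subset)
  show "variables \<subseteq> UNIV \<times> T \<times> T"
    using jumps_subset JP_subset by (auto simp: variables_def w_vars_def p_vars_def)
qed (use finite_T in auto)

lemma pivot_in_variables: "pivot v \<Longrightarrow> v \<in> variables"
  by (induction v rule: pivot.induct) (use JR_subset in \<open>auto simp: variables_def\<close>)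

lemma coefficient_nonzero: "pivot v \<Longrightarrow> coefficient v \<noteq> 0"
  by (induction v rule: pivot.induct)
     (use c_nonzero in_T in \<open>auto simp: w_vars_def p_vars_def star_T dest: subsetD[OF jumps_subset]\<close>)

lemma solutions_parametrized:
  obtains G where "\<And>v. (\<lambda>x. G x v) \<in> polynomial_functions" "\<And>x. solution (G x)"
    "\<And>x v. \<not> pivot v \<Longrightarrow> G x v = x v"
    "\<And>x y. solution x \<Longrightarrow> (\<And>v. \<not> pivot v \<Longrightarrow> x v = y v) \<Longrightarrow> G y = x"
proof -
  have "finite {v. pivot v}"
    by (rule finite_subset[OF _ finite_variables]) (use pivot_in_variables in blast)
  then show thesis
  proof (rule triangular_elimination[where P = "{v. pivot v}" and E = equation and \<gamma> = coefficient and \<rho> = rank])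
    fix G :: "(bool \<times> nat \<times> nat \<Rightarrow> complex) \<Rightarrow> bool \<times> nat \<times> nat \<Rightarrow> complex"
    assume G: "\<And>v. (\<lambda>x. G x v) \<in> polynomial_functions" "\<And>x v. v \<in> {v. pivot v} \<Longrightarrow> equation v (G x) = 0"
      "\<And>x v. v \<notin> {v. pivot v} \<Longrightarrow> G x v = x v"
      "\<And>x y. (\<And>v. v \<in> {v. pivot v} \<Longrightarrow> equation v x = 0) \<Longrightarrow>
        (\<And>v. v \<notin> {v. pivot v} \<Longrightarrow> x v = y v) \<Longrightarrow> G y = x"
    show thesis
    proof (rule that[OF G(1)])
      show "solution (G x)" for x by (rule pivot_solution) (use G(2) in simp)
      show "G x v = x v" if "\<not> pivot v" for x v using G(3) that by simp
      show "G y = x" if "solution x" "\<And>v. \<not> pivot v \<Longrightarrow> x v = y v" for x y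
        by (rule G(4)) (use solution_pivot[OF that(1)] that(2) in auto)
    qed
  next
    show "equation v x - equation v y = coefficient v * (x v - y v)"
      if "v \<in> {v. pivot v}" "\<And>u. rank u < rank v \<Longrightarrow> x u = y u" for v x y
      by (rule equation_diff) (use that in auto)
  qed (use polynomial_equation coefficient_nonzero in auto)
qed

end

section \<open>The cells of the fibre\<close>

context graded_form
begin

lemma form_span_zero:
  assumes "\<And>u v. u \<in> A \<Longrightarrow> v \<in> A' \<Longrightarrow> form u v = 0" "u \<in> vec.span A" "v \<in> vec.span A'"
  shows "form u v = 0"
proof -
  have left: "vec.subspace {u. form u v = 0}" for v
    by (rule vec.subspaceI)
       (auto simp: form_def co_simps distrib_right sum.distrib mult.assoc simp flip: sum_distrib_left)
  have right: "vec.subspace {v. form u v = 0}" for u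
    by (rule vec.subspaceI)
       (auto simp: form_def co_simps distrib_left distrib_right sum.distrib mult.assoc mult.left_commute
         simp flip: sum_distrib_left)
  have "form u v = 0" if "u \<in> A" "v \<in> vec.span A'" for u v
    using vec.span_minimal[OF _ right[of u], of A'] assms(1)[OF that(1)] that(2) by blast
  then show ?thesis
    using vec.span_minimal[OF _ left[of v], of A] assms(2,3) by blast
qed

text \<open>If \<open>star k\<close> is the position just below \<open>k\<close>, no terms but those
  of this dual pair survive, for lack of room in between. Used to rule out exceptional
  jumps.\<close>

lemma form_middle:
  assumes "lead k u" "lead k v" "Suc (star k) = k" "\<And>s. s \<in> T \<Longrightarrow> blk s \<noteq> blk k \<Longrightarrow> co s v = 0"
  shows "form u v = co (star k) v * c k + co (star k) u * c (star k)"
proof -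
  have T: "k \<in> T" "star k \<in> T" using lead_in_T[OF assms(1)] star_T by auto
  have ne: "star k \<noteq> k" using assms(3) by linarith
  have "co s u * co (star s) v * c s = 0" if s: "s \<in> T - {k, star k}" for s
  proof -
    consider "blk s \<noteq> blk k" | "s > k" | "blk s = blk k" "s < star k"
      using s assms(3) by fastforce
    then show ?thesis
    proof cases
      case 1
      then show ?thesis using assms(4)[of "star s"] s by (simp add: star_T blk_star)
    next
      case 3
      then have "star s > k" using star_less[of s "star k"] s T by (simp add: blk_star star_star)
      then show ?thesis using assms(2) by (simp add: lead_def)
    qed (use assms(1) in \<open>simp add: lead_def\<close>)
  qed
  then have "form u v = (\<Sum>s\<in>{k, star k}. co s u * co (star s) v * c s)"
    unfolding form_def by (intro sum.mono_neutral_right finite_T) (use T in auto)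
  then show ?thesis using ne T assms(1,2) by (simp add: star_star lead_def)
qed

end

section \<open>The blocks of the graded space\<close>

locale graded_space = graded_form T E blk star c \<epsilon>
  for T :: "nat set" and E :: "nat \<Rightarrow> complex ^ 'n" and blk star :: "nat \<Rightarrow> nat" and c \<epsilon> :: "nat \<Rightarrow> complex" +
  fixes m :: nat and V :: "nat \<Rightarrow> (complex ^ 'n) set"
  assumes blk_mono: "s \<in> T \<Longrightarrow> t \<in> T \<Longrightarrow> s \<le> t \<Longrightarrow> blk s \<le> blk t"
    and blk_range: "t \<in> T \<Longrightarrow> blk t \<in> {1..m}"
    and V_eq: "i \<in> {1..m} \<Longrightarrow> V i = coord_subspace {t \<in> T. blk t \<noteq> i}"
begin

lemma m_pos: "1 \<le> m"
proof -
  have "T \<noteq> {}" using card_T by (metis card.empty zero_less_card_finite less_irrefl)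
  then show ?thesis using blk_range by fastforce
qed

lemma E_in_V: "t \<in> T \<Longrightarrow> E t \<in> V (blk t)"
  using V_eq[OF blk_range] by (auto simp: coord_subspace_def co_E)

lemma span_blocks:
  assumes "I \<subseteq> {1..m}"
  shows "vec.span (\<Union>i\<in>I. V i) = coord_subspace {t \<in> T. blk t \<notin> I}"
proof
  show "vec.span (\<Union>i\<in>I. V i) \<subseteq> coord_subspace {t \<in> T. blk t \<notin> I}"
    by (rule vec.span_minimal[OF _ subspace_coord]) (use assms V_eq in \<open>force simp: coord_subspace_def\<close>)
  have "E ` (T - {t \<in> T. blk t \<notin> I}) \<subseteq> (\<Union>i\<in>I. V i)" using E_in_V by auto
  then show "coord_subspace {t \<in> T. blk t \<notin> I} \<subseteq> vec.span (\<Union>i\<in>I. V i)"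
    using coord_subspace_eq_span[of "{t \<in> T. blk t \<notin> I}"] by (simp add: vec.span_mono)
qed

lemma B_le_eq: "i \<in> {1..m} \<Longrightarrow> B_le V i = coord_subspace {t \<in> T. i < blk t}"
proof -
  assume "i \<in> {1..m}"
  then have "B_le V i = coord_subspace {t \<in> T. blk t \<notin> {1..i}}"
    unfolding B_le_def by (intro span_blocks) auto
  also have "{t \<in> T. blk t \<notin> {1..i}} = {t \<in> T. i < blk t}" using blk_range by fastforce
  finally show ?thesis .
qed

lemma B_lt_eq: "i \<in> {1..m} \<Longrightarrow> B_lt V i = coord_subspace {t \<in> T. i \<le> blk t}"
proof -
  assume "i \<in> {1..m}"
  then have "B_lt V i = coord_subspace {t \<in> T. blk t \<notin> {1..<i}}"
    unfolding B_lt_def by (intro span_blocks) auto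
  also have "{t \<in> T. blk t \<notin> {1..<i}} = {t \<in> T. i \<le> blk t}" using blk_range by fastforce
  finally show ?thesis .
qed

lemma block_proj_in_V: "i \<in> {1..m} \<Longrightarrow> block_proj i u \<in> V i"
  by (auto simp: V_eq coord_subspace_def co_block_proj)

lemma block_proj_V: "i \<in> {1..m} \<Longrightarrow> v \<in> V i \<Longrightarrow> block_proj i v = v"
  by (rule co_ext) (auto simp: V_eq coord_subspace_def co_block_proj)

lemma pr_eq: "i \<in> {1..m} \<Longrightarrow> pr V i L = block_proj i ` (L \<inter> B_le V i)"
proof (intro equalityI subsetI)
  fix v assume i: "i \<in> {1..m}" and "v \<in> pr V i L"
  then obtain h where h: "v \<in> V i" "h \<in> L \<inter> B_le V i" "h - v \<in> B_lt V i" unfolding pr_def by auto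
  have "v = block_proj i h"
    by (rule co_ext) (use h i V_eq B_lt_eq in \<open>auto simp: coord_subspace_def co_block_proj co_diff\<close>)
  then show "v \<in> block_proj i ` (L \<inter> B_le V i)" using h by auto
next
  fix v assume i: "i \<in> {1..m}" and "v \<in> block_proj i ` (L \<inter> B_le V i)"
  then obtain h where h: "h \<in> L \<inter> B_le V i" "v = block_proj i h" by auto
  have "h - v \<in> B_lt V i"
    using h i by (auto simp: B_le_eq B_lt_eq coord_subspace_def co_diff co_block_proj)
  then show "v \<in> pr V i L" unfolding pr_def using h block_proj_in_V[OF i] by auto
qed

end

text \<open>\<open>reg\<close> stands for the positions at which a Witt basis vector itself lies in
  \<open>pr_i M\<close>. Every other jump of \<open>M\<close> falls under \<open>special\<close>: it
  comes from the exceptional vector, whose coordinate -1 is visible in all vectors of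
  \<open>M\<close> with this leading position. The stability assumptions reduce the choice of a
  Lagrangian orbit to the jumps.\<close>

locale fibre = graded_space T E blk star c \<epsilon> m V
  for T :: "nat set" and E :: "nat \<Rightarrow> complex ^ 'n" and blk star :: "nat \<Rightarrow> nat" and c \<epsilon> :: "nat \<Rightarrow> complex"
    and m :: nat and V :: "nat \<Rightarrow> (complex ^ 'n) set" +
  fixes b :: "nat \<Rightarrow> complex ^ 'n \<Rightarrow> complex ^ 'n \<Rightarrow> complex"
    and C1 C2 :: "nat \<Rightarrow> (complex ^ 'n) set set" and ks :: "nat \<Rightarrow> nat" and rs :: "nat \<Rightarrow> rank_symbol"
    and M :: "(complex ^ 'n) set" and reg :: "nat set"
  assumes form_eq: "i \<in> {1..m} \<Longrightarrow> u \<in> V i \<Longrightarrow> v \<in> V i \<Longrightarrow> b i u v = form u v"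
    and M_subspace: "vec.subspace M"
    and regular_star: "k \<in> reg \<Longrightarrow> j \<in> jumps M \<Longrightarrow> blk j = blk k \<Longrightarrow> star k < j \<Longrightarrow> star k \<in> jumps M"
    and special: "k \<in> jumps M \<Longrightarrow> k \<notin> reg \<Longrightarrow>
      \<epsilon> (blk k) = 1 \<and> Suc (star k) = k \<and> (\<forall>h\<in>M. lead k h \<longrightarrow> co (star k) h = -1)"
    and C1_stable: "i \<in> {1..m} \<Longrightarrow> rs i = Zero1 \<Longrightarrow> P \<in> C1 i \<Longrightarrow>
      P \<in> Gr (ks i - rank_val (rs i)) (V i) \<Longrightarrow> P' \<in> Gr (ks i - rank_val (rs i)) (V i) \<Longrightarrow>
      \<forall>p\<in>P. \<forall>p'\<in>P. form p p' = 0 \<Longrightarrow> \<forall>p\<in>P'. \<forall>p'\<in>P'. form p p' = 0 \<Longrightarrow> jumps P' = jumps P \<Longrightarrow> P' \<in> C1 i"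
    and C2_stable: "i \<in> {1..m} \<Longrightarrow> rs i = Zero2 \<Longrightarrow> P \<in> C2 i \<Longrightarrow>
      P \<in> Gr (ks i - rank_val (rs i)) (V i) \<Longrightarrow> P' \<in> Gr (ks i - rank_val (rs i)) (V i) \<Longrightarrow>
      \<forall>p\<in>P. \<forall>p'\<in>P. form p p' = 0 \<Longrightarrow> \<forall>p\<in>P'. \<forall>p'\<in>P'. form p p' = 0 \<Longrightarrow> jumps P' = jumps P \<Longrightarrow> P' \<in> C2 i"
begin

definition X :: "'n point set" where
  "X = {x \<in> X_var m V b C1 C2 ks rs. mu m x = M}"

lemma X_iff: "x \<in> X \<longleftrightarrow> x \<in> extensional (components m) \<and> x (Hsub m) = M \<and> (\<forall>i\<in>{1..m}.
     x (Ptil i) \<in> Gr (ks i - rank_val (rs i)) (V i) \<and>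
     x (Psub i) \<in> Gr ((\<Sum>j\<in>{1..<i}. ks j) + (ks i - rank_val (rs i))) (B_le V i) \<and>
     x (Hsub i) \<in> Gr (\<Sum>j\<in>{1..i}. ks j) (B_le V i) \<and>
     (\<forall>p\<in>x (Ptil i). \<forall>p'\<in>x (Ptil i). form p p' = 0) \<and>
     (\<forall>h\<in>x (Psub i). block_proj i h \<in> x (Ptil i)) \<and>
     (\<forall>h\<in>x (Hsub i). \<forall>p\<in>x (Ptil i). form h p = 0) \<and>
     H_at x (i - 1) \<subseteq> x (Psub i) \<and> x (Psub i) \<subseteq> x (Hsub i) \<and>
     (rs i = Zero1 \<longrightarrow> x (Ptil i) \<in> C1 i) \<and> (rs i = Zero2 \<longrightarrow> x (Ptil i) \<in> C2 i))"
proof -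
  have 1: "x (Ptil i) \<subseteq> perp (V i) (b i) (x (Ptil i)) \<longleftrightarrow>
      (\<forall>p\<in>x (Ptil i). \<forall>p'\<in>x (Ptil i). form p p' = 0)" if "i \<in> {1..m}" "x (Ptil i) \<subseteq> V i" for i
    using that form_eq[OF that(1)] by (auto simp: perp_def subset_iff)
  have 2: "pr V i (x (Psub i)) \<subseteq> x (Ptil i) \<longleftrightarrow> (\<forall>h\<in>x (Psub i). block_proj i h \<in> x (Ptil i))"
    if "i \<in> {1..m}" "x (Psub i) \<subseteq> B_le V i" for i
    unfolding pr_eq[OF that(1)] using that(2) by blast
  have 3: "pr V i (x (Hsub i)) \<subseteq> perp (V i) (b i) (x (Ptil i)) \<longleftrightarrow>
      (\<forall>h\<in>x (Hsub i). \<forall>p\<in>x (Ptil i). form h p = 0)"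
    if i: "i \<in> {1..m}" and "x (Hsub i) \<subseteq> B_le V i" "x (Ptil i) \<subseteq> V i" for i
  proof -
    have "b i (block_proj i h) p = form h p" if "p \<in> x (Ptil i)" for h p
      using form_eq[OF i block_proj_in_V[OF i, of h], of p] that \<open>x (Ptil i) \<subseteq> V i\<close> V_eq[OF i]
      by (subst form_block_proj[of i p h, symmetric]) (auto simp: coord_subspace_def)
    moreover have "x (Hsub i) \<inter> B_le V i = x (Hsub i)" using that(2) by blast
    ultimately show ?thesis
      unfolding pr_eq[OF i] perp_def using block_proj_in_V[OF i] by (simp add: image_subset_iff)
  qed
  have "(x (Ptil i) \<in> Gr (ks i - rank_val (rs i)) (V i) \<and>
     x (Psub i) \<in> Gr ((\<Sum>j\<in>{1..<i}. ks j) + (ks i - rank_val (rs i))) (B_le V i) \<and>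
     x (Hsub i) \<in> Gr (\<Sum>j\<in>{1..i}. ks j) (B_le V i) \<and>
     x (Ptil i) \<subseteq> perp (V i) (b i) (x (Ptil i)) \<and> pr V i (x (Psub i)) \<subseteq> x (Ptil i) \<and>
     pr V i (x (Hsub i)) \<subseteq> perp (V i) (b i) (x (Ptil i)) \<and> R) \<longleftrightarrow>
    (x (Ptil i) \<in> Gr (ks i - rank_val (rs i)) (V i) \<and>
     x (Psub i) \<in> Gr ((\<Sum>j\<in>{1..<i}. ks j) + (ks i - rank_val (rs i))) (B_le V i) \<and>
     x (Hsub i) \<in> Gr (\<Sum>j\<in>{1..i}. ks j) (B_le V i) \<and>
     (\<forall>p\<in>x (Ptil i). \<forall>p'\<in>x (Ptil i). form p p' = 0) \<and> (\<forall>h\<in>x (Psub i). block_proj i h \<in> x (Ptil i)) \<and>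
     (\<forall>h\<in>x (Hsub i). \<forall>p\<in>x (Ptil i). form h p = 0) \<and> R)" if i: "i \<in> {1..m}" for i R
  proof -
    have "x (Ptil i) \<in> Gr d (V i) \<Longrightarrow> x (Ptil i) \<subseteq> V i" "x (Psub i) \<in> Gr d (B_le V i) \<Longrightarrow> x (Psub i) \<subseteq> B_le V i"
      "x (Hsub i) \<in> Gr d (B_le V i) \<Longrightarrow> x (Hsub i) \<subseteq> B_le V i" for d
      unfolding Gr_def by blast+
    then show ?thesis using 1[OF i] 2[OF i] 3[OF i] by blast
  qed
  then show ?thesis
    unfolding X_def X_var_def mu_def mem_Collect_eq by (simp only: cong: ball_cong) blast
qed

lemma X_D:
  assumes x: "x \<in> X" and i: "i \<in> {1..m}"
  shows "vec.subspace (x (Ptil i))" "x (Ptil i) \<subseteq> V i" "vec.subspace (x (Psub i))" "vec.subspace (x (Hsub i))"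
    "x (Psub i) \<subseteq> B_le V i" "x (Hsub i) \<subseteq> B_le V i"
    "\<And>p p'. p \<in> x (Ptil i) \<Longrightarrow> p' \<in> x (Ptil i) \<Longrightarrow> form p p' = 0"
    "\<And>h. h \<in> x (Psub i) \<Longrightarrow> block_proj i h \<in> x (Ptil i)"
    "\<And>h p. h \<in> x (Hsub i) \<Longrightarrow> p \<in> x (Ptil i) \<Longrightarrow> form h p = 0"
    "H_at x (i - 1) \<subseteq> x (Psub i)" "x (Psub i) \<subseteq> x (Hsub i)"
  using X_iff[THEN iffD1, OF x] i unfolding Gr_def by blast+

text \<open>Numbers \<open>P_1, H_1, P_2, H_2, ..., H_m\<close> by 1 to \<open>2 * m\<close>, which
  merges the inclusions among them into one monotonicity statement.\<close>

definition chain :: "nat \<Rightarrow> component" where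
  "chain s = (if odd s then Psub (Suc s div 2) else Hsub (s div 2))"

lemma chain_simps: "1 \<le> i \<Longrightarrow> chain (2 * i - 1) = Psub i" "chain (2 * i) = Hsub i"
proof -
  assume "1 \<le> i"
  then obtain k where "i = Suc k" by (cases i) auto
  then show "chain (2 * i - 1) = Psub i" by (simp add: chain_def)
qed (simp add: chain_def)

lemma chain_cases:
  assumes "s \<in> {1..2 * m}"
  obtains i where "i \<in> {1..m}" "s = 2 * i - 1" "chain s = Psub i" | i where "i \<in> {1..m}" "s = 2 * i" "chain s = Hsub i"
proof (cases "odd s")
  case True
  then obtain k where k: "s = 2 * k + 1" by (auto elim: oddE)
  then have "s = 2 * Suc k - 1" "Suc k \<in> {1..m}" using assms by auto
  then show thesis using that(1)[of "Suc k"] chain_simps(1)[of "Suc k"] by auto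
next
  case False
  then obtain k where "s = 2 * k" by (auto elim: evenE)
  then show thesis using that(2)[of k] chain_simps(2)[of k] assms by auto
qed

lemma components_cases:
  assumes "\<kappa> \<in> components m"
  obtains s where "s \<in> {1..2 * m}" "\<kappa> = chain s" | i where "i \<in> {1..m}" "\<kappa> = Ptil i"
proof -
  consider i where "i \<in> {1..m}" "\<kappa> = Psub i" | i where "i \<in> {1..m}" "\<kappa> = Hsub i" | i where "i \<in> {1..m}" "\<kappa> = Ptil i"
    using assms unfolding components_def by blast
  then show thesis
  proof cases
    case (1 i)
    then have "2 * i - 1 \<in> {1..2 * m}" unfolding atLeastAtMost_iff by arith
    then show thesis using that(1)[of "2 * i - 1"] chain_simps(1)[of i] 1 by simp
  next
    case (2 i)
    then show thesis using that(1)[of "2 * i"] chain_simps(2)[of i] by auto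
  qed (use that(2) in blast)
qed

lemma chain_in_components: "s \<in> {1..2 * m} \<Longrightarrow> chain s \<in> components m"
  by (erule chain_cases) (auto simp: components_def)

lemma chain_subspace: "x \<in> X \<Longrightarrow> s \<in> {1..2 * m} \<Longrightarrow> vec.subspace (x (chain s))"
  by (erule chain_cases) (simp_all add: X_D)

lemma chain_mono:
  assumes x: "x \<in> X" and "s \<le> s'" "s \<in> {1..2 * m}" "s' \<in> {1..2 * m}"
  shows "x (chain s) \<subseteq> x (chain s')"
  using assms(2-)
proof (induction rule: dec_induct)
  case (step r)
  then have r: "r \<in> {1..2 * m}" and Sr: "Suc r \<in> {1..2 * m}" by auto
  have "x (chain r) \<subseteq> x (chain (Suc r))"
    using r
  proof (cases rule: chain_cases)
    case (1 i)
    then have "Suc r = 2 * i" by auto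
    then show ?thesis using X_D(11)[OF x 1(1)] 1 chain_simps(2)[of i] by simp
  next
    case (2 i)
    then have i: "Suc i \<in> {1..m}" "Suc r = 2 * Suc i - 1" using Sr by auto
    then show ?thesis
      using X_D(10)[OF x i(1)] 2 chain_simps(1)[of "Suc i"] by (simp add: H_at_def)
  qed
  then show ?case using step.IH r step.prems by auto
qed simp

lemma chain_top: "x \<in> X \<Longrightarrow> x (chain (2 * m)) = M"
  using X_iff by (simp add: chain_simps)

lemma chain_in_M: "x \<in> X \<Longrightarrow> s \<in> {1..2 * m} \<Longrightarrow> x (chain s) \<subseteq> M"
  using chain_mono[of x s "2 * m"] chain_top m_pos by auto

lemma jumps_Ptil_block: "x \<in> X \<Longrightarrow> i \<in> {1..m} \<Longrightarrow> k \<in> jumps (x (Ptil i)) \<Longrightarrow> k \<in> T \<and> blk k = i"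
proof -
  assume x: "x \<in> X" and i: "i \<in> {1..m}" and "k \<in> jumps (x (Ptil i))"
  then obtain v where v: "v \<in> V i" "lead k v" using X_D(2)[OF x i] by (auto simp: jumps_def)
  then show "k \<in> T \<and> blk k = i"
    using lead_in_T[of k v] V_eq[OF i] by (force simp: coord_subspace_def lead_def)
qed

lemma component_subspace:
  assumes "x \<in> X" "\<kappa> \<in> components m"
  shows "vec.subspace (x \<kappa>)"
  using assms(2) by (cases rule: components_cases) (auto simp: chain_subspace[OF assms(1)] X_D[OF assms(1)])

end

section \<open>The jumps of a fixed point of the fibre\<close>

locale fibre_point = fibre T E blk star c \<epsilon> m V b C1 C2 ks rs M reg
  for T :: "nat set" and E :: "nat \<Rightarrow> complex ^ 'n" and blk star c \<epsilon> m V b C1 C2 ks rs M reg +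
  fixes x0 :: "'n point"
  assumes x0: "x0 \<in> X"
begin

abbreviation J :: "component \<Rightarrow> nat set" where "J \<kappa> \<equiv> jumps (x0 \<kappa>)"

text \<open>The bound \<open>1 \<le> s\<close> excludes \<open>chain 0\<close>, which is
  \<open>Hsub 0\<close> and no component of a point.\<close>

definition lev :: "nat \<Rightarrow> nat" where "lev j = (LEAST s. 1 \<le> s \<and> j \<in> J (chain s))"

definition "JQ = {j \<in> T. j \<in> J (Psub (blk j))}"
definition "JR = {j \<in> T. j \<in> J (Hsub (blk j))}"
definition "JP = {j \<in> T. j \<in> J (Ptil (blk j))}"

lemma lev:
  assumes "j \<in> jumps M"
  shows "lev j \<in> {1..2 * m}" "j \<in> J (chain (lev j))" "s \<in> {1..2 * m} \<Longrightarrow> j \<in> J (chain s) \<longleftrightarrow> lev j \<le> s"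
proof -
  have "1 \<le> 2 * m \<and> j \<in> J (chain (2 * m))" using assms chain_top[OF x0] m_pos by simp
  from LeastI[of "\<lambda>s. 1 \<le> s \<and> j \<in> J (chain s)", OF this] Least_le[of "\<lambda>s. 1 \<le> s \<and> j \<in> J (chain s)", OF this]
  show *: "lev j \<in> {1..2 * m}" "j \<in> J (chain (lev j))" by (auto simp: lev_def)
  assume s: "s \<in> {1..2 * m}"
  show "j \<in> J (chain s) \<longleftrightarrow> lev j \<le> s"
  proof
    assume "j \<in> J (chain s)"
    then show "lev j \<le> s" using s by (auto simp: lev_def intro: Least_le)
  next
    assume "lev j \<le> s"
    then show "j \<in> J (chain s)" using jumps_mono[OF chain_mono[OF x0 _ *(1) s]] *(2) by blast
  qed
qed

lemma JQ_iff: "j \<in> JQ \<longleftrightarrow> j \<in> jumps M \<and> lev j \<le> 2 * blk j - 1"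
  and JR_iff: "j \<in> JR \<longleftrightarrow> j \<in> jumps M \<and> lev j \<le> 2 * blk j"
proof -
  have i: "2 * blk j - 1 \<in> {1..2 * m}" "2 * blk j \<in> {1..2 * m}" "1 \<le> blk j" if "j \<in> T" for j
    using blk_range[OF that] by auto
  have M: "j \<in> J (chain s) \<Longrightarrow> j \<in> jumps M" if "s \<in> {1..2 * m}" for s j
    using jumps_mono[OF chain_in_M[OF x0 that]] by auto
  show "j \<in> JQ \<longleftrightarrow> j \<in> jumps M \<and> lev j \<le> 2 * blk j - 1"
  proof (cases "j \<in> T")
    case True
    then show ?thesis
      using lev(3)[of j "2 * blk j - 1"] i[OF True] M[OF i(1)[OF True], of j] chain_simps(1)[of "blk j"]
      by (auto simp: JQ_def)
  qed (use jumps_subset[of M] in \<open>auto simp: JQ_def\<close>)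
  show "j \<in> JR \<longleftrightarrow> j \<in> jumps M \<and> lev j \<le> 2 * blk j"
  proof (cases "j \<in> T")
    case True
    then show ?thesis
      using lev(3)[of j "2 * blk j"] i[OF True] M[OF i(2)[OF True], of j] chain_simps(2)[of "blk j"]
      by (auto simp: JR_def)
  qed (use jumps_subset[of M] in \<open>auto simp: JR_def\<close>)
qed

lemma J_Ptil: "i \<in> {1..m} \<Longrightarrow> J (Ptil i) = {k \<in> JP. blk k = i}"
  using jumps_Ptil_block[OF x0] by (auto simp: JP_def)

text \<open>At an exceptional jump \<open>k\<close>, symmetry and isotropy force a vector of
  \<open>P~_i\<close> leading at \<open>k\<close> to vanish at \<open>star k\<close>. A vector of
  \<open>H_i\<close> leading at \<open>k\<close> has coordinate -1 there, so the two cannot be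
  orthogonal.\<close>

lemma JR_JP_regular: "JR \<inter> JP \<subseteq> reg"
proof
  fix k assume k: "k \<in> JR \<inter> JP"
  show "k \<in> reg"
  proof (rule ccontr)
    assume nreg: "k \<notin> reg"
    have kM: "k \<in> jumps M" using k JR_iff by auto
    note sp = special[OF kM nreg]
    have kT: "k \<in> T" and i: "blk k \<in> {1..m}" using k blk_range by (auto simp: JR_def)
    obtain h where h: "h \<in> x0 (Hsub (blk k))" "lead k h" using k by (auto simp: JR_def jumps_def)
    obtain p where p: "p \<in> x0 (Ptil (blk k))" "lead k p" using k by (auto simp: JP_def jumps_def)
    have pb: "co s p = 0" if "s \<in> T" "blk s \<noteq> blk k" for s
      using X_D(2)[OF x0 i] p(1) V_eq[OF i] that by (auto simp: coord_subspace_def)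
    have hM: "h \<in> M" using h(1) chain_in_M[OF x0, of "2 * blk k"] chain_simps(2)[of "blk k"] i by auto
    have cs: "c (star k) = c k" using c_star[OF kT] sp by simp
    have "co (star k) p * c k + co (star k) p * c (star k) = 0"
      using form_middle[OF p(2,2) _ pb] sp X_D(7)[OF x0 i p(1,1)] by simp
    then have "co (star k) p = 0" using c_nonzero[OF kT] cs by simp
    moreover have "co (star k) p * c k + co (star k) h * c (star k) = 0"
      using form_middle[OF h(2) p(2) _ pb] sp X_D(9)[OF x0 i h(1) p(1)] by simp
    moreover have "co (star k) h = -1" using sp hM h(2) by blast
    ultimately show False using c_nonzero[OF kT] cs by simp
  qed
qed

lemma JQ_JP: "JQ \<subseteq> JP"
proof
  fix j assume j: "j \<in> JQ"
  then have i: "j \<in> T" "blk j \<in> {1..m}" using blk_range by (auto simp: JQ_def)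
  obtain h where h: "h \<in> x0 (Psub (blk j))" "lead j h" using j by (auto simp: JQ_def jumps_def)
  have "lead j (block_proj (blk j) h)" using h(2) i by (auto simp: lead_def co_block_proj)
  then show "j \<in> JP" using X_D(8)[OF x0 i(2) h(1)] i by (auto simp: JP_def jumps_def)
qed

text \<open>Vectors with dual leading positions have the nonzero product \<open>c j\<close>, which
  contradicts the orthogonality of \<open>P~_i\<close> to itself or to \<open>H_i\<close>.\<close>

lemma star_not_JP:
  shows "k \<in> JP \<Longrightarrow> star k \<notin> JP" and "j \<in> JR \<Longrightarrow> star j \<notin> JP"
proof -
  have *: False if j: "j \<in> T" "h \<in> x0 \<kappa>" "lead j h" "star j \<in> JP" and z: "\<And>p. p \<in> x0 (Ptil (blk j)) \<Longrightarrow> form h p = 0" for j h \<kappa>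
  proof -
    have i: "blk j \<in> {1..m}" using blk_range[OF j(1)] .
    obtain p where p: "p \<in> x0 (Ptil (blk j))" "lead (star j) p"
      using j(4) blk_star[OF j(1)] by (auto simp: JP_def jumps_def)
    have pb: "co s p = 0" if "s \<in> T" "blk s \<noteq> blk (star j)" for s
      using X_D(2)[OF x0 i] p(1) V_eq[OF i] that blk_star[OF j(1)] by (auto simp: coord_subspace_def)
    have "form h p = c j" by (rule form_lead(2)[OF j(3) p(2) _ pb]) (use blk_star[OF j(1)] in auto)
    then show False using z[OF p(1)] c_nonzero[OF j(1)] by simp
  qed
  show "star k \<notin> JP" if kP: "k \<in> JP"
  proof
    assume s: "star k \<in> JP"
    have k: "k \<in> T" "blk k \<in> {1..m}" using kP blk_range by (auto simp: JP_def)
    obtain p where p: "p \<in> x0 (Ptil (blk k))" "lead k p" using kP by (auto simp: JP_def jumps_def)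
    show False by (rule *[OF k(1) p s]) (rule X_D(7)[OF x0 k(2) p(1)])
  qed
  show "star j \<notin> JP" if jR: "j \<in> JR"
  proof
    assume s: "star j \<in> JP"
    have j: "j \<in> T" "blk j \<in> {1..m}" using jR blk_range by (auto simp: JR_def)
    obtain h where h: "h \<in> x0 (Hsub (blk j))" "lead j h" using jR by (auto simp: JR_def jumps_def)
    show False by (rule *[OF j(1) h s]) (rule X_D(9)[OF x0 j(2) h(1)])
  qed
qed

sublocale cell T E blk star c \<epsilon> M lev JQ JR JP reg
proof
  show "vec.subspace M" by (rule M_subspace)
  show "JR \<subseteq> jumps M" using JR_iff by blast
  show "JQ \<subseteq> JR" using JQ_iff JR_iff by auto
  show "JQ \<subseteq> JP" by (rule JQ_JP)
  show "JP \<subseteq> T" by (auto simp: JP_def)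
  show "lev j < lev l" if "j \<in> JR" "l \<in> jumps M" "blk l = blk j" "l \<notin> JR" for j l
    using that JR_iff by auto
  show "JR \<inter> JP \<subseteq> reg" by (rule JR_JP_regular)
  show "star k \<in> jumps M" if "k \<in> JP" "k \<in> reg" "j \<in> JR" "blk j = blk k" "star k < j" for k j
    using regular_star that JR_iff by blast
qed (fact star_not_JP)+

end

section \<open>The piece of a point and its coordinates\<close>

context fibre_point
begin

definition S :: "'n point set" where
  "S = {x \<in> X. \<forall>\<kappa>\<in>components m. jumps (x \<kappa>) = J \<kappa>}"

lemma S_X: "x \<in> S \<Longrightarrow> x \<in> X" and S_jumps: "x \<in> S \<Longrightarrow> \<kappa> \<in> components m \<Longrightarrow> jumps (x \<kappa>) = J \<kappa>"
  by (auto simp: S_def)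

definition vectors :: "(bool \<times> nat \<times> nat \<Rightarrow> complex) \<Rightarrow> component \<Rightarrow> nat \<Rightarrow> complex ^ 'n" where
  "vectors a \<kappa> = (case \<kappa> of Ptil i \<Rightarrow> z a | _ \<Rightarrow> w a)"

definition point_at :: "(bool \<times> nat \<times> nat \<Rightarrow> complex) \<Rightarrow> 'n point" where
  "point_at a = restrict (\<lambda>\<kappa>. vec.span (vectors a \<kappa> ` J \<kappa>)) (components m)"

text \<open>Zero outside \<open>variables\<close>, so that a point is determined by finitely many
  free coordinates.\<close>

definition coords_at :: "'n point \<Rightarrow> bool \<times> nat \<times> nat \<Rightarrow> complex" where
  "coords_at x v = (if v \<in> variables then
     (case v of (q, l, j) \<Rightarrow> co l (ech (x (if q then chain (lev j) else Ptil (blk j))) j)) else 0)"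

lemma Ptil_component: "i \<in> {1..m} \<Longrightarrow> Ptil i \<in> components m"
  and Psub_component: "i \<in> {1..m} \<Longrightarrow> Psub i \<in> components m"
  and Hsub_component: "i \<in> {1..m} \<Longrightarrow> Hsub i \<in> components m"
  by (auto simp: components_def)

lemma vectors_simps: "vectors a (chain s) = w a" "vectors a (Ptil i) = z a"
  "vectors a (Psub i) = w a" "vectors a (Hsub i) = w a"
  by (auto simp: vectors_def chain_def)

lemma J_chain_subset: "s \<in> {1..2 * m} \<Longrightarrow> J (chain s) \<subseteq> jumps M"
  using jumps_mono[OF chain_in_M[OF x0]] .

lemma lead_vectors: "\<kappa> \<in> components m \<Longrightarrow> j \<in> J \<kappa> \<Longrightarrow> lead j (vectors a \<kappa> j)"
  by (erule components_cases) (use J_chain_subset lead_w lead_z J_Ptil in \<open>auto simp: vectors_simps\<close>)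

lemma jumps_point_at: "\<kappa> \<in> components m \<Longrightarrow> jumps (point_at a \<kappa>) = J \<kappa>"
  and dim_point_at: "\<kappa> \<in> components m \<Longrightarrow> vec.dim (point_at a \<kappa>) = vec.dim (x0 \<kappa>)"
  and subspace_point_at: "\<kappa> \<in> components m \<Longrightarrow> vec.subspace (point_at a \<kappa>)"
  using jumps_span[OF finite_jumps lead_vectors] complementary_jumps(2)[OF component_subspace[OF x0]]
  by (auto simp: point_at_def)

lemma point_at_component: "\<kappa> \<in> components m \<Longrightarrow> point_at a \<kappa> = vec.span (vectors a \<kappa> ` J \<kappa>)"
  by (simp add: point_at_def)

lemma w_in_M: "j \<in> jumps M \<Longrightarrow> w a j \<in> M"
  unfolding w_def
  by (intro vec.subspace_add[OF subspace_M] vec.subspace_sum[OF subspace_M] vec.subspace_scale[OF subspace_M]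
      ech(1)[OF subspace_M]) (auto simp: w_vars_def)

lemma co_w:
  assumes j: "j \<in> jumps M" and t: "t \<in> jumps M"
  shows "co t (w a j) = (if t = j then 1 else if t \<in> w_vars j then a (True, t, j) else 0)"
proof -
  have ech: "co t (ech M s) = (if t = s then 1 else 0)" if "s \<in> jumps M" for s
    using ech(2)[OF subspace_M that t] .
  have "(\<Sum>s\<in>w_vars j. a (True, s, j) * co t (ech M s)) = (\<Sum>s\<in>w_vars j. if t = s then a (True, s, j) else 0)"
    by (rule sum.cong[OF refl]) (use ech in \<open>auto simp: w_vars_def\<close>)
  then show ?thesis
    using finite_vars(1)[of j] ech[OF j] by (auto simp: co_w_sum w_vars_def)
qed

text \<open>Both vectors lie in \<open>M\<close>, so their coordinates at the jumps of
  \<open>M\<close> decide. Those in \<open>w_vars j\<close> agree by definition; the others are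
  fixed by the leading position or by the reduced form in the chain space.\<close>

lemma w_coords_at:
  assumes x: "x \<in> S" and j: "j \<in> jumps M"
  shows "w (coords_at x) j = ech (x (chain (lev j))) j"
proof -
  let ?L = "x (chain (lev j))"
  note s = lev(1)[OF j]
  have L: "vec.subspace ?L" "?L \<subseteq> M" "jumps ?L = J (chain (lev j))"
    using chain_subspace[OF S_X[OF x] s] chain_in_M[OF S_X[OF x] s] S_jumps[OF x chain_in_components[OF s]] by auto
  have jL: "j \<in> jumps ?L" using lev(2)[OF j] L by simp
  have "w (coords_at x) j - ech ?L j = 0"
  proof (rule zero_on_jumps[OF subspace_M])
    show "w (coords_at x) j - ech ?L j \<in> M"
      using w_in_M[OF j] ech(1)[OF L(1) jL] L(2) by (auto intro: vec.subspace_diff[OF subspace_M])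
    fix t assume t: "t \<in> jumps M"
    consider "t = j" | "t \<in> w_vars j" | "t > j" | "t \<noteq> j" "lev t \<le> lev j"
      using t by (auto simp: w_vars_def not_less) (meson linorder_neqE_nat not_le)
    then have "co t (w (coords_at x) j) = co t (ech ?L j)"
    proof cases
      case 1
      then show ?thesis using co_w[OF j t] ech(2)[OF L(1) jL jL] by simp
    next
      case 2
      then have "(True, t, j) \<in> variables" using j by (auto simp: variables_def)
      then show ?thesis using co_w[OF j t] 2 by (auto simp: coords_at_def w_vars_def)
    next
      case 3
      then show ?thesis using co_w[OF j t] ech(3)[OF L(1) jL] by (auto simp: lead_def w_vars_def)
    next
      case 4
      then have "t \<in> jumps ?L" using lev(3)[OF t s] L by simp
      then show ?thesis using co_w[OF j t] ech(2)[OF L(1) jL] 4 by (auto simp: w_vars_def)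
    qed
    then show "co t (w (coords_at x) j - ech ?L j) = 0" by (simp add: co_diff)
  qed
  then show ?thesis by simp
qed

lemma w_coords_at_in:
  assumes x: "x \<in> S" and s: "s \<in> {1..2 * m}" and j: "j \<in> J (chain s)"
  shows "w (coords_at x) j \<in> x (chain s)"
proof -
  have jM: "j \<in> jumps M" using J_chain_subset[OF s] j by auto
  note l = lev[OF jM]
  have "ech (x (chain (lev j))) j \<in> x (chain (lev j))"
    using ech(1)[OF chain_subspace[OF S_X[OF x] l(1)]] l(2) S_jumps[OF x chain_in_components[OF l(1)]] by simp
  then show ?thesis
    using w_coords_at[OF x jM] chain_mono[OF S_X[OF x] _ l(1) s] l(3)[OF s] j by auto
qed

lemma z_coords_at_in:
  assumes x: "x \<in> S" and k: "k \<in> JP"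
  shows "z (coords_at x) k \<in> x (Ptil (blk k))"
proof (cases "k \<in> JQ")
  case True
  have i: "blk k \<in> {1..m}" using k blk_range by (auto simp: JP_def)
  then have s: "2 * blk k - 1 \<in> {1..2 * m}" unfolding atLeastAtMost_iff by arith
  have "chain (2 * blk k - 1) = Psub (blk k)" using chain_simps(1)[of "blk k"] i by simp
  then have "w (coords_at x) k \<in> x (Psub (blk k))"
    using w_coords_at_in[OF x s, of k] True by (simp add: JQ_def)
  then show ?thesis using X_D(8)[OF S_X[OF x] i] True by (simp add: z_def)
next
  case False
  have kT: "k \<in> T" and i: "blk k \<in> {1..m}" using k blk_range by (auto simp: JP_def)
  let ?L = "x (Ptil (blk k))"
  have L: "vec.subspace ?L" "?L \<subseteq> V (blk k)" "jumps ?L = J (Ptil (blk k))"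
    using X_D(1,2)[OF S_X[OF x] i] S_jumps[OF x Ptil_component[OF i]] by auto
  have kL: "k \<in> jumps ?L" using L k J_Ptil[OF i] by simp
  have "z (coords_at x) k = ech ?L k"
  proof (rule co_ext)
    fix s assume s: "s \<in> T"
    note cp = co_p[OF False kT, of s "coords_at x"]
    consider "s = k" | "s \<in> p_vars k" | "s > k" | "blk s \<noteq> blk k" | "s \<noteq> k" "blk s = blk k" "s \<in> JP"
      using s by (auto simp: p_vars_def) (meson linorder_neqE_nat)
    then show "co s (z (coords_at x) k) = co s (ech ?L k)"
    proof cases
      case 1
      then show ?thesis using cp ech(2)[OF L(1) kL kL] by simp
    next
      case 2
      then have "(False, s, k) \<in> variables" using k False by (auto simp: variables_def)
      then show ?thesis using cp 2 by (auto simp: coords_at_def p_vars_def)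
    next
      case 3
      then show ?thesis using cp ech(3)[OF L(1) kL] by (auto simp: lead_def p_vars_def)
    next
      case 4
      have "ech ?L k \<in> V (blk k)" using ech(1)[OF L(1) kL] L(2) by blast
      then show ?thesis using cp 4 s V_eq[OF i] by (auto simp: coord_subspace_def p_vars_def)
    next
      case 5
      then have "s \<in> jumps ?L" using L(3) J_Ptil[OF i] by simp
      then show ?thesis using cp ech(2)[OF L(1) kL] 5 by (auto simp: p_vars_def)
    qed
  qed
  then show ?thesis using ech(1)[OF L(1) kL] by simp
qed

lemma point_at_coords_at:
  assumes x: "x \<in> S"
  shows "point_at (coords_at x) = x"
proof (rule extensionalityI[of _ "components m"])
  show "point_at (coords_at x) \<in> extensional (components m)" by (simp add: point_at_def)
  show "x \<in> extensional (components m)" using S_X[OF x] X_iff by blast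
  fix \<kappa> assume \<kappa>: "\<kappa> \<in> components m"
  have "vectors (coords_at x) \<kappa> t \<in> x \<kappa>" if t: "t \<in> J \<kappa>" for t
    using \<kappa>
  proof (cases rule: components_cases)
    case (1 s)
    then show ?thesis using w_coords_at_in[OF x 1(1)] t by (simp add: vectors_simps)
  next
    case (2 i)
    then show ?thesis using z_coords_at_in[OF x, of t] t J_Ptil[OF 2(1)] by (auto simp: vectors_simps)
  qed
  then have "vec.span (vectors (coords_at x) \<kappa> ` jumps (x \<kappa>)) = x \<kappa>"
    by (intro span_leads component_subspace[OF S_X[OF x] \<kappa>]) (simp add: S_jumps[OF x \<kappa>] lead_vectors[OF \<kappa>])
  then show "point_at (coords_at x) \<kappa> = x \<kappa>"
    using point_at_component[OF \<kappa>] S_jumps[OF x \<kappa>] by simp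
qed

lemma solution_coords_at:
  assumes x: "x \<in> S"
  shows "solution (coords_at x)"
  unfolding solution_def
proof (intro ballI conjI impI)
  fix k assume k: "k \<in> JP"
  then have i: "blk k \<in> {1..m}" using blk_range by (auto simp: JP_def)
  fix j assume j: "j \<in> JR" "blk j = blk k"
  have "2 * blk k \<in> {1..2 * m}" using i by auto
  then have "w (coords_at x) j \<in> x (Hsub (blk k))"
    using w_coords_at_in[OF x, of "2 * blk k" j] j chain_simps(2)[of "blk k"] by (simp add: JR_def)
  then show "form (w (coords_at x) j) (z (coords_at x) k) = 0"
    using X_D(9)[OF S_X[OF x] i _ z_coords_at_in[OF x k]] by blast
next
  fix j k assume *: "k \<in> JP" "j \<in> JP - JQ" "k \<notin> JQ \<and> blk j = blk k"
  have i: "blk k \<in> {1..m}" using * blk_range by (auto simp: JP_def)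
  show "form (z (coords_at x) j) (z (coords_at x) k) = 0"
    using X_D(7)[OF S_X[OF x] i _ z_coords_at_in[OF x]] z_coords_at_in[OF x, of j] * by auto
qed

text \<open>The parametrizing vectors are already normalized at the jumps of their spaces, so
  \<open>ech_unique\<close> identifies them with the reduced echelon basis and no coordinate is
  altered.\<close>

lemma coords_at_point_at:
  assumes v: "v \<in> variables"
  shows "coords_at (point_at a) v = a v"
proof -
  obtain q l j where vq: "v = (q, l, j)" by (cases v) auto
  show ?thesis
  proof (cases q)
    case True
    then have j: "j \<in> jumps M" and l: "l \<in> w_vars j" using v by (auto simp: vq variables_def)
    note s = lev(1,2)[OF j]
    note \<kappa> = chain_in_components[OF s(1)]
    let ?L = "point_at a (chain (lev j))"
    have L: "?L = vec.span (w a ` J (chain (lev j)))" using point_at_component[OF \<kappa>] by (simp add: vectors_simps)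
    have eq: "w a j = ech ?L j"
    proof (rule ech_unique[OF subspace_point_at[OF \<kappa>]])
      show "j \<in> jumps ?L" using jumps_point_at[OF \<kappa>] s by simp
      show "w a j \<in> ?L" unfolding L using s(2) by (intro vec.span_base imageI)
      fix t assume "t \<in> jumps ?L"
      then have t: "t \<in> J (chain (lev j))" using jumps_point_at[OF \<kappa>] by simp
      then have tM: "t \<in> jumps M" using J_chain_subset[OF s(1)] by blast
      then have "lev t \<le> lev j" using lev(3)[OF tM s(1)] t by simp
      then show "co t (w a j) = (if t = j then 1 else 0)"
        using co_w[OF j tM] by (auto simp: w_vars_def)
    qed
    have "co l (ech ?L j) = a (True, l, j)"
      using co_w[OF j, of l a] l unfolding eq by (auto simp: w_vars_def)
    then show ?thesis using v by (simp add: vq True coords_at_def)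
  next
    case False
    then have k: "j \<in> JP" "j \<notin> JQ" and l: "l \<in> p_vars j" using v by (auto simp: vq variables_def)
    then have kT: "j \<in> T" and i: "blk j \<in> {1..m}" using blk_range by (auto simp: JP_def)
    note \<kappa> = Ptil_component[OF i]
    let ?L = "point_at a (Ptil (blk j))"
    have L: "?L = vec.span (z a ` J (Ptil (blk j)))" using point_at_component[OF \<kappa>] by (simp add: vectors_simps)
    have jJ: "j \<in> J (Ptil (blk j))" using k J_Ptil[OF i] by simp
    have eq: "z a j = ech ?L j"
    proof (rule ech_unique[OF subspace_point_at[OF \<kappa>]])
      show "j \<in> jumps ?L" using jumps_point_at[OF \<kappa>] jJ by simp
      show "z a j \<in> ?L" unfolding L using jJ by (intro vec.span_base imageI)
      fix t assume "t \<in> jumps ?L"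
      then have "t \<in> JP" using jumps_point_at[OF \<kappa>] J_Ptil[OF i] by simp
      then show "co t (z a j) = (if t = j then 1 else 0)"
        using co_p[OF k(2) kT] by (auto simp: p_vars_def)
    qed
    have "co l (ech ?L j) = a (False, l, j)"
      using co_p[OF k(2) kT, of l a] l unfolding eq by (auto simp: p_vars_def)
    then show ?thesis using v by (simp add: vq False coords_at_def)
  qed
qed

lemma point_at_in_S:
  assumes a: "solution a"
  shows "point_at a \<in> S"
proof -
  let ?x = "point_at a"
  have PH: "?x (Psub i) = vec.span (w a ` J (Psub i))" "?x (Hsub i) = vec.span (w a ` J (Hsub i))"
    "?x (Ptil i) = vec.span (z a ` J (Ptil i))" if "i \<in> {1..m}" for i
    using point_at_component[OF Psub_component[OF that]] point_at_component[OF Hsub_component[OF that]]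
      point_at_component[OF Ptil_component[OF that]] by (simp_all add: vectors_simps)
  have w_B_le: "w a j \<in> B_le V i" if i: "i \<in> {1..m}" and j: "j \<in> jumps (B_le V i)" "j \<in> jumps M" for i j
  proof -
    obtain v where v: "lead j v" "v \<in> B_le V i" using j(1) by (auto simp: jumps_def)
    then have "blk j \<le> i" using lead_in_T[OF v(1)] B_le_eq[OF i]
      by (force simp: coord_subspace_def lead_def)
    then have "co t (w a j) = 0" if "t \<in> T" "i < blk t" for t
      using lead_w[OF j(2), of a] blk_mono[OF that(1) lead_in_T[OF v(1)]] that(2)
      by (cases "t > j") (auto simp: lead_def)
    then show ?thesis using B_le_eq[OF i] by (simp add: coord_subspace_def)
  qed
  have J_sub: "J (Psub i) \<subseteq> J (Hsub i)" "J (Hsub i) \<subseteq> jumps M" "J (Hsub i) \<subseteq> jumps (B_le V i)"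
    if i: "i \<in> {1..m}" for i
    using jumps_mono[OF X_D(11)[OF x0 i]] jumps_mono[OF X_D(6)[OF x0 i]] J_chain_subset[of "2 * i"]
      chain_simps(2)[of i] i by auto
  have sB: "vec.subspace (B_le V i)" if "i \<in> {1..m}" for i using B_le_eq[OF that] subspace_coord by simp
  \<comment> \<open>A vector leading in an earlier block has no component in block \<open>i\<close>,
    so only the jumps in block \<open>i\<close> itself lead to conditions.\<close>
  have wproj: "block_proj i (w a j) = (if blk j = i then block_proj (blk j) (w a j) else 0)"
    if i: "i \<in> {1..m}" and j: "j \<in> J (Hsub i)" for i j
  proof (cases "blk j = i")
    case False
    have jM: "j \<in> jumps M" and jT: "j \<in> T" using J_sub[OF i] j jumps_subset by blast+
    obtain v where v: "lead j v" "v \<in> B_le V i" using J_sub(3)[OF i] j by (auto simp: jumps_def)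
    then have "blk j \<le> i" using jT B_le_eq[OF i] by (force simp: coord_subspace_def lead_def)
    then have lt: "blk j < i" using False by simp
    have "co t (block_proj i (w a j)) = 0" for t
      using lead_w[OF jM, of a] blk_mono[of t j] jT lt
      by (cases "t > j") (auto simp: co_block_proj lead_def)
    then show ?thesis using False by (intro co_ext) (simp add: co_zero)
  qed simp
  \<comment> \<open>\<open>solution\<close> demands products of two \<open>z\<close> only outside
    \<open>JQ\<close>. The remaining ones are products with \<open>w\<close>, because
    \<open>form\<close> against a vector of one block sees only the projection to that
    block.\<close>
  have zform: "form (z a j) (z a k) = 0" if "j \<in> JP" "k \<in> JP" "blk j = blk k" for j k
  proof -
    have kb: "\<And>s. s \<in> T \<Longrightarrow> blk s \<noteq> blk k \<Longrightarrow> co s (z a k) = 0" using z_block[OF that(2)] by blast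
    have jb: "\<And>s. s \<in> T \<Longrightarrow> blk s \<noteq> blk k \<Longrightarrow> co s (z a j) = 0" using z_block[OF that(1)] that(3) by simp
    have Q: "form (z a j) (z a k) = 0" if "j \<in> JQ" "k \<in> JP" "blk j = blk k"
        "\<And>s. s \<in> T \<Longrightarrow> blk s \<noteq> blk k \<Longrightarrow> co s (z a k) = 0" for j k
    proof -
      have "form (z a j) (z a k) = form (w a j) (z a k)"
        using form_block_proj[OF that(4), where u = "w a j"] that(1,3) by (simp add: z_def)
      then show ?thesis using a that JQ_subset unfolding solution_def by auto
    qed
    show ?thesis
    proof (cases "j \<in> JQ")
      case True
      then show ?thesis using Q that kb by blast
    next
      case jQ: False
      show ?thesis
      proof (cases "k \<in> JQ")
        case True
        have "form (z a k) (z a j) = 0" by (rule Q) (use True that jb in auto)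
        then show ?thesis using form_reflexive[OF kb, where x = "z a j"] by simp
      next
        case False
        then show ?thesis using a that jQ unfolding solution_def by auto
      qed
    qed
  qed
  have iso: "\<forall>p\<in>?x (Ptil i). \<forall>p'\<in>?x (Ptil i). form p p' = 0" if i: "i \<in> {1..m}" for i
  proof (intro ballI)
    fix p p' assume "p \<in> ?x (Ptil i)" "p' \<in> ?x (Ptil i)"
    then show "form p p' = 0"
      unfolding PH(3)[OF i] J_Ptil[OF i] by (rule form_span_zero[rotated]) (use zform in auto)
  qed
  have Gr: "?x \<kappa> \<in> Gr d U" if "\<kappa> \<in> components m" "x0 \<kappa> \<in> Gr d U" "?x \<kappa> \<subseteq> U" for \<kappa> d U
    using that dim_point_at[OF that(1)] subspace_point_at[OF that(1)] by (simp add: Gr_def)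
  have Pt: "?x (Ptil i) \<subseteq> V i" if i: "i \<in> {1..m}" for i
    unfolding PH(3)[OF i] J_Ptil[OF i]
  proof (rule vec.span_minimal)
    show "vec.subspace (V i)" using V_eq[OF i] subspace_coord by simp
    show "z a ` {k \<in> JP. blk k = i} \<subseteq> V i" using z_block V_eq[OF i] by (auto simp: coord_subspace_def)
  qed
  have Ps: "?x (Psub i) \<subseteq> ?x (Hsub i)" "?x (Hsub i) \<subseteq> B_le V i" if i: "i \<in> {1..m}" for i
    unfolding PH[OF i] using J_sub[OF i] w_B_le[OF i]
    by (auto intro!: vec.span_mono vec.span_minimal[OF _ sB[OF i]])
  note X0 = X_iff[THEN iffD1, OF x0]
  have X0i: "x0 (Ptil i) \<in> Gr (ks i - rank_val (rs i)) (V i)"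
    "x0 (Psub i) \<in> Gr ((\<Sum>j\<in>{1..<i}. ks j) + (ks i - rank_val (rs i))) (B_le V i)"
    "x0 (Hsub i) \<in> Gr (\<Sum>j\<in>{1..i}. ks j) (B_le V i)"
    "\<forall>p\<in>x0 (Ptil i). \<forall>p'\<in>x0 (Ptil i). form p p' = 0"
    "rs i = Zero1 \<Longrightarrow> x0 (Ptil i) \<in> C1 i" "rs i = Zero2 \<Longrightarrow> x0 (Ptil i) \<in> C2 i" if "i \<in> {1..m}" for i
    using X0 that by blast+
  have "?x \<in> X"
    unfolding X_iff
  proof (intro conjI ballI impI)
    show "?x \<in> extensional (components m)" by (simp add: point_at_def)
    have m: "m \<in> {1..m}" using m_pos by simp
    have "J (Hsub m) = jumps M" using X0 by simp
    then show "?x (Hsub m) = M"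
      unfolding PH(2)[OF m] using span_leads[OF subspace_M, of "w a"] w_in_M lead_w by simp
    fix i assume i: "i \<in> {1..m}"
    show Gr_i: "?x (Ptil i) \<in> Gr (ks i - rank_val (rs i)) (V i)"
      by (rule Gr[OF Ptil_component[OF i] X0i(1)[OF i] Pt[OF i]])
    show "?x (Psub i) \<in> Gr ((\<Sum>j\<in>{1..<i}. ks j) + (ks i - rank_val (rs i))) (B_le V i)"
      by (rule Gr[OF Psub_component[OF i] X0i(2)[OF i]]) (use Ps[OF i] in blast)
    show "?x (Hsub i) \<in> Gr (\<Sum>j\<in>{1..i}. ks j) (B_le V i)"
      by (rule Gr[OF Hsub_component[OF i] X0i(3)[OF i] Ps(2)[OF i]])
    show "form p p' = 0" if "p \<in> ?x (Ptil i)" "p' \<in> ?x (Ptil i)" for p p'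
      using iso[OF i] that by blast
    show "block_proj i h \<in> ?x (Ptil i)" if h: "h \<in> ?x (Psub i)" for h
    proof -
      have lin: "vec.subspace {h. block_proj i h \<in> ?x (Ptil i)}"
      proof (rule vec.subspaceI)
        note sP = subspace_point_at[OF Ptil_component[OF i], of a]
        have "block_proj i 0 = 0" by (rule co_ext) (simp add: co_block_proj co_zero)
        then show "0 \<in> {h. block_proj i h \<in> ?x (Ptil i)}" using vec.subspace_0[OF sP] by simp
        have "block_proj i (u + v) = block_proj i u + block_proj i v" for u v
          by (rule co_ext) (simp add: co_block_proj co_add)
        then show "u + v \<in> {h. block_proj i h \<in> ?x (Ptil i)}"
          if "u \<in> {h. block_proj i h \<in> ?x (Ptil i)}" "v \<in> {h. block_proj i h \<in> ?x (Ptil i)}" for u v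
          using that vec.subspace_add[OF sP] by simp
        have "block_proj i (r *s u) = r *s block_proj i u" for r u
          by (rule co_ext) (simp add: co_block_proj co_scale)
        then show "r *s u \<in> {h. block_proj i h \<in> ?x (Ptil i)}"
          if "u \<in> {h. block_proj i h \<in> ?x (Ptil i)}" for r u
          using that vec.subspace_scale[OF sP] by simp
      qed
      have "block_proj i (w a j) \<in> ?x (Ptil i)" if j: "j \<in> J (Psub i)" for j
      proof (cases "blk j = i")
        case True
        then have "j \<in> JQ" using j jumps_subset by (auto simp: JQ_def)
        moreover then have "j \<in> J (Ptil i)" using JQ_subset J_Ptil[OF i] True by auto
        ultimately show ?thesis
          unfolding PH(3)[OF i] using True by (intro vec.span_base image_eqI[of _ _ j]) (simp_all add: z_def)
      next
        case False
        then have "block_proj i (w a j) = 0" using wproj[OF i, of j] J_sub(1)[OF i] j by auto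
        then show ?thesis using vec.subspace_0[OF subspace_point_at[OF Ptil_component[OF i]]] by simp
      qed
      then show ?thesis
        using vec.span_minimal[OF _ lin, of "w a ` J (Psub i)"] h unfolding PH(1)[OF i] by blast
    qed
    show "form h p = 0" if h: "h \<in> ?x (Hsub i)" and p: "p \<in> ?x (Ptil i)" for h p
    proof (rule form_span_zero)
      show "h \<in> vec.span (w a ` J (Hsub i))" "p \<in> vec.span (z a ` J (Ptil i))" using h p PH[OF i] by auto
      fix u v assume "u \<in> w a ` J (Hsub i)" "v \<in> z a ` J (Ptil i)"
      then obtain j k where jk: "u = w a j" "v = z a k" "j \<in> J (Hsub i)" "k \<in> JP" "blk k = i"
        using J_Ptil[OF i] by auto
      show "form u v = 0"
      proof (cases "blk j = i")
        case True
        then have "j \<in> JR" using jk jumps_subset by (auto simp: JR_def)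
        then show ?thesis using a jk True unfolding solution_def by auto
      next
        case False
        have "form u v = form (block_proj i (w a j)) v"
          using form_block_proj[of i v "w a j"] z_block[OF jk(4)] jk by simp
        also have "\<dots> = 0" using wproj[OF i jk(3)] False by (simp add: form_def co_zero)
        finally show ?thesis .
      qed
    qed
    show "?x (Psub i) \<subseteq> ?x (Hsub i)" by (rule Ps(1)[OF i])
    show "H_at ?x (i - 1) \<subseteq> ?x (Psub i)"
    proof (cases "i = 1")
      case True
      then show ?thesis
        using vec.subspace_0[OF subspace_point_at[OF Psub_component[OF i]]] by (simp add: H_at_def)
    next
      case False
      then have i': "i - 1 \<in> {1..m}" "i - 1 \<noteq> 0" using i by auto
      have "x0 (Hsub (i - 1)) \<subseteq> x0 (Psub i)" using X_D(10)[OF x0 i] i' by (simp add: H_at_def)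
      then have "J (Hsub (i - 1)) \<subseteq> J (Psub i)" by (rule jumps_mono)
      then show ?thesis
        using i' PH(2)[OF i'(1)] PH(1)[OF i] by (simp add: H_at_def vec.span_mono image_mono)
    qed
    note jm = jumps_point_at[OF Ptil_component[OF i], of a]
    show "?x (Ptil i) \<in> C1 i" if "rs i = Zero1"
      by (rule C1_stable[OF i that X0i(5)[OF i that] X0i(1)[OF i] Gr_i X0i(4)[OF i] iso[OF i] jm])
    show "?x (Ptil i) \<in> C2 i" if "rs i = Zero2"
      by (rule C2_stable[OF i that X0i(6)[OF i that] X0i(1)[OF i] Gr_i X0i(4)[OF i] iso[OF i] jm])
  qed
  then show ?thesis using jumps_point_at by (auto simp: S_def)
qed

text \<open>All points of \<open>S\<close> lie in the chart given by their common jumps. The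
  nonpivot variables are the affine coordinates and \<open>G\<close> restores the pivots. Both
  directions are polynomial: \<open>ech\<close> is linear in the chart coordinates, and conversely
  \<open>polynomial_proj_along\<close> applies to the parametrizing vectors.\<close>

lemma S_isomorphic_affine:
  "\<exists>d. isomorphic_varieties (grassmann_atlas (components m)) S (affine_atlas d) (affine_space d)"
proof -
  obtain G where G: "\<And>v. (\<lambda>x. G x v) \<in> polynomial_functions" "\<And>x. solution (G x)"
    "\<And>x v. \<not> pivot v \<Longrightarrow> G x v = x v"
    "\<And>x y. solution x \<Longrightarrow> (\<And>v. \<not> pivot v \<Longrightarrow> x v = y v) \<Longrightarrow> G y = x"
  proof (rule solutions_parametrized)
    fix G :: "(bool \<times> nat \<times> nat \<Rightarrow> complex) \<Rightarrow> bool \<times> nat \<times> nat \<Rightarrow> complex"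
    assume G: "\<And>v. (\<lambda>x. G x v) \<in> polynomial_functions" "\<And>x. solution (G x)"
      "\<And>x v. \<not> pivot v \<Longrightarrow> G x v = x v"
      "\<And>x y. solution x \<Longrightarrow> (\<And>v. \<not> pivot v \<Longrightarrow> x v = y v) \<Longrightarrow> G y = x"
    show thesis by (rule that[OF G])
  qed
  define free where "free = {v \<in> variables. \<not> pivot v}"
  have "finite free" using finite_variables by (simp add: free_def)
  then obtain f where f: "bij_betw f {..<card free} free"
    using ex_bij_betw_nat_finite[of free] by (auto simp: atLeast0LessThan)
  define d where "d = card free"
  define g where "g = the_inv_into {..<d} f"
  have fg: "f i \<in> free" "g (f i) = i" if "i < d" for i
    using f that by (auto simp: bij_betw_def g_def d_def the_inv_into_f_f)
  have gf: "g v < d" "f (g v) = v" if "v \<in> free" for v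
    using f that the_inv_into_into[of f "{..<d}" v "{..<d}"] f_the_inv_into_f[of f "{..<d}" v]
    by (auto simp: bij_betw_def g_def d_def)
  \<comment> \<open>The value 0 at pivots is a placeholder overwritten by \<open>G\<close>; outside
    \<open>variables\<close> it agrees with \<open>coords_at\<close>.\<close>
  define ext where "ext t v = (if v \<in> free then t (g v) else 0)" for t :: "nat \<Rightarrow> complex" and v
  define \<phi> where "\<phi> x i = (if i < d then coords_at x (f i) else 0)" for x i
  define \<psi> where "\<psi> t = point_at (G (ext t))" for t
  let ?W = "\<lambda>\<kappa>. coord_subspace (J \<kappa>)"
  let ?c = "grassmann_coords (components m) ?W :: 'n point \<Rightarrow> component \<times> 'n \<times> 'n \<Rightarrow> complex"
  have fin: "finite (components m)" by (simp add: components_def)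
  have c: "?c x (\<kappa>, p, q) = proj_along (?W \<kappa>) (x \<kappa>) $ p $ q" if "\<kappa> \<in> components m" for x \<kappa> p q
    using that by (simp add: grassmann_coords_def)
  have "isomorphic_varieties (grassmann_atlas (components m)) S (affine_atlas d) (affine_space d)"
  proof (rule isomorphic_affine_if_polynomial[OF compatible_chart_grassmann[OF fin]])
    show "S \<subseteq> grassmann_chart (components m) ?W"
    proof
      fix x assume x: "x \<in> S"
      have "complementary (x \<kappa>) (?W \<kappa>)" if "\<kappa> \<in> components m" for \<kappa>
        using complementary_jumps(1)[OF component_subspace[OF S_X[OF x] that]] S_jumps[OF x that] by simp
      then show "x \<in> grassmann_chart (components m) ?W"
        using S_X[OF x] X_iff by (simp add: grassmann_chart_def)
    qed
    show "\<phi> x \<in> affine_space d" for x by (simp add: \<phi>_def affine_space_def)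
    show "\<psi> t \<in> S" for t unfolding \<psi>_def by (rule point_at_in_S[OF G(2)])
    show "\<psi> (\<phi> x) = x" if x: "x \<in> S" for x
    proof -
      have "G (ext (\<phi> x)) = coords_at x"
      proof (rule G(4)[OF solution_coords_at[OF x]])
        fix v assume "\<not> pivot v"
        then show "coords_at x v = ext (\<phi> x) v"
          using gf[of v] by (auto simp: ext_def \<phi>_def free_def coords_at_def)
      qed
      then show ?thesis unfolding \<psi>_def using point_at_coords_at[OF x] by simp
    qed
    show "\<phi> (\<psi> t) = t" if t: "t \<in> affine_space d" for t
    proof
      fix i
      show "\<phi> (\<psi> t) i = t i"
      proof (cases "i < d")
        case True
        note fi = fg[OF True]
        have "coords_at (point_at (G (ext t))) (f i) = G (ext t) (f i)"
          by (rule coords_at_point_at) (use fi in \<open>simp add: free_def\<close>)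
        also have "\<dots> = ext t (f i)" by (rule G(3)) (use fi in \<open>simp add: free_def\<close>)
        finally show ?thesis using True fi by (simp add: \<phi>_def \<psi>_def ext_def)
      qed (use t in \<open>simp add: \<phi>_def affine_space_def\<close>)
    qed
    show "\<exists>\<Phi>\<in>polynomial_functions. \<forall>x\<in>S. \<phi> x i = \<Phi> (?c x)" for i
    proof (cases "i < d")
      case False
      then show ?thesis by (intro bexI[OF _ polynomial_functions.const[of 0]]) (simp add: \<phi>_def)
    next
      case True
      obtain q l j where v: "f i = (q, l, j)" by (cases "f i") auto
      have v_var: "(q, l, j) \<in> variables" using fg(1)[OF True] v by (simp add: free_def)
      define \<kappa> where "\<kappa> = (if q then chain (lev j) else Ptil (blk j))"
      have \<kappa>: "\<kappa> \<in> components m"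
        using v_var lev(1)[of j] chain_in_components[of "lev j"] Ptil_component[of "blk j"] blk_range[of j]
        by (cases q) (auto simp: \<kappa>_def variables_def in_T)
      define \<Phi> where "\<Phi> = (\<lambda>y :: component \<times> 'n \<times> 'n \<Rightarrow> complex. co l ((\<chi> p q. y (\<kappa>, p, q)) *v E j))"
      have "\<Phi> \<in> polynomial_functions"
        unfolding \<Phi>_def
        by (rule polynomial_co) (unfold matrix_vector_mult_def vec_lambda_beta,
            intro polynomial_sum polynomial_functions.mult polynomial_functions.const polynomial_functions.var)
      moreover have "\<phi> x i = \<Phi> (?c x)" if x: "x \<in> S" for x
      proof -
        have "(\<chi> p q. ?c x (\<kappa>, p, q)) = proj_along (?W \<kappa>) (x \<kappa>)" using c[OF \<kappa>] by (simp add: vec_eq_iff)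
        then have "\<Phi> (?c x) = co l (ech (x \<kappa>) j)"
          using S_jumps[OF x \<kappa>] by (simp add: \<Phi>_def ech_def)
        then show ?thesis using True v v_var by (simp add: \<phi>_def coords_at_def \<kappa>_def)
      qed
      ultimately show ?thesis by (intro bexI[of _ \<Phi>]) auto
    qed
    show "\<exists>\<Psi>\<in>polynomial_functions. \<forall>t\<in>affine_space d. ?c (\<psi> t) v = \<Psi> t" for v
    proof -
      obtain \<kappa> p q where v: "v = (\<kappa>, p, q)" by (cases v) auto
      show ?thesis
      proof (cases "\<kappa> \<in> components m")
        case False
        then show ?thesis
          by (intro bexI[OF _ polynomial_functions.const[of 0]]) (simp add: v grassmann_coords_def)
      next
        case True
        have ext: "(\<lambda>t. ext t u) \<in> polynomial_functions" for u
          by (cases "u \<in> free") (simp_all add: ext_def polynomial_functions.const polynomial_functions.var)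
        have Gext: "(\<lambda>t. G (ext t) u) \<in> polynomial_functions" for u
          by (rule polynomial_subst[OF G(1) ext])
        have vec: "(\<lambda>t. vectors (G (ext t)) \<kappa> j $ r) \<in> polynomial_functions" for j r
        proof -
          have "(\<lambda>a. vectors a \<kappa> j $ r) \<in> polynomial_functions"
            by (cases \<kappa>) (simp_all add: vectors_simps polynomial_w polynomial_z)
          from polynomial_subst[OF this Gext] show ?thesis .
        qed
        have "(\<lambda>t. proj_along (?W \<kappa>) (vec.span ((\<lambda>j. vectors (G (ext t)) \<kappa> j) ` J \<kappa>)) $ p $ q) \<in> polynomial_functions"
          by (rule polynomial_proj_along[where w = "\<lambda>j t. vectors (G (ext t)) \<kappa> j"])
             (use finite_jumps lead_vectors[OF True] vec in auto)
        then show ?thesis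
          by (rule bexI[rotated]) (simp add: v c[OF True] \<psi>_def point_at_component[OF True])
      qed
    qed
  qed
  then show ?thesis by blast
qed

end

section \<open>Lagrangian subspaces in one orbit\<close>

text \<open>\<open>1 + N\<close> and its square are conjugate by \<open>1 + R\<close>, so \<open>det (1 + N)\<close> equals its square.\<close>

lemma det_unipotent:
  fixes N R :: "complex ^ 'n ^ 'n"
  assumes NN: "\<And>x. N *v (N *v x) = 0" and RR: "\<And>x. R *v (R *v x) = R *v x"
    and RN: "\<And>x. R *v (N *v x) = N *v x" and NR: "\<And>x. N *v (R *v x) = 0"
  shows "det (mat 1 + N) = 1"
proof -
  let ?g = "mat 1 + N" and ?h = "mat 1 + R"
  have nz: "det A \<noteq> 0" if "\<And>x. A *v x = 0 \<Longrightarrow> x = 0" for A :: "complex ^ 'n ^ 'n"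
  proof -
    have "inj ((*v) A)" using that by (simp add: vec.inj_iff_eq_0)
    then show ?thesis
      by (simp add: invertible_det_nz[symmetric] invertible_left_inverse matrix_left_invertible_injective)
  qed
  have "det ?h \<noteq> 0"
  proof (rule nz)
    fix x assume "?h *v x = 0"
    then have x: "x + R *v x = 0" by (simp add: matrix_vector_mult_add_rdistrib)
    then have "R *v (x + R *v x) = 0" by simp
    then have "R *v x + R *v x = 0" by (simp add: matrix_vector_right_distrib RR)
    then have "R *v x = 0" by (simp add: vec_eq_iff)
    then show "x = 0" using x by simp
  qed
  moreover have "det ?g \<noteq> 0"
  proof (rule nz)
    fix x assume "?g *v x = 0"
    then have x: "x + N *v x = 0" by (simp add: matrix_vector_mult_add_rdistrib)
    then have "N *v (x + N *v x) = 0" by simp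
    then have "N *v x = 0" by (simp add: matrix_vector_right_distrib NN)
    then show "x = 0" using x by simp
  qed
  moreover have "?h ** ?g = (?g ** ?g) ** ?h"
    unfolding matrix_eq
    by (simp add: matrix_vector_mul_assoc[symmetric] matrix_vector_mult_add_rdistrib
        matrix_vector_right_distrib NN RN NR algebra_simps)
  then have "det ?h * det ?g = det ?g * det ?g * det ?h" by (metis det_mul)
  ultimately show ?thesis by simp
qed

text \<open>\<open>V \<inter> D\<close> is an isotropic complement in \<open>V\<close> of both
  \<open>P\<close> and \<open>P'\<close>. The shear \<open>1 + N\<close> sends each vector of
  \<open>P\<close> to the vector of \<open>P'\<close> that differs from it by an element of
  \<open>D\<close>, and it fixes \<open>V \<inter> D\<close> and \<open>W\<close>. It is an
  isometry: only products with \<open>V \<inter> D\<close> contribute, and displacements inside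
  \<open>V \<inter> D\<close> do not change them.\<close>

lemma SO_orbit_stable:
  fixes V D P P' L :: "(complex ^ 'n) set"
  assumes bil: "bilinear_form_on V b" and sV: "vec.subspace V" and PV: "P \<subseteq> V" "P' \<subseteq> V"
    and PD: "complementary P D" "complementary P' D"
    and isoP: "\<And>x y. x \<in> P \<Longrightarrow> y \<in> P \<Longrightarrow> b x y = 0" and isoP': "\<And>x y. x \<in> P' \<Longrightarrow> y \<in> P' \<Longrightarrow> b x y = 0"
    and isoD: "\<And>x y. x \<in> V \<Longrightarrow> x \<in> D \<Longrightarrow> y \<in> V \<Longrightarrow> y \<in> D \<Longrightarrow> b x y = 0"
    and P: "P \<in> SO_orbit V b L"
  shows "P' \<in> SO_orbit V b L"
proof -
  obtain g0 where g0: "g0 \<in> SO V b" "P = (\<lambda>x. g0 *v x) ` L" using P unfolding SO_orbit_def by auto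
  obtain W where W: "complementary V W" "\<And>w. w \<in> W \<Longrightarrow> g0 *v w = w"
    and g0V: "\<And>x. x \<in> V \<Longrightarrow> g0 *v x \<in> V" "\<And>x y. x \<in> V \<Longrightarrow> y \<in> V \<Longrightarrow> b (g0 *v x) (g0 *v y) = b x y" "det g0 = 1"
    using g0(1) unfolding SO_def by auto
  let ?A = "proj_along D P'" and ?B = "proj_along D P" and ?\<Pi> = "proj_along W V"
  define N where "N = (?A - ?B) ** ?\<Pi>"
  \<comment> \<open>The projection onto \<open>V \<inter> D\<close> along \<open>P + W\<close>. It
    fixes the image of \<open>N\<close>, and \<open>N\<close> kills its image, as
    \<open>det_unipotent\<close> requires.\<close>
  define R where "R = (mat 1 - ?B) ** ?\<Pi>"
  let ?g = "mat 1 + N"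
  have Nx: "N *v x = ?A *v (?\<Pi> *v x) - ?B *v (?\<Pi> *v x)" for x
    by (simp add: N_def matrix_vector_mul_assoc[symmetric] matrix_vector_mult_diff_rdistrib)
  have Rx: "R *v x = ?\<Pi> *v x - ?B *v (?\<Pi> *v x)" for x
    by (simp add: R_def matrix_vector_mul_assoc[symmetric] matrix_vector_mult_diff_rdistrib)
  have gx: "?g *v x = x + N *v x" for x by (simp add: matrix_vector_mult_add_rdistrib)
  have \<Pi>: "?\<Pi> *v x \<in> V" for x by (rule proj_along(1)[OF W(1)])
  have \<Pi>V: "?\<Pi> *v x = x" if "x \<in> V" for x by (rule proj_along_id[OF W(1) that])
  have AV: "?A *v x \<in> V" "?B *v x \<in> V" for x
    using proj_along(1)[OF PD(2), of x] proj_along(1)[OF PD(1), of x] PV by auto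
  have sD: "vec.subspace D" using PD by (simp add: complementary_def)
  have RD: "R *v x \<in> V \<inter> D" for x
    unfolding Rx using proj_along(2)[OF PD(1)] \<Pi> AV vec.subspace_diff[OF sV] by blast
  have ND: "N *v x \<in> V \<inter> D" for x
  proof -
    have "?A *v y - ?B *v y \<in> D" for y
      using vec.subspace_diff[OF sD proj_along(2)[OF PD(1), of y] proj_along(2)[OF PD(2), of y]] by simp
    then show ?thesis unfolding Nx using vec.subspace_diff[OF sV AV] by blast
  qed
  have N0: "N *v x = 0" if "x \<in> V \<inter> D" for x
    using that \<Pi>V proj_along_0[OF PD(1)] proj_along_0[OF PD(2)] by (simp add: Nx)
  have RI: "R *v x = x" if "x \<in> V \<inter> D" for x
    using that \<Pi>V proj_along_0[OF PD(1)] by (simp add: Rx)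
  have det: "det ?g = 1"
    by (rule det_unipotent[of N R]) (use N0[OF ND] RI[OF RD] RI[OF ND] N0[OF RD] in auto)
  have gV: "?g *v x \<in> V" if "x \<in> V" for x
    using that ND[of x] vec.subspace_add[OF sV] by (simp add: gx)
  have gform: "?g *v x = ?A *v x + (x - ?B *v x)" if "x \<in> V" for x
    using that \<Pi>V by (simp add: gx Nx)
  have add: "b (x + y) z = b x z + b y z" "b z (x + y) = b z x + b z y" if "x \<in> V" "y \<in> V" "z \<in> V" for x y z
    using bil that unfolding bilinear_form_on_def by blast+
  have giso: "b (?g *v x) (?g *v y) = b x y" if "x \<in> V" "y \<in> V" for x y
  proof -
    have *: "x - ?B *v x \<in> V" "x - ?B *v x \<in> D" "?A *v x \<in> P'" "?B *v x \<in> P" "?A *v x - ?B *v x \<in> V"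
      "?A *v x - ?B *v x \<in> D" if "x \<in> V" for x
      using that proj_along(2)[OF PD(1)] proj_along(1)[OF PD(1)] proj_along(1)[OF PD(2)] AV ND[of x] \<Pi>V[OF that]
        vec.subspace_diff[OF sV] by (auto simp: Nx)
    have left: "b (?A *v x) (y - ?B *v y) = b (?B *v x) (y - ?B *v y)"
      using add(1)[of "?A *v x - ?B *v x" "?B *v x" "y - ?B *v y"] *[OF that(1)] *[OF that(2)] AV isoD by simp
    have right: "b (x - ?B *v x) (?A *v y) = b (x - ?B *v x) (?B *v y)"
      using add(2)[of "?A *v y - ?B *v y" "?B *v y" "x - ?B *v x"] *[OF that(1)] *[OF that(2)] AV isoD by simp
    have expand: "b (p + u) (q + v) = b p q + b p v + (b u q + b u v)" if "p \<in> V" "q \<in> V" "u \<in> V" "v \<in> V" for p q u v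
      using that add vec.subspace_add[OF sV] by (simp add: ac_simps)
    have "b (?g *v x) (?g *v y) = b (?B *v x) (y - ?B *v y) + b (x - ?B *v x) (?B *v y)"
      unfolding gform[OF that(1)] gform[OF that(2)] using expand[OF AV(1,1) *(1)[OF that(1)] *(1)[OF that(2)]]
        left right isoP' isoD * that by simp
    also have "\<dots> = b (?B *v x + (x - ?B *v x)) (?B *v y + (y - ?B *v y))"
      by (simp only: expand[OF AV(2,2) *(1)[OF that(1)] *(1)[OF that(2)]] isoP[OF *(4)[OF that(1)] *(4)[OF that(2)]]
          isoD[OF *(1,2)[OF that(1)] *(1,2)[OF that(2)]] add_0_left add_0_right)
    finally show ?thesis by simp
  qed
  have gW: "?g *v w = w" if "w \<in> W" for w
    using proj_along_0[OF W(1) that] by (simp add: gx Nx)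
  have "?g ** g0 \<in> SO V b"
    unfolding SO_def mem_Collect_eq
    by (intro conjI exI[of _ W]) (use W gW g0V gV giso det in \<open>auto simp: matrix_vector_mul_assoc[symmetric] det_mul\<close>)
  moreover have "P' = (\<lambda>x. (?g ** g0) *v x) ` L"
  proof -
    have "(\<lambda>x. ?g *v x) ` P = P'"
    proof (intro equalityI subsetI)
      fix y assume "y \<in> (\<lambda>x. ?g *v x) ` P"
      then obtain x where "x \<in> P" "y = ?g *v x" by auto
      then show "y \<in> P'"
        using gform[of x] PV proj_along_id[OF PD(1)] proj_along(1)[OF PD(2)] by auto
    next
      fix y assume y: "y \<in> P'"
      have "?A *v (?B *v y) = y"
      proof (rule proj_along_eqI[OF PD(2) y])
        show "?B *v y - y \<in> D"
          using vec.subspace_neg[OF sD proj_along(2)[OF PD(1), of y]] by simp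
      qed
      then have "?g *v (?B *v y) = y"
        using gform[OF AV(2)] proj_along_id[OF PD(1) proj_along(1)[OF PD(1)]] by simp
      then show "y \<in> (\<lambda>x. ?g *v x) ` P" using proj_along(1)[OF PD(1), of y] by (metis imageI)
    qed
    then show ?thesis unfolding g0(2) image_image by (simp add: matrix_vector_mul_assoc)
  qed
  ultimately show ?thesis unfolding SO_orbit_def by blast
qed

context graded_space
begin

lemma dim_V: "i \<in> {1..m} \<Longrightarrow> vec.dim (V i) = card {t \<in> T. blk t = i}"
proof -
  assume i: "i \<in> {1..m}"
  have "vec.dim (V i) + card {t \<in> T. blk t \<noteq> i} = card T"
    using dim_coord_subspace[of "{t \<in> T. blk t \<noteq> i}"] V_eq[OF i] card_T by auto
  moreover have "card {t \<in> T. blk t = i} + card {t \<in> T. blk t \<noteq> i} = card T"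
    using finite_T by (subst card_Un_disjoint[symmetric]) (auto intro!: arg_cong[of _ _ card])
  ultimately show ?thesis by linarith
qed

text \<open>By isotropy the jumps of \<open>P\<close> are disjoint from their duals, and by
  dimension the two sets exhaust the block. So each dual pair contains a jump, and the vectors of
  \<open>V i\<close> vanishing at the jumps form an isotropic space. Depending on the jumps only, it
  is a common complement of \<open>P\<close> and \<open>P'\<close> in \<open>V i\<close>.\<close>

lemma lagrangian_orbit_stable:
  assumes i: "i \<in> {1..m}" and bil: "bilinear_form_on (V i) b"
    and b: "\<And>u v. u \<in> V i \<Longrightarrow> v \<in> V i \<Longrightarrow> b u v = form u v"
    and P: "P \<in> SO_orbit (V i) b L" and Gr: "P \<in> Gr d (V i)" "P' \<in> Gr d (V i)" and d: "vec.dim (V i) = 2 * d"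
    and iso: "\<forall>p\<in>P. \<forall>p'\<in>P. form p p' = 0" "\<forall>p\<in>P'. \<forall>p'\<in>P'. form p p' = 0" and J: "jumps P' = jumps P"
  shows "P' \<in> SO_orbit (V i) b L"
proof -
  let ?B = "{t \<in> T. blk t = i}" and ?J = "jumps P"
  have sub: "vec.subspace P" "P \<subseteq> V i" "vec.dim P = d" "vec.subspace P'" "P' \<subseteq> V i"
    using Gr by (auto simp: Gr_def)
  have blkP: "co s p = 0" if "p \<in> P" "s \<in> T" "blk s \<noteq> i" for p s
    using that sub V_eq[OF i] by (auto simp: coord_subspace_def)
  have JB: "?J \<subseteq> ?B"
  proof
    fix k assume "k \<in> ?J"
    then obtain p where p: "p \<in> P" "lead k p" by (auto simp: jumps_def)
    then show "k \<in> ?B" using blkP[OF p(1), of k] lead_in_T[OF p(2)] by (auto simp: lead_def)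
  qed
  have disj: "?J \<inter> star ` ?J = {}"
  proof (rule ccontr)
    assume "?J \<inter> star ` ?J \<noteq> {}"
    then obtain k where k: "k \<in> ?J" "star k \<in> ?J" by auto
    obtain p q where p: "p \<in> P" "lead k p" and q: "q \<in> P" "lead (star k) q" using k by (auto simp: jumps_def)
    have kT: "k \<in> T" "blk k = i" using k JB by auto
    have "form p q = c k"
      by (rule form_lead(2)[OF p(2) q(2)]) (use kT blk_star blkP[OF q(1)] in auto)
    then show False using iso(1) p(1) q(1) c_nonzero[OF kT(1)] by simp
  qed
  have inj: "inj_on star ?J" using JB star_star by (intro inj_on_inverseI[of _ star]) auto
  have cardJ: "card ?J = d" using complementary_jumps(2)[OF sub(1)] sub(3) by simp
  have fJ: "finite ?J" by (rule finite_jumps)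
  have "card (?J \<union> star ` ?J) = card ?B"
    using card_Un_disjoint[OF fJ finite_imageI[OF fJ] disj] card_image[OF inj] cardJ d dim_V[OF i] by simp
  moreover have "?J \<union> star ` ?J \<subseteq> ?B" using JB star_T blk_star by auto
  ultimately have cover: "?J \<union> star ` ?J = ?B" using finite_T by (intro card_subset_eq) auto
  show ?thesis
  proof (rule SO_orbit_stable[OF bil _ sub(2,5) complementary_jumps(1)[OF sub(1)] _ _ _ _ P])
    show "vec.subspace (V i)" using V_eq[OF i] subspace_coord by simp
    show "complementary P' (coord_subspace (jumps P))" using complementary_jumps(1)[OF sub(4)] J by simp
    show "b x y = 0" if "x \<in> P" "y \<in> P" for x y
      using b[OF subsetD[OF sub(2) that(1)] subsetD[OF sub(2) that(2)]] iso(1) that by simp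
    show "b x y = 0" if "x \<in> P'" "y \<in> P'" for x y
      using b[OF subsetD[OF sub(5) that(1)] subsetD[OF sub(5) that(2)]] iso(2) that by simp
    show "b x y = 0" if xy: "x \<in> V i" "x \<in> coord_subspace ?J" "y \<in> V i" "y \<in> coord_subspace ?J" for x y
    proof -
      have "co s x * co (star s) y * c s = 0" if s: "s \<in> T" for s
      proof (cases "blk s = i")
        case True
        then have "s \<in> ?J \<union> star ` ?J" unfolding cover using s by simp
        then have "s \<in> ?J \<or> star s \<in> ?J" using star_star jumps_subset[of P] by auto
        then show ?thesis using xy by (auto simp: coord_subspace_def)
      next
        case False
        then show ?thesis using xy(1) s V_eq[OF i] by (auto simp: coord_subspace_def)
      qed
      then have "form x y = 0" unfolding form_def by (intro sum.neutral ballI)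
      then show ?thesis using b[OF xy(1,3)] by simp
    qed
  qed
qed

end

section \<open>The adapted basis of the graded space\<close>

lemma sum_single: "finite A \<Longrightarrow> a \<in> A \<Longrightarrow> (\<And>x. x \<in> A - {a} \<Longrightarrow> g x = 0) \<Longrightarrow> (\<Sum>x\<in>A. g x) = g a"
  for g :: "'a \<Rightarrow> 'b::comm_monoid_add"
  by (simp add: sum.remove sum.neutral)

lemma independent_family:
  fixes E :: "'i \<Rightarrow> complex ^ 'n"
  assumes T: "finite T" and zero: "\<And>f t. (\<Sum>t\<in>T. f t *s E t) = 0 \<Longrightarrow> t \<in> T \<Longrightarrow> f t = 0"
  shows "inj_on E T" "vec.independent (E ` T)"
proof -
  show inj: "inj_on E T"
  proof (rule inj_onI, rule ccontr)
    fix s t assume st: "s \<in> T" "t \<in> T" "E s = E t" "s \<noteq> t"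
    let ?f = "\<lambda>r. if r = s then 1 else if r = t then -1 else 0 :: complex"
    have "(\<Sum>r\<in>T. ?f r *s E r) = (\<Sum>r\<in>{s, t}. ?f r *s E r)"
      by (rule sum.mono_neutral_right) (use T st in auto)
    also have "\<dots> = 0" using st by simp
    finally have "?f s = 0" using zero[of ?f s] st by blast
    then show False by simp
  qed
  show "vec.independent (E ` T)"
  proof (rule vec.independent_if_scalars_zero)
    fix f x assume "(\<Sum>x\<in>E ` T. f x *s x) = 0" "x \<in> E ` T"
    then show "f x = 0" using zero[of "\<lambda>t. f (E t)"] by (auto simp: sum.reindex[OF inj])
  qed (use T in simp)
qed

text \<open>Pairing with the dual basis vector isolates a single coefficient.\<close>

lemma (in reflexive_form) witt_frame_coefficients_zero:
  assumes fr: "witt_frame V b \<epsilon> N n e r I \<nu>" and 0: "(\<Sum>j\<in>{1..n}. f j *s e j) = 0" and j: "j \<in> {1..n}"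
  shows "f j = 0"
proof -
  have sp: "vec.span (e ` {1..n}) = V" and pair: "\<And>i j. i \<in> {1..n} \<Longrightarrow> j \<in> {1..n} \<Longrightarrow>
      b (e i) (e j) \<noteq> 0 \<longleftrightarrow> i + j = Suc n"
    using fr unfolding witt_frame_def by blast+
  have eV: "e i \<in> V" if "i \<in> {1..n}" for i using that sp vec.span_base by blast
  have j': "Suc n - j \<in> {1..n}" using j by auto
  have "0 = b (\<Sum>i\<in>{1..n}. f i *s e i) (e (Suc n - j))" using 0 eV[OF j'] by (simp add: zero_left)
  also have "\<dots> = (\<Sum>i\<in>{1..n}. f i * b (e i) (e (Suc n - j)))"
    using eV j' by (subst sum_left) (auto simp: mem_V bilin)
  also have "\<dots> = f j * b (e j) (e (Suc n - j))"
  proof (rule sum_single[OF finite_atLeastAtMost j])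
    show "f i * b (e i) (e (Suc n - j)) = 0" if "i \<in> {1..n} - {j}" for i
      using pair[of i "Suc n - j"] j' that j by auto
  qed
  finally show ?thesis using pair[OF j j'] j by auto
qed

lemma subspace_pr: "vec.subspace (V i) \<Longrightarrow> vec.subspace L \<Longrightarrow> vec.subspace (pr V i L)"
proof (rule vec.subspaceI)
  assume V: "vec.subspace (V i)" and L: "vec.subspace L"
  have B: "vec.subspace (B_le V i)" "vec.subspace (B_lt V i)" unfolding B_le_def B_lt_def by auto
  have LB: "vec.subspace (L \<inter> B_le V i)" by (rule vec.subspace_inter[OF L B(1)])
  show "0 \<in> pr V i L"
    unfolding pr_def using vec.subspace_0[OF V] vec.subspace_0[OF LB] vec.subspace_0[OF B(2)] by force
  fix u v and r :: complex assume u: "u \<in> pr V i L"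
  then obtain h where h: "u \<in> V i" "h \<in> L \<inter> B_le V i" "h - u \<in> B_lt V i" unfolding pr_def by blast
  have "r *s h - r *s u \<in> B_lt V i" using vec.subspace_scale[OF B(2) h(3), of r] by (simp add: vec.scale_right_diff_distrib)
  then show "r *s u \<in> pr V i L"
    unfolding pr_def using vec.subspace_scale[OF V h(1)] vec.subspace_scale[OF LB h(2)] by blast
  assume "v \<in> pr V i L"
  then obtain h' where h': "v \<in> V i" "h' \<in> L \<inter> B_le V i" "h' - v \<in> B_lt V i" unfolding pr_def by blast
  have "h + h' - (u + v) \<in> B_lt V i" using vec.subspace_add[OF B(2) h(3) h'(3)] by (simp add: algebra_simps)
  then show "u + v \<in> pr V i L"
    unfolding pr_def using vec.subspace_add[OF V h(1) h'(1)] vec.subspace_add[OF LB h(2) h'(2)] by blast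
qed

lemma reflexive_form_exists:
  assumes "vec.subspace V" "bilinear_form_on V b" "symmetric_on V b \<or> skew_symmetric_on V b"
  shows "\<exists>\<epsilon>. reflexive_form V b \<epsilon>"
  using assms(3)
proof
  assume sym: "symmetric_on V b"
  have "reflexive_form V b 1"
  proof
    show "b u v = 1 * b v u" if "u \<in> V" "v \<in> V" for u v
      using sym that by (simp add: symmetric_on_def)
  qed (use assms in auto)
  then show ?thesis ..
next
  assume skew: "skew_symmetric_on V b"
  have "reflexive_form V b (-1)"
  proof
    show "b u v = -1 * b v u" if "u \<in> V" "v \<in> V" for u v
      unfolding mult_minus1 using skew that unfolding skew_symmetric_on_def by blast
  qed (use assms in auto)
  then show ?thesis ..
qed

lemma fibre_exists:
  fixes V :: "nat \<Rightarrow> (complex ^ 'n) set"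
  assumes V: "internal_direct_sum m V"
    and bil: "\<And>i. i \<in> {1..m} \<Longrightarrow> bilinear_form_on (V i) (b i)"
    and nd: "\<And>i. i \<in> {1..m} \<Longrightarrow> nondegenerate_on (V i) (b i)"
    and symm: "\<And>i. i \<in> {1..m} \<Longrightarrow> symmetric_on (V i) (b i) \<or> skew_symmetric_on (V i) (b i)"
    and lab: "\<And>i. i \<in> {1..m} \<Longrightarrow> symmetric_on (V i) (b i) \<Longrightarrow> even (vec.dim (V i))
           \<Longrightarrow> lagrangian_labelling (V i) (b i) (C1 i) (C2 i)"
    and Omega: "(ks, rs) \<in> Omega m V b k" and M: "vec.subspace M"
  obtains T E blk star c \<epsilon> reg where "fibre T E blk star c \<epsilon> m V b C1 C2 ks rs M reg"
    "\<And>i. i \<in> {1..m} \<Longrightarrow> \<exists>l. rad (V i) (b i) (pr V i M) + B_lt V i = frame.coord_subspace T E {t \<in> T. t > l}"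
proof -
  have sV: "vec.subspace (V i)" if "i \<in> {1..m}" for i
    using V that by (auto simp: internal_direct_sum_def)
  obtain \<epsilon> where \<epsilon>: "\<And>i. i \<in> {1..m} \<Longrightarrow> reflexive_form (V i) (b i) (\<epsilon> i)"
    using reflexive_form_exists[OF sV bil symm] by metis
  define F where "F i n e r I \<nu> \<longleftrightarrow> witt_frame (V i) (b i) (\<epsilon> i) (pr V i M) n e r I \<nu>" for i n e r I \<nu>
  have "\<exists>n e r I \<nu>. F i n e r I \<nu>" if i: "i \<in> {1..m}" for i
    unfolding F_def
    by (rule witt_frame_exists[OF \<epsilon>[OF i] nd[OF i] subspace_pr[where V = V and i = i, OF sV[OF i] M]]) (auto simp: pr_def)
  then obtain n e r I \<nu> where F: "\<And>i. i \<in> {1..m} \<Longrightarrow> F i (n i) (e i) (r i) (I i) (\<nu> i)" by metis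
  have sp: "vec.span (e i ` {1..n i}) = V i"
    and pair: "j \<in> {1..n i} \<Longrightarrow> l \<in> {1..n i} \<Longrightarrow> b i (e i j) (e i l) \<noteq> 0 \<longleftrightarrow> j + l = Suc (n i)"
    and rI: "{1..r i} \<subseteq> I i" and In: "I i \<subseteq> {1..n i - r i}"
    and rad: "rad (V i) (b i) (pr V i M) = vec.span (e i ` {1..r i})" and prM: "pr V i M = vec.span (\<nu> i ` I i)"
    and \<nu>: "j \<in> I i \<Longrightarrow> \<nu> i j = e i j \<and> j \<le> r i \<or> \<nu> i j = e i j \<and> Suc (n i) - j \<in> I i \<or>
        \<epsilon> i = 1 \<and> 2 * j = n i + 2 \<and> j - 1 \<notin> I i \<and> \<nu> i j = e i j - e i (j - 1)" if "i \<in> {1..m}" for i j l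
    using F[OF that] unfolding F_def witt_frame_def by blast+
  \<comment> \<open>A radix exceeding all \<open>n i\<close>: position \<open>j\<close> of block
    \<open>i\<close> becomes \<open>i * K + j\<close>, and the order of natural numbers is the
    lexicographic one with the block first.\<close>
  define K where "K = Suc (\<Sum>i\<in>{1..m}. n i)"
  have nK: "n i < K" if "i \<in> {1..m}" for i
    using member_le_sum[of i "{1..m}" n] that by (simp add: K_def)
  define E where "E t = e (t div K) (t mod K)" for t
  define blk where "blk t = t div K" for t
  \<comment> \<open>The reflection of \<open>j\<close> to \<open>Suc (n i) - j\<close> inside the
    block, expressed without decoding \<open>j\<close>.\<close>
  define star where "star t = 2 * (t div K * K) + Suc (n (t div K)) - t" for t
  define T where "T = (\<lambda>(i, j). i * K + j) ` Sigma {1..m} (\<lambda>i. {1..n i})"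
  define c where "c t = b (blk t) (E t) (E (star t))" for t
  have dm: "(i * K + j) div K = i" "(i * K + j) mod K = j" if "i \<in> {1..m}" "j \<in> {1..n i}" for i j
    using nK[OF that(1)] that(2) by auto
  have TI: "i * K + j \<in> T" if "i \<in> {1..m}" "j \<in> {1..n i}" for i j
    unfolding T_def using that by (intro image_eqI[of _ _ "(i, j)"]) auto
  have TE: "\<exists>i\<in>{1..m}. \<exists>j\<in>{1..n i}. t = i * K + j" if "t \<in> T" for t
    using that unfolding T_def by auto
  have ij: "blk (i * K + j) = i" "E (i * K + j) = e i j" "star (i * K + j) = i * K + (Suc (n i) - j)"
    if "i \<in> {1..m}" "j \<in> {1..n i}" for i j
    using dm[OF that] that(2) unfolding blk_def E_def star_def atLeastAtMost_iff by (simp_all only:, linarith)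
  have inj: "inj_on (\<lambda>(i, j). i * K + j) (Sigma {1..m} (\<lambda>i. {1..n i}))"
    by (rule inj_on_inverseI[where g = "\<lambda>t. (t div K, t mod K)"]) (use dm in auto)
  have sumT: "(\<Sum>t\<in>T. g t) = (\<Sum>i\<in>{1..m}. \<Sum>j\<in>{1..n i}. g (i * K + j))" for g :: "nat \<Rightarrow> complex ^ 'n"
    unfolding T_def by (subst sum.reindex[OF inj]) (simp add: sum.Sigma case_prod_unfold)
  have eV: "e i j \<in> V i" if "i \<in> {1..m}" "j \<in> {1..n i}" for i j
    unfolding sp[OF that(1), symmetric] by (rule vec.span_base) (use that(2) in blast)
  have finT: "finite T" by (simp add: T_def)
  have EV: "E t \<in> V (blk t)" "blk t \<in> {1..m}" if t: "t \<in> T" for t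
  proof -
    obtain i j where tij: "i \<in> {1..m}" "j \<in> {1..n i}" "t = i * K + j" using TE[OF t] by blast
    show "E t \<in> V (blk t)" "blk t \<in> {1..m}"
      unfolding tij(3) ij[OF tij(1,2)] by (rule eV[OF tij(1,2)]) (rule tij(1))
  qed
  have blkT: "{t \<in> T. blk t = i} = (\<lambda>j. i * K + j) ` {1..n i}" if i: "i \<in> {1..m}" for i
  proof (intro equalityI subsetI)
    fix t assume t: "t \<in> {t \<in> T. blk t = i}"
    then obtain i' j where tij: "i' \<in> {1..m}" "j \<in> {1..n i'}" "t = i' * K + j" using TE by blast
    then show "t \<in> (\<lambda>j. i * K + j) ` {1..n i}" using ij(1)[OF tij(1,2)] t by simp
  next
    fix t assume "t \<in> (\<lambda>j. i * K + j) ` {1..n i}"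
    then obtain j where "j \<in> {1..n i}" "t = i * K + j" by blast
    then show "t \<in> {t \<in> T. blk t = i}" using ij(1)[OF i] TI[OF i] by simp
  qed
  have Eblk: "E ` {t \<in> T. blk t = i} = e i ` {1..n i}" if "i \<in> {1..m}" for i
    unfolding blkT[OF that] image_image by (rule image_cong) (use ij that in auto)
  have unique: "u i = 0" if u: "\<And>i. i \<in> {1..m} \<Longrightarrow> u i \<in> V i" "(\<Sum>i\<in>{1..m}. u i) = 0" and i: "i \<in> {1..m}" for u i
  proof -
    have "\<exists>!w. w \<in> (\<Pi>\<^sub>E i\<in>{1..m}. V i) \<and> (0 :: complex ^ 'n) = (\<Sum>i\<in>{1..m}. w i)"
      using V unfolding internal_direct_sum_def by (elim conjE allE)
    moreover have "restrict u {1..m} \<in> (\<Pi>\<^sub>E i\<in>{1..m}. V i) \<and> 0 = (\<Sum>i\<in>{1..m}. restrict u {1..m} i)"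
      using u by auto
    moreover have "restrict (\<lambda>_. 0) {1..m} \<in> (\<Pi>\<^sub>E i\<in>{1..m}. V i) \<and>
        (0 :: complex ^ 'n) = (\<Sum>i\<in>{1..m}. restrict (\<lambda>_. 0) {1..m} i)"
      using sV by (auto simp: vec.subspace_0)
    ultimately have "restrict u {1..m} = restrict (\<lambda>_. 0) {1..m}" by blast
    then show ?thesis using i by (metis restrict_apply')
  qed
  have zero: "f t = 0" if f: "(\<Sum>t\<in>T. f t *s E t) = 0" and t: "t \<in> T" for f t
  proof -
    obtain i j where tij: "i \<in> {1..m}" "j \<in> {1..n i}" "t = i * K + j" using TE[OF t] by blast
    let ?u = "\<lambda>i. \<Sum>j\<in>{1..n i}. f (i * K + j) *s e i j"
    have "(\<Sum>i\<in>{1..m}. ?u i) = (\<Sum>t\<in>T. f t *s E t)"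
      unfolding sumT by (rule sum.cong[OF refl], rule sum.cong[OF refl]) (simp only: ij(2))
    then have 0: "(\<Sum>i\<in>{1..m}. ?u i) = 0" using f by simp
    have uV: "?u i \<in> V i" if i: "i \<in> {1..m}" for i
      by (rule vec.subspace_sum[OF sV[OF i]]) (rule vec.subspace_scale[OF sV[OF i] eV[OF i]])
    have "?u i = 0" by (rule unique[OF uV 0 tij(1)])
    then show ?thesis
      using reflexive_form.witt_frame_coefficients_zero[OF \<epsilon>[OF tij(1)] F[OF tij(1), unfolded F_def],
          of "\<lambda>j. f (i * K + j)" j] tij by simp
  qed
  have spanE: "vec.span (E ` T) = UNIV"
  proof -
    have "x \<in> vec.span (E ` T)" for x
    proof -
      obtain u where u: "u \<in> (\<Pi>\<^sub>E i\<in>{1..m}. V i)" "x = (\<Sum>i\<in>{1..m}. u i)"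
        using V unfolding internal_direct_sum_def by blast
      have "u i \<in> vec.span (E ` T)" if i: "i \<in> {1..m}" for i
      proof -
        have "u i \<in> V i" using u(1) i by auto
        then have "u i \<in> vec.span (E ` {t \<in> T. blk t = i})" using sp[OF i] Eblk[OF i] by simp
        then show ?thesis using vec.span_mono[of "E ` {t \<in> T. blk t = i}" "E ` T"] by blast
      qed
      then show ?thesis unfolding u(2) by (intro vec.span_sum)
    qed
    then show ?thesis by blast
  qed
  interpret frame T E
    by (unfold_locales) (use finT spanE independent_family[OF finT, of E] zero in blast)+
  have star_facts: "star t \<in> T" "blk (star t) = blk t" "star (star t) = t" if "t \<in> T" for t
  proof -
    obtain i j where tij: "i \<in> {1..m}" "j \<in> {1..n i}" "t = i * K + j" using TE[OF \<open>t \<in> T\<close>] by blast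
    have j': "Suc (n i) - j \<in> {1..n i}" "Suc (n i) - (Suc (n i) - j) = j" using tij(2) by auto
    show "star t \<in> T" "blk (star t) = blk t" "star (star t) = t"
      using tij(3) ij[OF tij(1,2)] ij[OF tij(1) j'(1)] TI[OF tij(1) j'(1)] j'(2) by auto
  qed
  have pairT: "b i (E s) (E t) \<noteq> 0 \<longleftrightarrow> s = star t"
    if s: "s \<in> T" "blk s = i" and t: "t \<in> T" "blk t = i" for s t i
  proof -
    have i: "i \<in> {1..m}" using EV(2)[OF t(1)] t(2) by simp
    obtain j where j: "j \<in> {1..n i}" "s = i * K + j" using s blkT[OF i] by blast
    obtain l where l: "l \<in> {1..n i}" "t = i * K + l" using t blkT[OF i] by blast
    have "s = star t \<longleftrightarrow> j + l = Suc (n i)" unfolding j(2) l(2) ij(3)[OF i l(1)] using l(1) by auto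
    then show ?thesis using pair[OF i j(1) l(1)] unfolding j(2) l(2) ij(2)[OF i j(1)] ij(2)[OF i l(1)] by blast
  qed
  have V_eq: "V i = coord_subspace {t \<in> T. blk t \<noteq> i}" if i: "i \<in> {1..m}" for i
  proof -
    have "T - {t \<in> T. blk t \<noteq> i} = {t \<in> T. blk t = i}" by auto
    then show ?thesis
      using coord_subspace_eq_span[of "{t \<in> T. blk t \<noteq> i}"] Eblk[OF i] sp[OF i] by auto
  qed
  have gs: "graded_space T E blk star c \<epsilon> m V"
  proof unfold_locales
    show "s + star s = t + star t" if s: "s \<in> T" and t: "t \<in> T" and st: "blk s = blk t" for s t
    proof -
      obtain i j where ts: "i \<in> {1..m}" "j \<in> {1..n i}" "s = i * K + j" using TE[OF s] by blast
      obtain i' l where tt: "i' \<in> {1..m}" "l \<in> {1..n i'}" "t = i' * K + l" using TE[OF t] by blast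
      have "i' = i" using st unfolding ts(3) tt(3) ij(1)[OF ts(1,2)] ij(1)[OF tt(1,2)] by simp
      then show ?thesis using ts(2) tt(2) unfolding ts(3) tt(3) ij(3)[OF ts(1,2)] ij(3)[OF tt(1,2)] by auto
    qed
    fix t assume t: "t \<in> T"
    note EV = EV[OF t] EV[OF star_facts(1)[OF t], unfolded star_facts(2)[OF t]]
    interpret rf: reflexive_form "V (blk t)" "b (blk t)" "\<epsilon> (blk t)" by (rule \<epsilon>[OF EV(2)])
    show "c t \<noteq> 0" using pairT[OF t refl star_facts(1,2)[OF t]] star_facts[OF t] by (simp add: c_def)
    show "c (star t) = \<epsilon> (blk t) * c t"
      using rf.reflexive[OF EV(3,1)] star_facts[OF t] by (simp add: c_def)
    show "\<epsilon> (blk t) = 1 \<or> \<epsilon> (blk t) = -1" by (rule rf.sign)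
  qed (use star_facts EV V_eq in \<open>auto simp: blk_def div_le_mono\<close>)
  interpret graded_space T E blk star c \<epsilon> m V by (rule gs)
  have form_eq: "b i u v = form u v" if i: "i \<in> {1..m}" and u: "u \<in> V i" and v: "v \<in> V i" for i u v
  proof -
    interpret rf: reflexive_form "V i" "b i" "\<epsilon> i" by (rule \<epsilon>[OF i])
    let ?B = "{t \<in> T. blk t = i}"
    have fB: "finite ?B" using finT by simp
    have EB: "E t \<in> V i" if "t \<in> ?B" for t using EV[of t] that by auto
    have exp: "w = (\<Sum>t\<in>?B. co t w *s E t)" if "w \<in> V i" for w
      using block_proj_V[OF i that] by (simp add: block_proj_def)
    have right: "b i (E s) v = co (star s) v * c s" if s: "s \<in> ?B" for s
    proof -
      have ss: "star s \<in> ?B" using star_facts s by auto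
      have "b i v (E s) = b i (\<Sum>t\<in>?B. co t v *s E t) (E s)" using exp[OF v] by simp
      also have "\<dots> = (\<Sum>t\<in>?B. co t v * b i (E t) (E s))"
        using EB s by (subst rf.sum_left) (auto simp: rf.mem_V rf.bilin)
      also have "\<dots> = co (star s) v * b i (E (star s)) (E s)"
      proof (rule sum_single[OF fB ss])
        show "co t v * b i (E t) (E s) = 0" if "t \<in> ?B - {star s}" for t
          using pairT[where s = t and t = s and i = i] that s by auto
      qed
      finally have "b i (E s) v = \<epsilon> i * (co (star s) v * b i (E (star s)) (E s))"
        using rf.reflexive[OF EB[OF s] v] by simp
      also have "b i (E (star s)) (E s) = \<epsilon> i * c s"
        using rf.reflexive[OF EB[OF ss] EB[OF s]] s by (simp add: c_def)
      finally show ?thesis using rf.sign_square by (simp add: algebra_simps)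
    qed
    have "b i u v = b i (\<Sum>s\<in>?B. co s u *s E s) v" using exp[OF u] by simp
    also have "\<dots> = (\<Sum>s\<in>?B. co s u * b i (E s) v)"
      using EB v by (subst rf.sum_left) (auto simp: rf.mem_V rf.bilin)
    also have "\<dots> = (\<Sum>s\<in>?B. co s u * co (star s) v * c s)"
      by (rule sum.cong[OF refl]) (simp only: right mult.assoc)
    also have "\<dots> = form u v"
      unfolding form_def
      by (rule sum.mono_neutral_left) (use finT u V_eq[OF i] in \<open>auto simp: coord_subspace_def\<close>)
    finally show ?thesis .
  qed
  have I_n: "j \<in> {1..n i}" if "i \<in> {1..m}" "j \<in> I i" for i j
    using subsetD[OF In[OF that(1)] that(2)] diff_le_self[of "n i" "r i"] unfolding atLeastAtMost_iff by linarith
  have co_e: "co (i * K + l) (e i j) = (if l = j then 1 else 0)" if "i \<in> {1..m}" "j \<in> {1..n i}" for i j l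
    using co_E[OF TI[OF that], of "i * K + l"] ij(2)[OF that] by simp
  have co_e': "co s (e i j) = (if s = i * K + j then 1 else 0)" if "i \<in> {1..m}" "j \<in> {1..n i}" for i j s
    using co_E[OF TI[OF that], of s] ij(2)[OF that] by simp
  have lead_\<nu>: "lead (i * K + j) (\<nu> i j)" if i: "i \<in> {1..m}" and j: "j \<in> I i" for i j
    using \<nu>[OF i j]
  proof (elim disjE conjE)
    assume *: "2 * j = n i + 2" "\<nu> i j = e i j - e i (j - 1)"
    then have "j - 1 \<in> {1..n i}" using I_n[OF i j] by auto
    then show ?thesis using * co_e'[OF i I_n[OF i j]] co_e'[OF i, of "j - 1"] by (auto simp: lead_def co_diff)
  qed (use co_e'[OF i I_n[OF i j]] in \<open>auto simp: lead_def\<close>)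
  have jumps_pr: "jumps (pr V i M) = (\<lambda>j. i * K + j) ` I i" if i: "i \<in> {1..m}" for i
  proof -
    let ?J = "(\<lambda>j. i * K + j) ` I i"
    have fI: "finite (I i)" using In[OF i] finite_subset by blast
    have "(\<lambda>t. \<nu> i (t mod K)) ` ?J = \<nu> i ` I i"
      unfolding image_image by (rule image_cong) (use dm(2)[OF i I_n[OF i]] in auto)
    moreover have "jumps (vec.span ((\<lambda>t. \<nu> i (t mod K)) ` ?J)) = ?J"
      by (rule jumps_span(1)) (use fI lead_\<nu>[OF i] dm(2)[OF i I_n[OF i]] in auto)
    ultimately show ?thesis using prM[OF i] by simp
  qed
  have lead_proj: "block_proj (blk t) h \<in> pr V (blk t) M \<and> lead t (block_proj (blk t) h)"
    if h: "h \<in> M" "lead t h" for t h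
  proof -
    have t: "t \<in> T" using lead_in_T[OF h(2)] .
    have "co s h = 0" if "s \<in> T" "blk t < blk s" for s
      using h(2) blk_mono[OF that(1) t] that(2) by (cases "s > t") (auto simp: lead_def)
    then have "h \<in> B_le V (blk t)" using B_le_eq[OF EV(2)[OF t]] by (auto simp: coord_subspace_def)
    then have "block_proj (blk t) h \<in> pr V (blk t) M" using pr_eq[OF EV(2)[OF t]] h(1) by auto
    moreover have "lead t (block_proj (blk t) h)" using h(2) t by (auto simp: lead_def co_block_proj)
    ultimately show ?thesis by blast
  qed
  have jumps_M: "i * K + j \<in> jumps M \<longleftrightarrow> j \<in> I i" if i: "i \<in> {1..m}" and j: "j \<in> {1..n i}" for i j
  proof
    assume "i * K + j \<in> jumps M"
    then obtain h where "h \<in> M" "lead (i * K + j) h" by (auto simp: jumps_def)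
    from lead_proj[OF this] have "i * K + j \<in> jumps (pr V i M)" using ij(1)[OF i j] by (auto simp: jumps_def)
    then show "j \<in> I i" unfolding jumps_pr[OF i] by auto
  next
    assume "j \<in> I i"
    then have "i * K + j \<in> jumps (pr V i M)" using jumps_pr[OF i] by auto
    then obtain v where v: "v \<in> pr V i M" "lead (i * K + j) v" by (auto simp: jumps_def)
    then obtain h where h: "h \<in> M \<inter> B_le V i" "h - v \<in> B_lt V i" unfolding pr_def by auto
    have eq: "co s h = co s v" if "s \<in> T" "i \<le> blk s" for s
      using h(2) that B_lt_eq[OF i] by (auto simp: coord_subspace_def co_diff)
    have "co s h = 0" if "s > i * K + j" for s
    proof (cases "s \<in> T")
      case True
      then have "i \<le> blk s" using blk_mono[OF TI[OF i j] True] ij(1)[OF i j] that by simp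
      then show ?thesis using eq[OF True] v(2) that by (simp add: lead_def)
    qed (rule co_outside)
    moreover have "co (i * K + j) h = 1" using eq[OF TI[OF i j]] ij(1)[OF i j] v(2) by (simp add: lead_def)
    ultimately have "lead (i * K + j) h" by (simp add: lead_def)
    then show "i * K + j \<in> jumps M" using h(1) by (auto simp: jumps_def)
  qed
  \<comment> \<open>The positions of the first two alternatives for \<open>\<nu>\<close> in
    \<open>witt_frame\<close>, radical vectors and basis vectors whose dual position also belongs to
    \<open>I i\<close>.\<close>
  define reg where "reg = {i * K + j | i j. i \<in> {1..m} \<and> j \<in> I i \<and> \<nu> i j = e i j \<and> (j \<le> r i \<or> Suc (n i) - j \<in> I i)}"
  have special: "\<epsilon> (blk t) = 1 \<and> Suc (star t) = t \<and> (\<forall>h\<in>M. lead t h \<longrightarrow> co (star t) h = -1)"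
    if t: "t \<in> jumps M" "t \<notin> reg" for t
  proof -
    have "t \<in> T" using t(1) jumps_subset by blast
    then obtain i j where tij: "i \<in> {1..m}" "j \<in> {1..n i}" "t = i * K + j" using TE by blast
    note i = tij(1) and f = ij[OF tij(1,2)]
    have jI: "j \<in> I i" using t(1) jumps_M[OF i tij(2)] tij(3) by simp
    then have sp: "\<epsilon> i = 1" "2 * j = n i + 2" "j - 1 \<notin> I i" "\<nu> i j = e i j - e i (j - 1)"
      using \<nu>[OF i jI] t(2) tij unfolding reg_def by blast+
    have j1: "j - 1 \<in> {1..n i}" "Suc (j - 1) = j" using sp(2) tij(2) by auto
    have st: "star t = i * K + (j - 1)" "Suc (star t) = t" using sp(2) tij(2,3) f(3) by auto
    \<comment> \<open>On the exceptional vector the two coordinates cancel, and the other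
      \<open>\<nu> i l\<close> have neither of the positions \<open>j\<close> and
      \<open>j - 1\<close>. So coordinate 1 at \<open>t\<close> forces -1 at
      \<open>star t\<close>.\<close>
    have "co (star t) y + co t y = 0" if "y \<in> pr V i M" for y
    proof -
      have "vec.subspace {y. co (star t) y + co t y = 0}"
        by (rule vec.subspaceI) (auto simp: co_simps algebra_simps simp flip: distrib_left)
      moreover have "\<nu> i l \<in> {y. co (star t) y + co t y = 0}" if l: "l \<in> I i" for l
      proof (cases "l = j")
        case True
        then show ?thesis
          unfolding True mem_Collect_eq sp(4) st(1) unfolding tij(3) co_diff co_e[OF i tij(2)] co_e[OF i j1(1)]
          using j1(2) by simp
      next
        case False
        then have "\<nu> i l = e i l" using \<nu>[OF i l] sp(2) by auto
        moreover have "l \<noteq> j - 1" using l sp(3) by auto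
        ultimately show ?thesis
          using False unfolding mem_Collect_eq st(1) unfolding tij(3) by (simp add: co_e[OF i I_n[OF i l]] del: One_nat_def)
      qed
      ultimately show ?thesis
        using vec.span_minimal[of "\<nu> i ` I i" "{y. co (star t) y + co t y = 0}"] that prM[OF i] by blast
    qed
    then have "co (star t) h = -1" if h: "h \<in> M" "lead t h" for h
      using lead_proj[OF h] h(2) f(1) tij(3) \<open>t \<in> T\<close> star_facts[OF \<open>t \<in> T\<close>]
      by (fastforce simp: co_block_proj lead_def add_eq_0_iff2)
    then show ?thesis using sp(1) st f(1) tij(3) by simp
  qed
  have regular_star: "star t \<in> jumps M" if t: "t \<in> reg" "s \<in> jumps M" "blk s = blk t" "star t < s" for s t
  proof -
    obtain i j where tij: "i \<in> {1..m}" "j \<in> I i" "t = i * K + j" "j \<le> r i \<or> Suc (n i) - j \<in> I i"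
      using t(1) unfolding reg_def by blast
    note i = tij(1) and jn = I_n[OF tij(1,2)]
    have "s \<in> {t \<in> T. blk t = i}" using t(2,3) jumps_subset[of M] ij(1)[OF i jn] tij(3) by auto
    then obtain l where l: "l \<in> {1..n i}" "s = i * K + l" unfolding blkT[OF i] by blast
    have lI: "l \<in> I i" using t(2) jumps_M[OF i l(1)] l(2) by simp
    have st: "star t = i * K + (Suc (n i) - j)" using ij(3)[OF i jn] tij(3) by simp
    have "Suc (n i) - j < l" using t(4) st l(2) by simp
    \<comment> \<open>For a radical \<open>j\<close> the dual position exceeds
      \<open>n i - r i\<close> and could not lie below \<open>l\<close>, so only the second
      alternative for \<open>j\<close> remains.\<close>
    moreover have "l \<le> n i - r i" using subsetD[OF In[OF i] lI] by simp
    ultimately have "Suc (n i) - j \<in> I i" using tij(4) jn by auto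
    then show ?thesis unfolding st using jumps_M[OF i I_n[OF i]] by blast
  qed
  \<comment> \<open>\<open>allowed_ranks\<close> admits \<open>Zero1\<close> and
    \<open>Zero2\<close> only for a symmetric form in the Lagrangian dimension, where the labelling
    is available.\<close>
  have lagr: "vec.dim (V i) = 2 * ks i \<and> lagrangian_labelling (V i) (b i) (C1 i) (C2 i)"
    if i: "i \<in> {1..m}" and z: "rs i = Zero1 \<or> rs i = Zero2" for i
  proof -
    have "rs i \<in> allowed_ranks (V i) (b i) (ks i)" using Omega i unfolding Omega_def by blast
    then have "symmetric_on (V i) (b i) \<and> vec.dim (V i) = 2 * ks i"
      using z unfolding allowed_ranks_def by (auto simp: Let_def split: if_splits)
    then show ?thesis using lab[OF i] by simp
  qed
  have stable: "P' \<in> C"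
    if i: "i \<in> {1..m}" and z: "rs i = Zero1 \<and> C = C1 i \<or> rs i = Zero2 \<and> C = C2 i" and P: "P \<in> C"
      "P \<in> Gr (ks i - rank_val (rs i)) (V i)" "P' \<in> Gr (ks i - rank_val (rs i)) (V i)"
      "\<forall>p\<in>P. \<forall>p'\<in>P. form p p' = 0" "\<forall>p\<in>P'. \<forall>p'\<in>P'. form p p' = 0" "jumps P' = jumps P" for i C P P'
  proof -
    have d: "vec.dim (V i) = 2 * ks i" "ks i - rank_val (rs i) = ks i" using lagr[OF i] z by auto
    obtain L where "C = SO_orbit (V i) (b i) L"
      using lagr[OF i] z unfolding lagrangian_labelling_def Let_def by auto
    then show ?thesis
      using lagrangian_orbit_stable[OF i bil[OF i] form_eq[OF i], of P L "ks i" P'] P d by auto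
  qed
  have "fibre T E blk star c \<epsilon> m V b C1 C2 ks rs M reg"
  proof (intro fibre.intro gs fibre_axioms.intro)
    show "P' \<in> C1 i" if "i \<in> {1..m}" "rs i = Zero1" "P \<in> C1 i"
      "P \<in> Gr (ks i - rank_val (rs i)) (V i)" "P' \<in> Gr (ks i - rank_val (rs i)) (V i)"
      "\<forall>p\<in>P. \<forall>p'\<in>P. form p p' = 0" "\<forall>p\<in>P'. \<forall>p'\<in>P'. form p p' = 0" "jumps P' = jumps P" for i P P'
      by (rule stable[of i "C1 i" P P']) (use that in auto)
    show "P' \<in> C2 i" if "i \<in> {1..m}" "rs i = Zero2" "P \<in> C2 i"
      "P \<in> Gr (ks i - rank_val (rs i)) (V i)" "P' \<in> Gr (ks i - rank_val (rs i)) (V i)"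
      "\<forall>p\<in>P. \<forall>p'\<in>P. form p p' = 0" "\<forall>p\<in>P'. \<forall>p'\<in>P'. form p p' = 0" "jumps P' = jumps P" for i P P'
      by (rule stable[of i "C2 i" P P']) (use that in auto)
  qed (fact form_eq M regular_star special)+
  \<comment> \<open>The radical occupies the first \<open>r i\<close> positions of its block, so
    together with all earlier blocks it spans a member of the flag.\<close>
  moreover have "rad (V i) (b i) (pr V i M) + B_lt V i = coord_subspace {t \<in> T. t > i * K + r i}" if i: "i \<in> {1..m}" for i
  proof -
    have rn: "r i \<le> n i"
    proof (cases "r i = 0")
      case False
      then have "r i \<in> {1..r i}" by simp
      then have "r i \<in> {1..n i}" using rI[OF i] I_n[OF i] by blast
      then show ?thesis by simp
    qed simp
    have "coord_subspace {t \<in> T. i \<le> blk t} = vec.span (E ` {t \<in> T. blk t < i})"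
      using coord_subspace_eq_span[of "{t \<in> T. i \<le> blk t}"] by (auto intro!: arg_cong[of _ _ "\<lambda>S. vec.span (E ` S)"])
    moreover have "e i ` {1..r i} = E ` ((\<lambda>j. i * K + j) ` {1..r i})"
      unfolding image_image by (rule image_cong) (use ij(2)[OF i] rn in auto)
    ultimately have "rad (V i) (b i) (pr V i M) + B_lt V i =
        vec.span (E ` ((\<lambda>j. i * K + j) ` {1..r i} \<union> {t \<in> T. blk t < i}))"
      unfolding rad[OF i] B_lt_eq[OF i] image_Un span_Un_plus by simp
    also have "(\<lambda>j. i * K + j) ` {1..r i} \<union> {t \<in> T. blk t < i} = T - {t \<in> T. t > i * K + r i}"
    proof (intro equalityI subsetI)
      fix t assume "t \<in> (\<lambda>j. i * K + j) ` {1..r i} \<union> {t \<in> T. blk t < i}"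
      then consider j where "j \<in> {1..r i}" "t = i * K + j" | "t \<in> T" "blk t < i" by blast
      then show "t \<in> T - {t \<in> T. t > i * K + r i}"
      proof cases
        case 1
        then show ?thesis using TI[OF i, of j] rn by auto
      next
        case 2
        have "\<not> t > i * K + r i"
        proof
          assume "t > i * K + r i"
          then have "(i * K) div K \<le> t div K" by (intro div_le_mono) simp
          moreover have "K \<noteq> 0" using nK[OF i] by simp
          ultimately show False using 2(2) by (simp add: blk_def)
        qed
        then show ?thesis using 2 by auto
      qed
    next
      fix t assume "t \<in> T - {t \<in> T. t > i * K + r i}"
      then have t: "t \<in> T" "t \<le> i * K + r i" by auto
      obtain i' j where tij: "i' \<in> {1..m}" "j \<in> {1..n i'}" "t = i' * K + j" using TE[OF t(1)] by blast
      have "i' \<le> i"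
      proof -
        have "t div K \<le> (i * K + r i) div K" using t(2) by (rule div_le_mono)
        moreover have "(i * K + r i) div K = i" using rn nK[OF i] by simp
        ultimately show ?thesis using dm(1)[OF tij(1,2)] tij(3) by simp
      qed
      then consider "i' = i" | "i' < i" by linarith
      then show "t \<in> (\<lambda>j. i * K + j) ` {1..r i} \<union> {t \<in> T. blk t < i}"
      proof cases
        case 1
        then show ?thesis using tij t(2) by auto
      next
        case 2
        then show ?thesis using t(1) ij(1)[OF tij(1,2)] tij(3) by auto
      qed
    qed
    finally show ?thesis using coord_subspace_eq_span[of "{t \<in> T. t > i * K + r i}"] by simp
  qed
  then have "\<And>i. i \<in> {1..m} \<Longrightarrow> \<exists>l. rad (V i) (b i) (pr V i M) + B_lt V i = coord_subspace {t \<in> T. t > l}"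
    by blast
  ultimately show thesis by (rule that)
qed

section \<open>The paving of the fibre\<close>

lemma finite_components: "finite (components m)" by (simp add: components_def)

context fibre
begin

text \<open>Indexes the flag of \<open>E\<close>: the member belonging to \<open>D\<close> is
  \<open>coord_subspace (T - D)\<close>, spanned by the basis vectors at positions in
  \<open>D\<close>.\<close>

definition "lower_sets = {D. D \<subseteq> T \<and> (\<forall>t\<in>D. \<forall>s\<in>T. s \<le> t \<longrightarrow> s \<in> D)}"

lemma same_jumps_iff:
  assumes L: "vec.subspace L" and L': "vec.subspace L'"
  shows "jumps L = jumps L' \<longleftrightarrow>
    (\<forall>D\<in>lower_sets. vec.dim (L \<inter> coord_subspace (T - D)) = vec.dim (L' \<inter> coord_subspace (T - D)))"
proof
  assume eq: "jumps L = jumps L'"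
  have "vec.dim (L \<inter> coord_subspace (T - D)) = vec.dim (L' \<inter> coord_subspace (T - D))" if D: "D \<in> lower_sets" for D
  proof -
    have low: "s \<in> D" if "t \<in> D" "s \<in> T" "s \<le> t" for s t using D that unfolding lower_sets_def by blast
    have "vec.dim (N \<inter> coord_subspace (T - D)) = card (jumps N \<inter> D)" if "vec.subspace N" for N
      by (rule jumps_Int_flag(2)[OF that]) (rule low)
    then show ?thesis using L L' eq by simp
  qed
  then show "\<forall>D\<in>lower_sets. vec.dim (L \<inter> coord_subspace (T - D)) = vec.dim (L' \<inter> coord_subspace (T - D))" ..
next
  assume *: "\<forall>D\<in>lower_sets. vec.dim (L \<inter> coord_subspace (T - D)) = vec.dim (L' \<inter> coord_subspace (T - D))"
  have "t \<in> jumps L \<longleftrightarrow> t \<in> jumps L'" if t: "t \<in> T" for t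
  proof -
    have "{s \<in> T. s \<le> t} \<in> lower_sets" "{s \<in> T. s < t} \<in> lower_sets" unfolding lower_sets_def by auto
    note dims = bspec[OF * this(1)] bspec[OF * this(2)]
    have "T - {s \<in> T. s \<le> t} = {s \<in> T. s > t}" "T - {s \<in> T. s < t} = {s \<in> T. s \<ge> t}" by auto
    with dims show ?thesis unfolding jumps_iff_dim[OF L t] jumps_iff_dim[OF L' t] by simp
  qed
  then show "jumps L = jumps L'" using jumps_subset by blast
qed

text \<open>The dimensions of the intersections of all components with all members of the flag are
  taken as the semicontinuous functions. Their common fibres are the sets of prescribed jumps, so
  the cells \<open>S\<close> apply.\<close>

lemma affine_paving_X:
  "\<exists>Ss. affine_paving (grassmann_atlas (components m)) X Ss \<and> (\<forall>S\<in>set Ss. \<forall>\<kappa>\<in>components m. \<forall>D\<in>lower_sets.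
     (\<lambda>x. vec.dim (x \<kappa> \<inter> coord_subspace (T - D))) constant_on S)"
proof -
  let ?A = "grassmann_atlas (components m) :: (component \<Rightarrow> (complex ^ 'n) set, _) atlas"
  define d where "d = (\<lambda>(\<kappa>, D) (x :: 'n point). vec.dim (x \<kappa> \<inter> coord_subspace (T - D)))"
  have ext: "x \<in> extensional (components m)" if "x \<in> X" for x using that X_iff by blast
  have "\<exists>Ss. affine_paving ?A X Ss \<and> (\<forall>S\<in>set Ss. \<forall>k\<in>components m \<times> lower_sets. d k constant_on S)"
  proof (rule affine_paving_by_fibres)
    have "finite (Pow T)" using finite_T by simp
    then have "finite lower_sets" by (rule rev_finite_subset) (auto simp: lower_sets_def)
    then show "finite (components m \<times> lower_sets)" using finite_components by blast
    show "d k x \<le> vec.dim (UNIV :: (complex ^ 'n) set)" for k x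
      unfolding d_def case_prod_unfold by (rule vec.dim_subset) simp
    show "\<exists>U. openin (zariski ?A) U \<and> x \<in> U \<and> (\<forall>y\<in>U \<inter> X. d k y \<le> d k x)"
      if k: "k \<in> components m \<times> lower_sets" and x: "x \<in> X" for k x
    proof -
      obtain \<kappa> D where kD: "k = (\<kappa>, D)" "\<kappa> \<in> components m" using k by blast
      show ?thesis
        using dim_Int_semicontinuous[OF ext[OF x] component_subspace[OF x] subspace_coord kD(2), of "T - D"]
        unfolding kD(1) d_def prod.case by blast
    qed
    then show "X \<subseteq> topspace (zariski ?A)"
    proof -
      have "x \<in> topspace (zariski ?A)" if x: "x \<in> X" for x
      proof -
        obtain W where W: "x \<in> grassmann_chart (components m) W"
          using transversal_grassmann_chart[OF ext[OF x] component_subspace[OF x] vec.subspace_UNIV] .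
        have "(grassmann_chart (components m) W, grassmann_coords (components m) W) \<in> ?A"
          unfolding grassmann_atlas_def by blast
        then show ?thesis using openin_subset[OF openin_zariski_chart] W by blast
      qed
      then show ?thesis by blast
    qed
    fix x0 assume x0: "x0 \<in> X"
    interpret fibre_point T E blk star c \<epsilon> m V b C1 C2 ks rs M reg x0
      using x0 by unfold_locales
    have "(\<forall>k\<in>components m \<times> lower_sets. d k x = d k x0) \<longleftrightarrow> (\<forall>\<kappa>\<in>components m. jumps (x \<kappa>) = J \<kappa>)"
      if x: "x \<in> X" for x
      using same_jumps_iff[OF component_subspace[OF x] component_subspace[OF x0]]
      by (simp add: d_def)
    then have "{x \<in> X. \<forall>k\<in>components m \<times> lower_sets. d k x = d k x0} = S" unfolding S_def by blast
    then show "\<exists>e. isomorphic_varieties ?A {x \<in> X. \<forall>k\<in>components m \<times> lower_sets. d k x = d k x0}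
        (affine_atlas e) (affine_space e)"
      using S_isomorphic_affine by simp
  qed
  then show ?thesis unfolding d_def by simp
qed

end

theorem lemma6p5:
  fixes m k :: nat
    and V :: "nat \<Rightarrow> (complex ^ 'n) set"
    and b :: "nat \<Rightarrow> complex ^ 'n \<Rightarrow> complex ^ 'n \<Rightarrow> complex"
    and C1 C2 :: "nat \<Rightarrow> (complex ^ 'n) set set"
    and ks :: "nat \<Rightarrow> nat" and rs :: "nat \<Rightarrow> rank_symbol"
    and M :: "(complex ^ 'n) set"
  assumes "internal_direct_sum m V"
    and "\<And>i. i \<in> {1..m} \<Longrightarrow> V i \<noteq> {0}"
    and "\<And>i. i \<in> {1..m} \<Longrightarrow> bilinear_form_on (V i) (b i)"
    and "\<And>i. i \<in> {1..m} \<Longrightarrow> nondegenerate_on (V i) (b i)"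
    and "\<And>i. i \<in> {1..m} \<Longrightarrow> symmetric_on (V i) (b i) \<or> skew_symmetric_on (V i) (b i)"
    and "\<And>i. i \<in> {1..m} \<Longrightarrow> symmetric_on (V i) (b i) \<Longrightarrow> even (vec.dim (V i))
           \<Longrightarrow> lagrangian_labelling (V i) (b i) (C1 i) (C2 i)"
    and "k \<le> vec.dim (UNIV :: (complex ^ 'n) set)"
    and "(ks, rs) \<in> Omega m V b k"
    and "M \<in> Gr k UNIV"
  shows "\<exists>Ss. affine_paving (grassmann_atlas (components m))
             {x \<in> X_var m V b C1 C2 ks rs. mu m x = M} Ss \<and>
           (\<forall>S\<in>set Ss. \<forall>i\<in>{1..m}.
              (\<lambda>x. vec.dim (x (Psub i) \<inter> B_lt V i)) constant_on S \<and>
              (\<lambda>x. vec.dim (x (Hsub i) \<inter> B_lt V i)) constant_on S \<and>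
              (\<lambda>x. vec.dim (x (Psub i) \<inter> (rad (V i) (b i) (pr V i M) + B_lt V i))) constant_on S)"
proof -
  have M: "vec.subspace M" using assms(9) by (simp add: Gr_def)
  obtain T E blk star c \<epsilon> reg where fib: "fibre T E blk star c \<epsilon> m V b C1 C2 ks rs M reg"
    and rad: "\<And>i. i \<in> {1..m} \<Longrightarrow>
      \<exists>l. rad (V i) (b i) (pr V i M) + B_lt V i = frame.coord_subspace T E {t \<in> T. t > l}"
    by (rule fibre_exists[OF assms(1,3-6,8) M]; (rule that)?; blast?)
  interpret fibre T E blk star c \<epsilon> m V b C1 C2 ks rs M reg by (rule fib)
  obtain Ss where Ss: "affine_paving (grassmann_atlas (components m)) X Ss"
    and const: "\<And>S \<kappa> D. S \<in> set Ss \<Longrightarrow> \<kappa> \<in> components m \<Longrightarrow> D \<in> lower_sets \<Longrightarrow>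
      (\<lambda>x. vec.dim (x \<kappa> \<inter> coord_subspace (T - D))) constant_on S"
    using affine_paving_X by blast
  have comp: "Psub i \<in> components m" "Hsub i \<in> components m" if "i \<in> {1..m}" for i
    using that by (auto simp: components_def)
  \<comment> \<open>Whole blocks form lower sets of \<open>T\<close>, which makes the constancy on
    the pieces part of their construction.\<close>
  have B_lt: "\<exists>D\<in>lower_sets. B_lt V i = coord_subspace (T - D)" if i: "i \<in> {1..m}" for i
  proof
    have "T - {t \<in> T. blk t < i} = {t \<in> T. i \<le> blk t}" by auto
    then show "B_lt V i = coord_subspace (T - {t \<in> T. blk t < i})" using B_lt_eq[OF i] by simp
    show "{t \<in> T. blk t < i} \<in> lower_sets" unfolding lower_sets_def using blk_mono by fastforce
  qed
  have rad_B_lt: "\<exists>D\<in>lower_sets. rad (V i) (b i) (pr V i M) + B_lt V i = coord_subspace (T - D)"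
    if i: "i \<in> {1..m}" for i
  proof -
    obtain l where l: "rad (V i) (b i) (pr V i M) + B_lt V i = coord_subspace {t \<in> T. t > l}" using rad[OF i] ..
    have "T - {t \<in> T. t \<le> l} = {t \<in> T. t > l}" by auto
    moreover have "{t \<in> T. t \<le> l} \<in> lower_sets" unfolding lower_sets_def by auto
    ultimately show ?thesis using l by metis
  qed
  show ?thesis
  proof (intro exI[of _ Ss] conjI ballI)
    show "affine_paving (grassmann_atlas (components m)) {x \<in> X_var m V b C1 C2 ks rs. mu m x = M} Ss"
      using Ss by (simp only: X_def)
    fix S i assume S: "S \<in> set Ss" and i: "i \<in> {1..m}"
    obtain D where D: "D \<in> lower_sets" "B_lt V i = coord_subspace (T - D)" using B_lt[OF i] by blast
    show "(\<lambda>x. vec.dim (x (Psub i) \<inter> B_lt V i)) constant_on S"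
      "(\<lambda>x. vec.dim (x (Hsub i) \<inter> B_lt V i)) constant_on S"
      unfolding D(2) by (intro const S comp i D(1))+
    obtain D' where D': "D' \<in> lower_sets"
      "rad (V i) (b i) (pr V i M) + B_lt V i = coord_subspace (T - D')" using rad_B_lt[OF i] by blast
    show "(\<lambda>x. vec.dim (x (Psub i) \<inter> (rad (V i) (b i) (pr V i M) + B_lt V i))) constant_on S"
      unfolding D'(2) by (intro const S comp i D'(1))
  qed
qed

end
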